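(* Let $\mathcal{D}=(G,\chi,g,0)$ be a group datum of nilpotent type with $n\ge 2$ the order of $\chi(g)$, let $H=H_{\mathcal D}$, and let $M(i,j)$ ($1\le i\le m$, $1\le j\le n$) be the indecomposable $H$-modules and $\tau$ the permutation of $\{1,\dots,m\}$ defined in the context. For $1\le i\le m$, the following isomorphisms of $H$-modules hold: (1) $M(1,2)\otimes M(i,j)\cong M(i,j)\otimes M(1,2)\cong M(i,j+1)\oplus M(\tau(i),j-1)$, for $2\le j\le n-1$. (2) $M(1,2)\otimes M(i,n)\cong M(i,n)\otimes M(1,2)\cong M(i,n)\oplus M(\tau(i),n)$.
   Context: $\mathbb{K}$ is an algebraically closed field of characteristic zero; modules are finite dimensional left modules; $\otimes=\otimes_{\mathbb K}$. Group datum: $G$ is a finite group, $g$ an element of the center of $G$, $\chi:G\to\mathbb{K}^\times$ a linear character, $q=\chi(g)$ has order $n\ge 2$. $H=H_{\mathcal D}$ is the $\mathbb K$-algebra generated by $y$ and the elements $h\in G$, containing $\mathbb{K}G$ as a subalgebra, with relations $y^n=0$ and $yh=\chi(h)hy$ for $h\in G$; it has basis $\{y^ih\mid h\in G,\ 0\le i\le n-1\}$. It is a Hopf algebra with $\Delta(y)=y\otimes g+1\otimes y$, $\varepsilon(y)=0$, $S(y)=-yg^{-1}$, and $\Delta(h)=h\otimes h$, $\varepsilon(h)=1$, $S(h)=h^{-1}$ for $h\in G$. $V_1,\dots,V_m$ is a complete set of non-isomorphic simple $\mathbb{K}G$-modules, with $V_1$ the trivial module; each is regarded as a simple $H$-module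 with $y$ acting by $0$. $V_{\chi^{t}}$ is the one-dimensional module with character $\chi^t$. $\tau$ is the permutation of $\{1,\dots,m\}$ with $V_{\chi^{-1}}\otimes V_i\cong V_i\otimes V_{\chi^{-1}}\cong V_{\tau(i)}$. For $1\le i\le m$, $1\le j\le n$, $M(i,j)=V_i\oplus xV_i\oplus\cdots\oplus x^{j-1}V_i$ (formal copies $x^kV_i$ of the vector space $V_i$), with $h(x^kv)=\chi^{-k}(h)\,x^k(hv)$ for $h\in G$, and $y(x^kv)=x^{k+1}v$ if $0\le k\le j-2$, $y(x^{j-1}v)=0$, for $v\in V_i$. Tensor products of $H$-modules are $H$-modules via $\Delta$. *)

theory Defs
  imports
    "HOL-Algebra.Ring"
    "HOL-Computational_Algebra.Polynomial"
    "HOL-Combinatorics.Permutations"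
    "HOL-Library.Function_Algebras"
    "HOL-Library.Product_Plus"
begin

section \<open>Finite-dimensional algebras and comultiplications on a basis\<close>

text \<open>
  An algebra (with comultiplication) is given by a finite basis \<^term>\<open>B\<close>, the coordinate
  functions of the products of basis elements, of the unit, and of the images of the basis
  elements under the comultiplication. Elements are the functions supported on \<^term>\<open>B\<close>; an
  element of \<open>A \<otimes> A\<close> is a function on pairs of basis elements.
\<close>

record ('b, 'k) balg =
  Bas :: "'b set"
  bmult :: "'b \<Rightarrow> 'b \<Rightarrow> 'b \<Rightarrow> 'k"
  bone :: "'b \<Rightarrow> 'k"

record ('b, 'k) bialg = "('b, 'k) balg" +
  bcomult :: "'b \<Rightarrow> 'b \<times> 'b \<Rightarrow> 'k"

definition bvec :: "'b \<Rightarrow> 'b \<Rightarrow> 'k::field" where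
  "bvec b = (\<lambda>x. if x = b then 1 else 0)"

definition alg_ring :: "('b, 'k::field, 'z) balg_scheme \<Rightarrow> ('b \<Rightarrow> 'k) ring" where
  "alg_ring A = \<lparr>carrier = {f. \<forall>x. x \<notin> Bas A \<longrightarrow> f x = 0},
     monoid.mult = (\<lambda>f f' x. \<Sum>p\<in>Bas A. \<Sum>q\<in>Bas A. f p * f' q * bmult A p q x),
     one = bone A, zero = (\<lambda>x. 0), add = (\<lambda>f f' x. f x + f' x)\<rparr>"

definition tensor_square :: "('b, 'k::field, 'z) balg_scheme \<Rightarrow> ('b \<times> 'b, 'k) balg" where
  "tensor_square A = \<lparr>Bas = Bas A \<times> Bas A,
     bmult = (\<lambda>(p, p') (q, q') (x, x'). bmult A p q x * bmult A p' q' x'),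
     bone = (\<lambda>(x, x'). bone A x * bone A x')\<rparr>"

definition comult :: "('b, 'k::field, 'z) bialg_scheme \<Rightarrow> ('b \<Rightarrow> 'k) \<Rightarrow> 'b \<times> 'b \<Rightarrow> 'k" where
  "comult A a = (\<lambda>pq. \<Sum>b\<in>Bas A. a b * bcomult A b pq)"

definition group_algebra :: "('g, 'y) monoid_scheme \<Rightarrow> ('g, 'k::field) bialg" where
  "group_algebra G = \<lparr>Bas = carrier G,
     bmult = (\<lambda>h h'. bvec (h \<otimes>\<^bsub>G\<^esub> h')), bone = bvec \<one>\<^bsub>G\<^esub>,
     bcomult = (\<lambda>h. bvec (h, h))\<rparr>"


section \<open>Group data of nilpotent type and their Hopf algebras\<close>

definition linear_character :: "('g, 'y) monoid_scheme \<Rightarrow> ('g \<Rightarrow> 'k::field) \<Rightarrow> bool" where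
  "linear_character G \<chi> \<longleftrightarrow> (\<forall>h\<in>carrier G. \<chi> h \<noteq> 0) \<and>
     (\<forall>h\<in>carrier G. \<forall>h'\<in>carrier G. \<chi> (h \<otimes>\<^bsub>G\<^esub> h') = \<chi> h * \<chi> h')"

definition nilpotent_datum ::
    "('g, 'y) monoid_scheme \<Rightarrow> ('g \<Rightarrow> 'k::field) \<Rightarrow> 'g \<Rightarrow> nat \<Rightarrow> bool" where
  "nilpotent_datum G \<chi> g n \<longleftrightarrow> group G \<and> finite (carrier G) \<and>
     g \<in> carrier G \<and> (\<forall>h\<in>carrier G. g \<otimes>\<^bsub>G\<^esub> h = h \<otimes>\<^bsub>G\<^esub> g) \<and>
     linear_character G \<chi> \<and>
     2 \<le> n \<and> \<chi> g ^ n = 1 \<and> (\<forall>k. 0 < k \<and> k < n \<longrightarrow> \<chi> g ^ k \<noteq> 1)"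

text \<open>
  The basis element \<open>y\<^sup>s h\<close> of \<open>H\<close> is indexed by the pair \<open>(s, h)\<close>. The structure constants
  follow from \<open>h y = \<chi>(h)\<^sup>-\<^sup>1 y h\<close> and \<open>y\<^sup>n = 0\<close>; lemma \<open>nilp_alg_relations\<close> below recovers
  the defining relations.
\<close>

definition nilp_alg ::
    "('g, 'y) monoid_scheme \<Rightarrow> ('g \<Rightarrow> 'k::field) \<Rightarrow> nat \<Rightarrow> (nat \<times> 'g, 'k) balg" where
  "nilp_alg G \<chi> n = \<lparr>Bas = {..<n} \<times> carrier G,
     bmult = (\<lambda>(s, h) (t, h') x.
        if s + t < n then inverse (\<chi> h) ^ t * bvec (s + t, h \<otimes>\<^bsub>G\<^esub> h') x else 0),
     bone = bvec (0, \<one>\<^bsub>G\<^esub>)\<rparr>"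

text \<open>
  \<open>\<Delta>(y\<^sup>s h) = (y \<otimes> g + 1 \<otimes> y)\<^sup>s (h \<otimes> h)\<close>, computed in \<open>H \<otimes> H\<close>. The counit and the antipode
  are not needed to form direct sums and tensor products of modules.
\<close>

definition nilp_comult :: "('g, 'y) monoid_scheme \<Rightarrow> ('g \<Rightarrow> 'k::field) \<Rightarrow> 'g \<Rightarrow> nat \<Rightarrow>
    nat \<times> 'g \<Rightarrow> (nat \<times> 'g) \<times> (nat \<times> 'g) \<Rightarrow> 'k" where
  "nilp_comult G \<chi> g n = (\<lambda>(s, h).
     let HH = alg_ring (tensor_square (nilp_alg G \<chi> n))
     in ((bvec ((1, \<one>\<^bsub>G\<^esub>), (0, g)) \<oplus>\<^bsub>HH\<^esub> bvec ((0, \<one>\<^bsub>G\<^esub>), (1, \<one>\<^bsub>G\<^esub>))) [^]\<^bsub>HH\<^esub> s)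
          \<otimes>\<^bsub>HH\<^esub> bvec ((0, h), (0, h)))"

definition nilp_hopf :: "('g, 'y) monoid_scheme \<Rightarrow> ('g \<Rightarrow> 'k::field) \<Rightarrow> 'g \<Rightarrow> nat \<Rightarrow>
    (nat \<times> 'g, 'k) bialg" where
  "nilp_hopf G \<chi> g n = balg.extend (nilp_alg G \<chi> n) \<lparr>bcomult = nilp_comult G \<chi> g n\<rparr>"


section \<open>Modules\<close>

text \<open>
  The underlying vector space of a module is a subspace \<open>mcar\<close> of an ambient vector space
  whose scalar multiplication is \<open>mscale\<close>; only the values of \<open>mact\<close> on \<open>mcar\<close> matter.
\<close>

record ('b, 'k, 'v) amod =
  mcar :: "'v set"
  mscale :: "'k \<Rightarrow> 'v \<Rightarrow> 'v"
  mact :: "('b \<Rightarrow> 'k) \<Rightarrow> 'v \<Rightarrow> 'v"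

definition linear_between ::
    "'v set \<Rightarrow> ('k \<Rightarrow> 'v \<Rightarrow> 'v) \<Rightarrow> ('k \<Rightarrow> 'w \<Rightarrow> 'w) \<Rightarrow> ('v::ab_group_add \<Rightarrow> 'w::ab_group_add) \<Rightarrow> bool" where
  "linear_between V s s' f \<longleftrightarrow>
     (\<forall>v\<in>V. \<forall>w\<in>V. f (v + w) = f v + f w) \<and> (\<forall>c. \<forall>v\<in>V. f (s c v) = s' c (f v))"

definition fin_module :: "('b, 'k::field, 'z) balg_scheme \<Rightarrow>
    ('b, 'k, 'v::ab_group_add) amod \<Rightarrow> bool" where
  "fin_module A M \<longleftrightarrow>
     vector_space (mscale M) \<and> module.subspace (mscale M) (mcar M) \<and>
     (\<exists>S. finite S \<and> module.span (mscale M) S = mcar M) \<and>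
     (\<forall>a\<in>carrier (alg_ring A). mact M a ` mcar M \<subseteq> mcar M \<and>
        linear_between (mcar M) (mscale M) (mscale M) (mact M a)) \<and>
     (\<forall>a\<in>carrier (alg_ring A). \<forall>b\<in>carrier (alg_ring A). \<forall>v\<in>mcar M.
        mact M (a \<oplus>\<^bsub>alg_ring A\<^esub> b) v = mact M a v + mact M b v \<and>
        mact M (a \<otimes>\<^bsub>alg_ring A\<^esub> b) v = mact M a (mact M b v)) \<and>
     (\<forall>a\<in>carrier (alg_ring A). \<forall>c. \<forall>v\<in>mcar M.
        mact M (\<lambda>x. c * a x) v = mscale M c (mact M a v)) \<and>
     (\<forall>v\<in>mcar M. mact M \<one>\<^bsub>alg_ring A\<^esub> v = v)"

definition module_iso :: "('b, 'k::field, 'z) balg_scheme \<Rightarrow>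
    ('b, 'k, 'v::ab_group_add) amod \<Rightarrow> ('b, 'k, 'w::ab_group_add) amod \<Rightarrow> bool" where
  "module_iso A M N \<longleftrightarrow> (\<exists>f. bij_betw f (mcar M) (mcar N) \<and>
     linear_between (mcar M) (mscale M) (mscale N) f \<and>
     (\<forall>a\<in>carrier (alg_ring A). \<forall>v\<in>mcar M. f (mact M a v) = mact N a (f v)))"

definition simple_module :: "('b, 'k::field, 'z) balg_scheme \<Rightarrow>
    ('b, 'k, 'v::ab_group_add) amod \<Rightarrow> bool" where
  "simple_module A M \<longleftrightarrow> fin_module A M \<and> mcar M \<noteq> {0} \<and>
     (\<forall>U. U \<subseteq> mcar M \<and> module.subspace (mscale M) U \<and>
        (\<forall>a\<in>carrier (alg_ring A). mact M a ` U \<subseteq> U) \<longrightarrow> U = {0} \<or> U = mcar M)"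

definition direct_sum :: "('b, 'k::field, 'v::ab_group_add) amod \<Rightarrow>
    ('b, 'k, 'w::ab_group_add) amod \<Rightarrow> ('b, 'k, 'v \<times> 'w) amod" where
  "direct_sum M N = \<lparr>mcar = mcar M \<times> mcar N,
     mscale = (\<lambda>c (v, w). (mscale M c v, mscale N c w)),
     mact = (\<lambda>a (v, w). (mact M a v, mact N a w))\<rparr>"


section \<open>Tensor products\<close>

text \<open>
  \<open>V \<otimes> W\<close> is realised as the span of the pure tensors in the dual of the space of bilinear
  forms on \<open>V \<times> W\<close>, where \<open>v \<otimes> w\<close> is evaluation at \<open>(v, w)\<close>. The functionals are set to \<open>0\<close>
  on functions that are not bilinear on \<open>V \<times> W\<close>. Lemma \<open>tensor_universal\<close> below is the
  universal property.
\<close>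

definition bilinear_between :: "'v set \<Rightarrow> 'w set \<Rightarrow> ('k \<Rightarrow> 'v \<Rightarrow> 'v) \<Rightarrow> ('k \<Rightarrow> 'w \<Rightarrow> 'w) \<Rightarrow>
    ('k \<Rightarrow> 'u \<Rightarrow> 'u) \<Rightarrow> ('v::ab_group_add \<Rightarrow> 'w::ab_group_add \<Rightarrow> 'u::ab_group_add) \<Rightarrow> bool" where
  "bilinear_between V W s s' s'' \<beta> \<longleftrightarrow>
     (\<forall>w\<in>W. linear_between V s s'' (\<lambda>v. \<beta> v w)) \<and> (\<forall>v\<in>V. linear_between W s' s'' (\<beta> v))"

definition bilinear_form :: "('b, 'k::field, 'v::ab_group_add) amod \<Rightarrow>
    ('b, 'k, 'w::ab_group_add) amod \<Rightarrow> ('v \<Rightarrow> 'w \<Rightarrow> 'k) \<Rightarrow> bool" where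
  "bilinear_form M N = bilinear_between (mcar M) (mcar N) (mscale M) (mscale N) (*)"

definition pure_tensor :: "('b, 'k::field, 'v::ab_group_add) amod \<Rightarrow>
    ('b, 'k, 'w::ab_group_add) amod \<Rightarrow> 'v \<Rightarrow> 'w \<Rightarrow> ('v \<Rightarrow> 'w \<Rightarrow> 'k) \<Rightarrow> 'k" where
  "pure_tensor M N v w = (\<lambda>\<beta>. if bilinear_form M N \<beta> then \<beta> v w else 0)"

definition tensor_map :: "('b, 'k::field, 'v::ab_group_add) amod \<Rightarrow>
    ('b, 'k, 'w::ab_group_add) amod \<Rightarrow> ('v \<Rightarrow> 'v) \<Rightarrow> ('w \<Rightarrow> 'w) \<Rightarrow>
    (('v \<Rightarrow> 'w \<Rightarrow> 'k) \<Rightarrow> 'k) \<Rightarrow> ('v \<Rightarrow> 'w \<Rightarrow> 'k) \<Rightarrow> 'k" where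
  "tensor_map M N \<phi> \<psi> t =
     (\<lambda>\<beta>. if bilinear_form M N \<beta> then t (\<lambda>v w. \<beta> (\<phi> v) (\<psi> w)) else 0)"

definition tensor :: "('b, 'k::field, 'z) bialg_scheme \<Rightarrow> ('b, 'k, 'v::ab_group_add) amod \<Rightarrow>
    ('b, 'k, 'w::ab_group_add) amod \<Rightarrow> ('b, 'k, ('v \<Rightarrow> 'w \<Rightarrow> 'k) \<Rightarrow> 'k) amod" where
  "tensor A M N = \<lparr>
     mcar = module.span (\<lambda>c t \<beta>. c * t \<beta>) {pure_tensor M N v w | v w. v \<in> mcar M \<and> w \<in> mcar N},
     mscale = (\<lambda>c t \<beta>. c * t \<beta>),
     mact = (\<lambda>a t \<beta>. \<Sum>p\<in>Bas A. \<Sum>q\<in>Bas A.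
       comult A a (p, q) * tensor_map M N (mact M (bvec p)) (mact N (bvec q)) t \<beta>)\<rparr>"


section \<open>The modules of the statement\<close>

definition char_module :: "('g, 'y) monoid_scheme \<Rightarrow> ('g \<Rightarrow> 'k::field) \<Rightarrow> ('g, 'k, 'k) amod" where
  "char_module G \<psi> = \<lparr>mcar = UNIV, mscale = (*),
     mact = (\<lambda>a v. (\<Sum>h\<in>carrier G. a h * \<psi> h) * v)\<rparr>"

text \<open>
  The completeness clause ranges over modules whose ambient space is \<open>'g \<Rightarrow> 'k\<close>. This is no
  restriction: a simple module is a quotient of the regular module, hence of dimension at most
  \<open>|G|\<close>, and so is isomorphic to one carried by a subspace of \<open>'g \<Rightarrow> 'k\<close>.
\<close>

definition complete_simples :: "('g, 'y) monoid_scheme \<Rightarrow> nat \<Rightarrow>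
    (nat \<Rightarrow> ('g, 'k::field, 'v::ab_group_add) amod) \<Rightarrow> bool" where
  "complete_simples G m V \<longleftrightarrow>
     (\<forall>i\<in>{1..m}. simple_module (group_algebra G :: ('g, 'k) bialg) (V i)) \<and>
     (\<forall>i\<in>{1..m}. \<forall>i'\<in>{1..m}.
        module_iso (group_algebra G :: ('g, 'k) bialg) (V i) (V i') \<longrightarrow> i = i') \<and>
     (\<forall>S :: ('g, 'k, 'g \<Rightarrow> 'k) amod. simple_module (group_algebra G :: ('g, 'k) bialg) S \<longrightarrow>
        (\<exists>i\<in>{1..m}. module_iso (group_algebra G :: ('g, 'k) bialg) S (V i)))"

text \<open>
  An element \<open>v\<^sub>0 + x v\<^sub>1 + \<dots> + x\<^sup>j\<^sup>-\<^sup>1 v\<^bsub>j-1\<^esub>\<close> of \<open>V \<oplus> xV \<oplus> \<dots> \<oplus> x\<^sup>j\<^sup>-\<^sup>1V\<close> is the sequence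
  of its coefficients, extended by \<open>0\<close>.
\<close>

definition M_grp :: "('g \<Rightarrow> 'k::field) \<Rightarrow> ('g, 'k, 'v::ab_group_add) amod \<Rightarrow>
    'g \<Rightarrow> (nat \<Rightarrow> 'v) \<Rightarrow> nat \<Rightarrow> 'v" where
  "M_grp \<chi> V h f = (\<lambda>k. mscale V (inverse (\<chi> h) ^ k) (mact V (bvec h) (f k)))"

definition M_y :: "nat \<Rightarrow> (nat \<Rightarrow> 'v::ab_group_add) \<Rightarrow> nat \<Rightarrow> 'v" where
  "M_y j f = (\<lambda>k. if 0 < k \<and> k < j then f (k - 1) else 0)"

definition M_module :: "('g, 'y) monoid_scheme \<Rightarrow> ('g \<Rightarrow> 'k::field) \<Rightarrow> nat \<Rightarrow>
    ('g, 'k, 'v::ab_group_add) amod \<Rightarrow> nat \<Rightarrow> (nat \<times> 'g, 'k, nat \<Rightarrow> 'v) amod" where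
  "M_module G \<chi> n V j = \<lparr>
     mcar = {f. (\<forall>k<j. f k \<in> mcar V) \<and> (\<forall>k\<ge>j. f k = 0)},
     mscale = (\<lambda>c f k. mscale V c (f k)),
     mact = (\<lambda>a f k. \<Sum>(s, h)\<in>{..<n} \<times> carrier G.
       mscale V (a (s, h)) ((M_y j ^^ s) (M_grp \<chi> V h f) k))\<rparr>"



section \<open>Checks of the definitions\<close>

lemma alg_ring_bvec_mult:
  assumes "finite (Bas A)" "p \<in> Bas A" "q \<in> Bas A"
  shows "bvec p \<otimes>\<^bsub>alg_ring A\<^esub> bvec q = bmult A p q"
proof
  fix x
  have "(\<Sum>p'\<in>Bas A. \<Sum>q'\<in>Bas A. bvec p p' * bvec q q' * bmult A p' q' x)
      = (\<Sum>p'\<in>Bas A. if p' = p then (\<Sum>q'\<in>Bas A. if q' = q then bmult A p q' x else 0) else 0)"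
    by (intro sum.cong refl) (auto simp: bvec_def intro!: sum.cong)
  also have "\<dots> = bmult A p q x"
    using assms by simp
  finally show "(bvec p \<otimes>\<^bsub>alg_ring A\<^esub> bvec q) x = bmult A p q x"
    by (simp add: alg_ring_def)
qed

lemma nilp_alg_ring:
  fixes G :: "('a, 'b) monoid_scheme" and \<chi> :: "'a \<Rightarrow> 'c::field"
  assumes "nilpotent_datum G \<chi> g n"
  shows "ring (alg_ring (nilp_alg G \<chi> n))"
proof -
  interpret group G using assms by (simp add: nilpotent_datum_def)
  define B where "B = {..<n} \<times> carrier G"
  define c where "c = bmult (nilp_alg G \<chi> n)"
  have fin: "finite B" using assms by (auto simp: nilpotent_datum_def B_def)
  have BB: "Bas (nilp_alg G \<chi> n) = B" by (simp add: nilp_alg_def B_def)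
  have n: "n \<ge> 2" using assms by (simp add: nilpotent_datum_def)
  have chi: "\<chi> h \<noteq> 0" "\<chi> (h \<otimes>\<^bsub>G\<^esub> h') = \<chi> h * \<chi> h'" if "h \<in> carrier G" "h' \<in> carrier G" for h h'
    using assms that by (auto simp: nilpotent_datum_def linear_character_def)
  have chi1: "\<chi> \<one>\<^bsub>G\<^esub> = 1"
    using chi[of "\<one>\<^bsub>G\<^esub>" "\<one>\<^bsub>G\<^esub>"] by simp
  have c0: "c p q x = 0" if "p \<in> B" "q \<in> B" "x \<notin> B" for p q x
    using that by (auto simp: c_def nilp_alg_def B_def bvec_def)
  have sel: "(\<Sum>z\<in>B. F z * c p q z) =
      (if fst p + fst q < n then inverse (\<chi> (snd p)) ^ fst q * F (fst p + fst q, snd p \<otimes>\<^bsub>G\<^esub> snd q) else 0)"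
    if "p \<in> B" "q \<in> B" for F p q
  proof -
    have "(\<Sum>z\<in>B. F z * c p q z) = (\<Sum>z\<in>B. if z = (fst p + fst q, snd p \<otimes>\<^bsub>G\<^esub> snd q) then
       (if fst p + fst q < n then inverse (\<chi> (snd p)) ^ fst q * F (fst p + fst q, snd p \<otimes>\<^bsub>G\<^esub> snd q) else 0) else 0)"
      by (intro sum.cong refl) (auto simp: c_def nilp_alg_def bvec_def split: prod.splits)
    also have "\<dots> = (if fst p + fst q < n then inverse (\<chi> (snd p)) ^ fst q * F (fst p + fst q, snd p \<otimes>\<^bsub>G\<^esub> snd q) else 0)"
      using that fin by (auto simp: B_def)
    finally show ?thesis .
  qed
  have assoc: "(\<Sum>z\<in>B. c z r x * c p q z) = (\<Sum>z\<in>B. c p z x * c q r z)"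
    if "p \<in> B" "q \<in> B" "r \<in> B" for p q r x
    unfolding sel[OF that(1,2)] sel[OF that(2,3)] using that
    by (auto simp: c_def nilp_alg_def B_def bvec_def chi m_assoc power_add power_mult_distrib)
  let ?R = "alg_ring (nilp_alg G \<chi> n)"
  have mult: "(a \<otimes>\<^bsub>?R\<^esub> b) x = (\<Sum>p\<in>B. \<Sum>q\<in>B. a p * b q * c p q x)" for a b x
    by (simp add: alg_ring_def BB c_def)
  have add: "(a \<oplus>\<^bsub>?R\<^esub> b) x = a x + b x" for a b x
    by (simp add: alg_ring_def)
  have car: "a \<in> carrier ?R \<longleftrightarrow> (\<forall>x. x \<notin> B \<longrightarrow> a x = 0)" for a
    by (simp add: alg_ring_def BB)
  have one: "\<one>\<^bsub>?R\<^esub> = bvec (0, \<one>\<^bsub>G\<^esub>)" by (simp add: alg_ring_def nilp_alg_def)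
  have clos: "a \<otimes>\<^bsub>?R\<^esub> b \<in> carrier ?R" for a b
    unfolding car mult by (auto simp: c0 intro!: sum.neutral)
  have rot: "(\<Sum>z\<in>B. \<Sum>q\<in>B. \<Sum>r\<in>B. F z q r) = (\<Sum>q\<in>B. \<Sum>r\<in>B. \<Sum>z\<in>B. F z q r)"
    for F :: "nat \<times> 'a \<Rightarrow> nat \<times> 'a \<Rightarrow> nat \<times> 'a \<Rightarrow> 'c"
    by (rule trans[OF sum.swap], rule sum.cong[OF refl], rule sum.swap)
  have as: "(a \<otimes>\<^bsub>?R\<^esub> b) \<otimes>\<^bsub>?R\<^esub> d = a \<otimes>\<^bsub>?R\<^esub> (b \<otimes>\<^bsub>?R\<^esub> d)" for a b d
  proof
    fix x
    have "((a \<otimes>\<^bsub>?R\<^esub> b) \<otimes>\<^bsub>?R\<^esub> d) x =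
       (\<Sum>z\<in>B. \<Sum>r\<in>B. \<Sum>p\<in>B. \<Sum>q\<in>B. a p * b q * d r * (c z r x * c p q z))"
      unfolding mult by (simp add: sum_distrib_left sum_distrib_right mult_ac)
    also have "\<dots> = (\<Sum>p\<in>B. \<Sum>q\<in>B. \<Sum>r\<in>B. \<Sum>z\<in>B. a p * b q * d r * (c z r x * c p q z))"
      by (rule trans[OF sum.cong[OF refl rot]], rule trans[OF sum.swap], rule sum.cong[OF refl], rule rot)
    also have "\<dots> = (\<Sum>p\<in>B. \<Sum>q\<in>B. \<Sum>r\<in>B. a p * b q * d r * (\<Sum>z\<in>B. c p z x * c q r z))"
      by (intro sum.cong refl) (simp add: sum_distrib_left[symmetric] assoc)
    also have "\<dots> = (\<Sum>p\<in>B. \<Sum>q\<in>B. \<Sum>r\<in>B. \<Sum>z\<in>B. a p * b q * d r * (c p z x * c q r z))"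
      by (simp add: sum_distrib_left)
    also have "\<dots> = (\<Sum>p\<in>B. \<Sum>z\<in>B. \<Sum>q\<in>B. \<Sum>r\<in>B. a p * b q * d r * (c p z x * c q r z))"
      by (rule sum.cong[OF refl], rule rot[symmetric])
    also have "\<dots> = (a \<otimes>\<^bsub>?R\<^esub> (b \<otimes>\<^bsub>?R\<^esub> d)) x"
      unfolding mult by (simp add: sum_distrib_left sum_distrib_right algebra_simps)
    finally show "((a \<otimes>\<^bsub>?R\<^esub> b) \<otimes>\<^bsub>?R\<^esub> d) x = (a \<otimes>\<^bsub>?R\<^esub> (b \<otimes>\<^bsub>?R\<^esub> d)) x" .
  qed
  have e: "(0, \<one>\<^bsub>G\<^esub>) \<in> B" using n by (auto simp: B_def)
  have bsum: "(\<Sum>p\<in>B. bvec (0, \<one>\<^bsub>G\<^esub>) p * F p) = F (0, \<one>\<^bsub>G\<^esub>)" for F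
  proof -
    have "(\<Sum>p\<in>B. bvec (0, \<one>\<^bsub>G\<^esub>) p * F p) = (\<Sum>p\<in>B. if p = (0, \<one>\<^bsub>G\<^esub>) then F (0, \<one>\<^bsub>G\<^esub>) else 0)"
      by (intro sum.cong refl) (auto simp: bvec_def)
    then show ?thesis using e fin by simp
  qed
  have c1: "c (0, \<one>\<^bsub>G\<^esub>) q x = bvec q x" "c q (0, \<one>\<^bsub>G\<^esub>) x = bvec q x" if "q \<in> B" for q x
    using that by (auto simp: c_def nilp_alg_def bvec_def chi1 B_def)
  have expand: "(\<Sum>q\<in>B. a q * bvec q x) = a x" if "a \<in> carrier ?R" for a x
  proof -
    have "(\<Sum>q\<in>B. a q * bvec q x) = (\<Sum>q\<in>B. if q = x then a x else 0)"
      by (intro sum.cong refl) (auto simp: bvec_def)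
    then show ?thesis using that fin by (cases x; cases "x \<in> B") (simp_all add: car)
  qed
  have l1: "\<one>\<^bsub>?R\<^esub> \<otimes>\<^bsub>?R\<^esub> a = a" if "a \<in> carrier ?R" for a
  proof
    fix x
    have "(\<one>\<^bsub>?R\<^esub> \<otimes>\<^bsub>?R\<^esub> a) x = (\<Sum>p\<in>B. bvec (0, \<one>\<^bsub>G\<^esub>) p * (\<Sum>q\<in>B. a q * c p q x))"
      unfolding mult one by (simp add: sum_distrib_left mult.assoc)
    also have "\<dots> = (\<Sum>q\<in>B. a q * bvec q x)"
      unfolding bsum by (intro sum.cong refl) (simp add: c1)
    finally show "(\<one>\<^bsub>?R\<^esub> \<otimes>\<^bsub>?R\<^esub> a) x = a x" using expand[OF that] by simp
  qed
  have r1: "a \<otimes>\<^bsub>?R\<^esub> \<one>\<^bsub>?R\<^esub> = a" if "a \<in> carrier ?R" for a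
  proof
    fix x
    have "(a \<otimes>\<^bsub>?R\<^esub> \<one>\<^bsub>?R\<^esub>) x = (\<Sum>p\<in>B. \<Sum>q\<in>B. bvec (0, \<one>\<^bsub>G\<^esub>) q * (a p * c p q x))"
      unfolding mult one by (intro sum.cong refl) (simp add: algebra_simps)
    also have "\<dots> = (\<Sum>q\<in>B. a q * bvec q x)"
      unfolding bsum by (intro sum.cong refl) (simp add: c1)
    finally show "(a \<otimes>\<^bsub>?R\<^esub> \<one>\<^bsub>?R\<^esub>) x = a x" using expand[OF that] by simp
  qed
  show ?thesis
  proof (rule ringI)
    show "abelian_group ?R"
    proof (rule abelian_groupI)
      fix a assume a: "a \<in> carrier ?R"
      show "\<exists>b\<in>carrier ?R. b \<oplus>\<^bsub>?R\<^esub> a = \<zero>\<^bsub>?R\<^esub>"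
        using a by (intro bexI[of _ "\<lambda>x. - a x"]) (auto simp: alg_ring_def)
    qed (auto simp: alg_ring_def algebra_simps)
    show "monoid ?R"
      by (rule monoidI) (use clos as l1 r1 e in \<open>auto simp: car one bvec_def\<close>)
    fix a b d
    show "(a \<oplus>\<^bsub>?R\<^esub> b) \<otimes>\<^bsub>?R\<^esub> d = a \<otimes>\<^bsub>?R\<^esub> d \<oplus>\<^bsub>?R\<^esub> b \<otimes>\<^bsub>?R\<^esub> d"
      by (rule ext) (simp add: mult add algebra_simps sum.distrib)
    show "d \<otimes>\<^bsub>?R\<^esub> (a \<oplus>\<^bsub>?R\<^esub> b) = d \<otimes>\<^bsub>?R\<^esub> a \<oplus>\<^bsub>?R\<^esub> d \<otimes>\<^bsub>?R\<^esub> b"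
      by (rule ext) (simp add: mult add algebra_simps sum.distrib)
  qed
qed

lemma nilp_alg_relations:
  assumes "nilpotent_datum G \<chi> g n" and "h \<in> carrier G" "h' \<in> carrier G"
  defines "R \<equiv> alg_ring (nilp_alg G \<chi> n)" and "y \<equiv> bvec (1, \<one>\<^bsub>G\<^esub>)"
  shows "bvec (0, h) \<otimes>\<^bsub>R\<^esub> bvec (0, h') = bvec (0, h \<otimes>\<^bsub>G\<^esub> h')"
    and "y \<otimes>\<^bsub>R\<^esub> bvec (0, h) = (\<lambda>x. \<chi> h * (bvec (0, h) \<otimes>\<^bsub>R\<^esub> y) x)"
    and "s < n \<Longrightarrow> (y [^]\<^bsub>R\<^esub> s) \<otimes>\<^bsub>R\<^esub> bvec (0, h) = bvec (s, h)"
    and "y [^]\<^bsub>R\<^esub> n = \<zero>\<^bsub>R\<^esub>"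
proof -
  interpret group G using assms by (simp add: nilpotent_datum_def)
  interpret R: ring R unfolding R_def by (rule nilp_alg_ring) fact
  have fin: "finite (Bas (nilp_alg G \<chi> n))" and n: "2 \<le> n"
    using assms(1) by (auto simp: nilpotent_datum_def nilp_alg_def)
  have chi: "\<chi> k \<noteq> 0" "\<chi> (k \<otimes>\<^bsub>G\<^esub> k') = \<chi> k * \<chi> k'"
    if "k \<in> carrier G" "k' \<in> carrier G" for k k'
    using assms(1) that by (auto simp: nilpotent_datum_def linear_character_def)
  have chi1: "\<chi> \<one>\<^bsub>G\<^esub> = 1"
    using chi[of "\<one>\<^bsub>G\<^esub>" "\<one>\<^bsub>G\<^esub>"] by simp
  have basis_mult: "bvec (s, k) \<otimes>\<^bsub>R\<^esub> bvec (t, k') =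
      (if s + t < n then (\<lambda>x. inverse (\<chi> k) ^ t * bvec (s + t, k \<otimes>\<^bsub>G\<^esub> k') x) else \<zero>\<^bsub>R\<^esub>)"
    if "s < n" "t < n" "k \<in> carrier G" "k' \<in> carrier G" for s t k k'
    using alg_ring_bvec_mult[OF fin, of "(s, k)" "(t, k')"] that
    by (auto simp: R_def nilp_alg_def alg_ring_def)
  show "bvec (0, h) \<otimes>\<^bsub>R\<^esub> bvec (0, h') = bvec (0, h \<otimes>\<^bsub>G\<^esub> h')"
    using n assms(2,3) by (simp add: basis_mult)
  show "y \<otimes>\<^bsub>R\<^esub> bvec (0, h) = (\<lambda>x. \<chi> h * (bvec (0, h) \<otimes>\<^bsub>R\<^esub> y) x)"
    using n assms(2) chi(1)[OF assms(2) assms(2)] by (simp add: basis_mult y_def flip: mult.assoc)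
  have pow: "y [^]\<^bsub>R\<^esub> s = (if s < n then bvec (s, \<one>\<^bsub>G\<^esub>) else \<zero>\<^bsub>R\<^esub>)" for s :: nat
  proof (induction s)
    case 0
    show ?case using n by (simp add: R_def alg_ring_def nilp_alg_def)
  next
    case (Suc s)
    have "y \<in> carrier R" using n by (auto simp: y_def R_def alg_ring_def nilp_alg_def bvec_def)
    then have "y [^]\<^bsub>R\<^esub> Suc s = (if s < n then bvec (s, \<one>\<^bsub>G\<^esub>) else \<zero>\<^bsub>R\<^esub>) \<otimes>\<^bsub>R\<^esub> y"
      by (simp add: Suc)
    also have "\<dots> = (if Suc s < n then bvec (Suc s, \<one>\<^bsub>G\<^esub>) else \<zero>\<^bsub>R\<^esub>)"
      using n \<open>y \<in> carrier R\<close> by (cases "s < n") (simp_all add: basis_mult chi1 y_def)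
    finally show ?case .
  qed
  show "y [^]\<^bsub>R\<^esub> n = \<zero>\<^bsub>R\<^esub>" by (simp add: pow)
  show "(y [^]\<^bsub>R\<^esub> s) \<otimes>\<^bsub>R\<^esub> bvec (0, h) = bvec (s, h)" if "s < n"
    using that n assms(2) by (simp add: pow basis_mult)
qed

lemma nilp_hopf_comult:
  assumes "nilpotent_datum G \<chi> g n" and "h \<in> carrier G"
  shows "comult (nilp_hopf G \<chi> g n) (bvec (0, h)) = bvec ((0, h), (0, h))"
    and "comult (nilp_hopf G \<chi> g n) (bvec (1, \<one>\<^bsub>G\<^esub>)) =
           (\<lambda>x. bvec ((1, \<one>\<^bsub>G\<^esub>), (0, g)) x + bvec ((0, \<one>\<^bsub>G\<^esub>), (1, \<one>\<^bsub>G\<^esub>)) x)"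
proof -
  interpret group G using assms by (simp add: nilpotent_datum_def)
  let ?A = "nilp_alg G \<chi> n"
  define R where "R = alg_ring (tensor_square ?A)"
  let ?I = "\<one>\<^bsub>G\<^esub>"
  have n: "2 \<le> n" and g: "g \<in> carrier G" and fin: "finite (carrier G)"
    using assms(1) by (auto simp: nilpotent_datum_def)
  have chi: "\<chi> k \<noteq> 0" "\<chi> (k \<otimes>\<^bsub>G\<^esub> k') = \<chi> k * \<chi> k'"
    if "k \<in> carrier G" "k' \<in> carrier G" for k k'
    using assms(1) that by (auto simp: nilpotent_datum_def linear_character_def)
  have chi1: "\<chi> ?I = 1" using chi[of ?I ?I] by simp
  have basis_mult: "bvec p \<otimes>\<^bsub>R\<^esub> bvec q = bmult (tensor_square ?A) p q"
    if "p \<in> Bas (tensor_square ?A)" "q \<in> Bas (tensor_square ?A)" for p q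
    unfolding R_def by (rule alg_ring_bvec_mult) (use that fin in \<open>auto simp: tensor_square_def nilp_alg_def\<close>)
  have unit: "\<one>\<^bsub>R\<^esub> = bvec ((0, ?I), (0, ?I))"
    by (auto simp: R_def alg_ring_def tensor_square_def nilp_alg_def bvec_def fun_eq_iff)
  have l1: "bvec ((0, ?I), (0, ?I)) \<otimes>\<^bsub>R\<^esub> bvec ((s, k), (t, k')) = bvec ((s, k), (t, k'))"
    and r1: "bvec ((s, k), (t, k')) \<otimes>\<^bsub>R\<^esub> bvec ((0, ?I), (0, ?I)) = bvec ((s, k), (t, k'))"
    if "s < n" "t < n" "k \<in> carrier G" "k' \<in> carrier G" for s t k k'
    using that n
    by (subst basis_mult; auto simp: tensor_square_def nilp_alg_def bvec_def fun_eq_iff chi1)+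
  have distr: "(a \<oplus>\<^bsub>R\<^esub> b) \<otimes>\<^bsub>R\<^esub> d = a \<otimes>\<^bsub>R\<^esub> d \<oplus>\<^bsub>R\<^esub> b \<otimes>\<^bsub>R\<^esub> d"
    "d \<otimes>\<^bsub>R\<^esub> (a \<oplus>\<^bsub>R\<^esub> b) = d \<otimes>\<^bsub>R\<^esub> a \<oplus>\<^bsub>R\<^esub> d \<otimes>\<^bsub>R\<^esub> b" for a b d
    by (simp_all add: R_def alg_ring_def fun_eq_iff algebra_simps sum.distrib)
  have com: "comult (nilp_hopf G \<chi> g n) (bvec b) = nilp_comult G \<chi> g n b"
    if "b \<in> {..<n} \<times> carrier G" for b
  proof
    fix x
    have "comult (nilp_hopf G \<chi> g n) (bvec b) x
        = (\<Sum>b'\<in>{..<n} \<times> carrier G. if b' = b then nilp_comult G \<chi> g n b x else 0)"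
      unfolding comult_def
      by (intro sum.cong) (auto simp: nilp_hopf_def balg.defs nilp_alg_def bvec_def)
    then show "comult (nilp_hopf G \<chi> g n) (bvec b) x = nilp_comult G \<chi> g n b x"
      using that fin by simp
  qed
  show "comult (nilp_hopf G \<chi> g n) (bvec (0, h)) = bvec ((0, h), (0, h))"
    using n assms(2) by (simp add: com nilp_comult_def unit l1 flip: R_def)
  have "nilp_comult G \<chi> g n (1, ?I) = bvec ((1, ?I), (0, g)) \<oplus>\<^bsub>R\<^esub> bvec ((0, ?I), (1, ?I))"
    using n g by (simp add: nilp_comult_def unit l1 r1 distr flip: R_def)
  then show "comult (nilp_hopf G \<chi> g n) (bvec (1, ?I)) =
      (\<lambda>x. bvec ((1, ?I), (0, g)) x + bvec ((0, ?I), (1, ?I)) x)"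
    using n by (simp add: com R_def alg_ring_def)
qed

lemma tensor_map_pure:
  assumes "\<phi> ` mcar M \<subseteq> mcar M" "linear_between (mcar M) (mscale M) (mscale M) \<phi>"
    and "\<psi> ` mcar N \<subseteq> mcar N" "linear_between (mcar N) (mscale N) (mscale N) \<psi>"
  shows "tensor_map M N \<phi> \<psi> (pure_tensor M N v w) = pure_tensor M N (\<phi> v) (\<psi> w)"
proof
  fix \<beta>
  have "bilinear_form M N (\<lambda>v w. \<beta> (\<phi> v) (\<psi> w))" if "bilinear_form M N \<beta>"
    using that assms unfolding bilinear_form_def bilinear_between_def linear_between_def
    by (simp add: image_subset_iff)
  then show "tensor_map M N \<phi> \<psi> (pure_tensor M N v w) \<beta> = pure_tensor M N (\<phi> v) (\<psi> w) \<beta>"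
    by (simp add: tensor_map_def pure_tensor_def)
qed

text \<open>The canonical map is bilinear, and every bilinear map factors uniquely through it.\<close>

lemma pure_tensor_bilinear:
  assumes "module.subspace (mscale M) (mcar M)" "vector_space (mscale M)"
    and "module.subspace (mscale N) (mcar N)" "vector_space (mscale N)"
  shows "bilinear_between (mcar M) (mcar N) (mscale M) (mscale N) (mscale (tensor A M N))
           (pure_tensor M N)"
  unfolding bilinear_between_def linear_between_def tensor_def
  by (auto simp: pure_tensor_def bilinear_form_def bilinear_between_def linear_between_def fun_eq_iff)

lemma tensor_universal:
  fixes A :: "('b, 'k::field, 'z) bialg_scheme"
    and M :: "('b, 'k, 'v::ab_group_add) amod" and N :: "('b, 'k, 'w::ab_group_add) amod"
    and s :: "'k \<Rightarrow> 'u::ab_group_add \<Rightarrow> 'u"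
  assumes "vector_space s"
    and \<beta>: "bilinear_between (mcar M) (mcar N) (mscale M) (mscale N) s \<beta>"
  shows "\<exists>F. linear_between (mcar (tensor A M N)) (mscale (tensor A M N)) s F \<and>
      (\<forall>v\<in>mcar M. \<forall>w\<in>mcar N. F (pure_tensor M N v w) = \<beta> v w) \<and>
      (\<forall>F'. linear_between (mcar (tensor A M N)) (mscale (tensor A M N)) s F' \<and>
         (\<forall>v\<in>mcar M. \<forall>w\<in>mcar N. F' (pure_tensor M N v w) = \<beta> v w) \<longrightarrow>
         (\<forall>t\<in>mcar (tensor A M N). F' t = F t))"
proof -
  interpret U: vector_space s by fact
  let ?sT = "\<lambda>c (t :: ('v \<Rightarrow> 'w \<Rightarrow> 'k) \<Rightarrow> 'k) \<beta>. c * t \<beta>"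
  interpret T: vector_space ?sT
    by unfold_locales (auto simp: fun_eq_iff algebra_simps)
  interpret K: vector_space "(*) :: 'k \<Rightarrow> 'k \<Rightarrow> 'k"
    by unfold_locales (auto simp: algebra_simps)
  interpret TU: vector_space_pair ?sT s ..
  interpret UK: vector_space_pair s "(*) :: 'k \<Rightarrow> 'k \<Rightarrow> 'k" ..
  define P where "P = {pure_tensor M N v w | v w. v \<in> mcar M \<and> w \<in> mcar N}"
  have car: "mcar (tensor A M N) = T.span P" "mscale (tensor A M N) = ?sT"
    by (simp_all add: tensor_def P_def)
  obtain B where B: "B \<subseteq> P" "T.independent B" "P \<subseteq> T.span B"
    using T.maximal_independent_subset[of P] by blast
  have spB: "T.span B = T.span P"
    using B by (metis T.span_mono T.span_span subset_antisym)
  have "\<forall>b\<in>B. \<exists>v w. v \<in> mcar M \<and> w \<in> mcar N \<and> b = pure_tensor M N v w"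
    using B(1) unfolding P_def by blast
  then obtain l r where lr: "\<And>b. b \<in> B \<Longrightarrow> l b \<in> mcar M \<and> r b \<in> mcar N \<and> b = pure_tensor M N (l b) (r b)"
    by metis
  define F where "F = TU.construct B (\<lambda>b. \<beta> (l b) (r b))"
  have linF: "Vector_Spaces.linear ?sT s F"
    unfolding F_def by (rule TU.linear_construct[OF B(2)])
  interpret F: Vector_Spaces.linear ?sT s F by (rule linF)
  have key: "\<phi> (F t) = t (\<lambda>v w. \<phi> (\<beta> v w))" if \<phi>: "Vector_Spaces.linear s (*) \<phi>" and t: "t \<in> T.span B" for \<phi> t
  proof -
    interpret \<phi>: Vector_Spaces.linear s "(*)" \<phi> by (rule \<phi>)
    have bil: "bilinear_form M N (\<lambda>v w. \<phi> (\<beta> v w))"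
      using \<beta> unfolding bilinear_form_def bilinear_between_def linear_between_def
      by (simp add: \<phi>.add \<phi>.scale)
    show ?thesis using t
    proof (induction rule: T.span_induct_alt)
      case base
      show ?case unfolding F.zero \<phi>.zero by (simp add: zero_fun_def)
    next
      case (step c b t)
      have "F b = \<beta> (l b) (r b)"
        unfolding F_def using TU.construct_basis[OF B(2) step(1)] .
      moreover have "b (\<lambda>v w. \<phi> (\<beta> v w)) = \<phi> (\<beta> (l b) (r b))"
        using lr[OF step(1)] bil by (metis pure_tensor_def)
      ultimately show ?case
        unfolding F.add F.scale \<phi>.add \<phi>.scale step(2) by simp
    qed
  qed
  have sep: "u = u'" if "\<And>\<phi>. Vector_Spaces.linear s (*) \<phi> \<Longrightarrow> \<phi> u = \<phi> u'" for u u'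
  proof (rule ccontr)
    assume "u \<noteq> u'"
    then have ind: "U.independent {u - u'}" by simp
    define \<phi> where "\<phi> = UK.construct {u - u'} (\<lambda>_. 1)"
    have lin: "Vector_Spaces.linear s (*) \<phi>" unfolding \<phi>_def by (rule UK.linear_construct[OF ind])
    interpret \<phi>: Vector_Spaces.linear s "(*)" \<phi> by (rule lin)
    have "\<phi> (u - u') = 1" unfolding \<phi>_def by (rule UK.construct_basis[OF ind]) simp
    then show False using that[OF lin] by (simp add: \<phi>.diff)
  qed
  have pureF: "F (pure_tensor M N v w) = \<beta> v w" if "v \<in> mcar M" "w \<in> mcar N" for v w
  proof (rule sep)
    fix \<phi> assume \<phi>: "Vector_Spaces.linear s (*) \<phi>"
    interpret \<phi>: Vector_Spaces.linear s "(*)" \<phi> by (rule \<phi>)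
    have bil: "bilinear_form M N (\<lambda>v w. \<phi> (\<beta> v w))"
      using \<beta> unfolding bilinear_form_def bilinear_between_def linear_between_def
      by (simp add: \<phi>.add \<phi>.scale)
    have "pure_tensor M N v w \<in> T.span B"
      using that B(3) by (auto simp: P_def)
    from key[OF \<phi> this] show "\<phi> (F (pure_tensor M N v w)) = \<phi> (\<beta> v w)"
      using bil by (simp add: pure_tensor_def)
  qed
  show ?thesis
  proof (intro exI[of _ F] conjI allI impI ballI)
    show "linear_between (mcar (tensor A M N)) (mscale (tensor A M N)) s F"
      unfolding linear_between_def car by (simp add: F.add F.scale)
    show "F (pure_tensor M N v w) = \<beta> v w" if "v \<in> mcar M" "w \<in> mcar N" for v w
      using that by (rule pureF)
    fix F' t
    assume F': "linear_between (mcar (tensor A M N)) (mscale (tensor A M N)) s F' \<and>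
         (\<forall>v\<in>mcar M. \<forall>w\<in>mcar N. F' (pure_tensor M N v w) = \<beta> v w)"
      and "t \<in> mcar (tensor A M N)"
    then have "t \<in> T.span P" by (simp add: car)
    then have "t \<in> T.span P \<and> F' t = F t"
    proof (induction rule: T.span_induct_alt)
      case base
      have "F' 0 = 0"
        using F' T.span_zero[of P] unfolding linear_between_def car
        by (metis add_cancel_right_right)
      then show ?case using F.zero T.span_zero by metis
    next
      case (step c b t)
      have b: "b \<in> T.span P" "?sT c b \<in> T.span P"
        using step(1) T.span_base T.span_scale by blast+
      have "F' b = F b" using step(1) F' pureF by (auto simp: P_def)
      then show ?case
        using step(2) b F' T.span_add[OF b(2), of t] F.add[of "?sT c b" t] F.scale[of c b]
        unfolding linear_between_def car by metis
    qed
    then show "F' t = F t" by simp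
  qed
qed

end

theory Submission
  imports Defs
begin

text \<open>
  Everything happens inside \<open>M(V,j) \<otimes> M(1,2)\<close>, where \<open>M(1,2)\<close> has the basis \<open>e0, e1\<close> with \<open>y e0 = e1\<close> and
  \<open>V\<close> is a representation of \<open>G\<close>. Let \<open>p = \<chi>(g)\<^sup>-\<^sup>1\<close> and \<open>[k] = 1 + p + \<dots> + p\<^sup>k\<^sup>-\<^sup>1\<close>.
  From \<open>\<Delta>(y) = y \<otimes> g + 1 \<otimes> y\<close> one finds
  \<open>y\<^sup>k(v \<otimes> e0) = x\<^sup>k v \<otimes> e0 + [k] x\<^sup>k\<^sup>-\<^sup>1 v \<otimes> e1\<close>. The tensor product is thus made of two strings of length
  \<open>j\<close>, one starting with \<open>V \<otimes> e0\<close> and one with \<open>V \<otimes> e1\<close>, the latter being twisted by \<open>\<chi>\<^sup>-\<^sup>1\<close>. After the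
  multiples \<open>[k]\<close> are subtracted, the strings interact only at the end, where the first one has stopped and
  \<open>[j] x\<^sup>j\<^sup>-\<^sup>1 v \<otimes> e1\<close> is left over.

  If \<open>j = n\<close> then \<open>[n] = 0\<close>, since \<open>p\<close> is a root of unity of order \<open>n\<close>; the strings are independent and
  the module is \<open>M(V,n) \<oplus> M(V\<chi>\<^sup>-\<^sup>1,n)\<close>. If \<open>j < n\<close> then \<open>[j]\<close> is invertible; the first string absorbs
  the last entry of the second, and the lengths become \<open>j + 1\<close> and \<open>j - 1\<close>. By the choice of \<open>\<tau>\<close>, the
  twist of \<open>V\<^sub>i\<close> by \<open>\<chi>\<^sup>-\<^sup>1\<close> is \<open>V\<^bsub>\<tau>(i)\<^esub>\<close>.

  In the opposite order \<open>M(1,2) \<otimes> M(V,j)\<close> the same two strings occur, linked by the action of \<open>g\<close> instead.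
  Since \<open>g\<close> is central, its action on the \<open>V\<close>-components can be removed \<open>G\<close>-equivariantly, and the interaction of the strings can again be
  reduced to the coefficient \<open>[j]\<close> at the end. Hence both orders have the same normal form
  (\<open>left_normal_form\<close>, \<open>right_normal_form\<close>), which is decomposed in \<open>normal_form_split_iso\<close> and
  \<open>normal_form_regroup_iso\<close>.

  Two reductions allow such computations with generators. A linear bijection that commutes with the
  operators of \<open>y\<close> and of all \<open>h\<close> is an isomorphism of \<open>H\<close>-modules (\<open>module_iso_acts_by\<close>). And a tensor product
  is governed by the operators of \<open>\<Delta>(y)\<close> and \<open>\<Delta>(h)\<close> (\<open>tensor_acts_by\<close>), because the action of \<open>H \<otimes> H\<close> is
  multiplicative (\<open>tensor_act_mult\<close>).
\<close>

section \<open>Linear maps on subspaces and module isomorphisms\<close>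

lemma linear_betweenD:
  assumes "linear_between V s s' f"
  shows "v \<in> V \<Longrightarrow> w \<in> V \<Longrightarrow> f (v + w) = f v + f w" "v \<in> V \<Longrightarrow> f (s c v) = s' c (f v)"
  using assms unfolding linear_between_def by blast+

lemma linear_betweenI:
  assumes "\<And>v w. v \<in> V \<Longrightarrow> w \<in> V \<Longrightarrow> f (v + w) = f v + f w"
    and "\<And>c v. v \<in> V \<Longrightarrow> f (s c v) = s' c (f v)"
  shows "linear_between V s s' f"
  using assms unfolding linear_between_def by blast

text \<open>
  Linearity is only known on the subspace, so the value at \<open>0\<close> comes from \<open>0 = 0 \<cdot> 0\<close>.
\<close>

lemma linear_between_zero:
  assumes "vector_space s" "vector_space s'" "module.subspace s V" "linear_between V s s' f"
  shows "f 0 = 0"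
proof -
  interpret s: vector_space s by fact
  interpret s': vector_space s' by fact
  have "f (s 0 0) = s' 0 (f 0)" using assms(4) s.subspace_0[OF assms(3)] by (rule linear_betweenD(2))
  then show ?thesis by simp
qed

lemma linear_between_sum:
  assumes "vector_space s" "vector_space s'" "module.subspace s V" "linear_between V s s' f"
    and "\<And>i. i \<in> I \<Longrightarrow> x i \<in> V"
  shows "f (\<Sum>i\<in>I. s (c i) (x i)) = (\<Sum>i\<in>I. s' (c i) (f (x i)))"
proof -
  interpret s: vector_space s by fact
  show ?thesis
    using assms(5)
  proof (induction I rule: infinite_finite_induct)
    case (insert i I)
    have "s (c i) (x i) \<in> V" "(\<Sum>i\<in>I. s (c i) (x i)) \<in> V"
      using assms(3) insert.prems by (auto intro!: s.subspace_scale s.subspace_sum)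
    then show ?case
      using insert by (simp add: linear_betweenD[OF assms(4)])
  qed (simp_all add: linear_between_zero[OF assms(1-4)])
qed

lemma linear_between_compose:
  assumes "linear_between V s s' f" "linear_between W s' s'' f'" "f ` V \<subseteq> W"
  shows "linear_between V s s'' (\<lambda>v. f' (f v))"
  using assms unfolding linear_between_def by (auto simp: image_subset_iff)

lemma vector_space_fun:
  assumes "vector_space s" shows "vector_space (\<lambda>c f x. s c (f x))"
proof -
  interpret vector_space s by fact
  show ?thesis by unfold_locales (auto simp: fun_eq_iff scale_right_distrib scale_left_distrib)
qed

lemma vector_space_pair_scale:
  assumes "vector_space s" "vector_space s'"
  shows "vector_space (\<lambda>c (v, w). (s c v, s' c w))"
proof -
  interpret s: vector_space s by fact
  interpret s': vector_space s' by fact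
  show ?thesis
    by unfold_locales (auto simp: s.scale_right_distrib s.scale_left_distrib
        s'.scale_right_distrib s'.scale_left_distrib)
qed

lemma subspace_Times:
  assumes "vector_space s" "vector_space s'" "module.subspace s V" "module.subspace s' W"
  shows "module.subspace (\<lambda>c (v, w). (s c v, s' c w)) (V \<times> W)"
proof -
  interpret s: vector_space s by fact
  interpret s': vector_space s' by fact
  interpret p: vector_space "\<lambda>c (v, w). (s c v, s' c w)"
    by (rule vector_space_pair_scale) fact+
  show ?thesis
    using assms(3,4) by (auto simp: p.subspace_def s.subspace_def s'.subspace_def zero_prod_def)
qed

text \<open>
  The set-theoretic inverse is again equivariant only because the action of the source preserves
  its carrier; nothing in the type of modules enforces that.
\<close>

lemma module_iso_sym:
  assumes "module_iso A M N" and "vector_space (mscale M)" "module.subspace (mscale M) (mcar M)"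
    and closed: "\<And>a v. v \<in> mcar M \<Longrightarrow> mact M a v \<in> mcar M"
  shows "module_iso A N M"
proof -
  interpret vector_space "mscale M" by fact
  obtain f where f: "bij_betw f (mcar M) (mcar N)" and lin: "linear_between (mcar M) (mscale M) (mscale N) f"
    and act: "\<And>a v. a \<in> carrier (alg_ring A) \<Longrightarrow> v \<in> mcar M \<Longrightarrow> f (mact M a v) = mact N a (f v)"
    using assms(1) unfolding module_iso_def by blast
  let ?g = "the_inv_into (mcar M) f"
  have inj: "inj_on f (mcar M)" and im: "f ` mcar M = mcar N"
    using f by (auto simp: bij_betw_def)
  have g: "?g w \<in> mcar M" "f (?g w) = w" if "w \<in> mcar N" for w
    using that f by (auto simp: f_the_inv_into_f_bij_betw intro: bij_betwE[OF bij_betw_the_inv_into, rule_format])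
  have geq: "?g w = v" if "v \<in> mcar M" "f v = w" for v w
    using that the_inv_into_f_f[OF inj] by auto
  show ?thesis
    unfolding module_iso_def
  proof (intro exI[of _ ?g] conjI ballI)
    show "bij_betw ?g (mcar N) (mcar M)" using f by (rule bij_betw_the_inv_into)
    show "linear_between (mcar N) (mscale N) (mscale M) ?g"
      by (rule linear_betweenI; rule geq)
        (use g assms(3) in \<open>auto simp: linear_betweenD[OF lin] intro: subspace_add subspace_scale\<close>)
    show "?g (mact N a w) = mact M a (?g w)" if "a \<in> carrier (alg_ring A)" "w \<in> mcar N" for a w
      by (rule geq) (use that g closed act in auto)
  qed
qed

lemma module_iso_trans:
  assumes "module_iso A M N" "module_iso A N P"
  shows "module_iso A M P"
proof -
  obtain f where f: "bij_betw f (mcar M) (mcar N)" "linear_between (mcar M) (mscale M) (mscale N) f"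
     "\<And>a v. a \<in> carrier (alg_ring A) \<Longrightarrow> v \<in> mcar M \<Longrightarrow> f (mact M a v) = mact N a (f v)"
    using assms(1) unfolding module_iso_def by blast
  obtain f' where f': "bij_betw f' (mcar N) (mcar P)" "linear_between (mcar N) (mscale N) (mscale P) f'"
     "\<And>a v. a \<in> carrier (alg_ring A) \<Longrightarrow> v \<in> mcar N \<Longrightarrow> f' (mact N a v) = mact P a (f' v)"
    using assms(2) unfolding module_iso_def by blast
  show ?thesis
    unfolding module_iso_def
  proof (intro exI[of _ "\<lambda>v. f' (f v)"] conjI ballI)
    show "bij_betw (\<lambda>v. f' (f v)) (mcar M) (mcar P)"
      using bij_betw_trans[OF f(1) f'(1)] by (simp add: o_def)
    show "linear_between (mcar M) (mscale M) (mscale P) (\<lambda>v. f' (f v))"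
      using linear_between_compose[OF f(2) f'(2)] f(1) by (simp add: bij_betw_def)
    show "f' (f (mact M a v)) = mact P a (f' (f v))" if "a \<in> carrier (alg_ring A)" "v \<in> mcar M" for a v
      using that f f' bij_betwE by metis
  qed
qed

section \<open>Modules given by operators for the generators\<close>

text \<open>
  A module over \<open>H\<close> reduced to generators: \<open>T h\<close> is the action of the group element \<open>h\<close> and \<open>Y\<close>
  that of \<open>y\<close>, and the basis \<open>y\<^sup>s h\<close> determines the action of every other element.
\<close>

definition acts_by :: "('g, 'y) monoid_scheme \<Rightarrow> nat \<Rightarrow> (nat \<times> 'g, 'k::field, 'v::ab_group_add) amod \<Rightarrow>
    ('g \<Rightarrow> 'v \<Rightarrow> 'v) \<Rightarrow> ('v \<Rightarrow> 'v) \<Rightarrow> bool" where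
  "acts_by G n M T Y \<longleftrightarrow>
     vector_space (mscale M) \<and> module.subspace (mscale M) (mcar M) \<and>
     (\<forall>h\<in>carrier G. \<forall>v\<in>mcar M. T h v \<in> mcar M) \<and> (\<forall>v\<in>mcar M. Y v \<in> mcar M) \<and>
     (\<forall>a. \<forall>v\<in>mcar M. mact M a v =
        (\<Sum>(s, h)\<in>{..<n} \<times> carrier G. mscale M (a (s, h)) ((Y ^^ s) (T h v))))"

lemma acts_byD:
  assumes "acts_by G n M T Y"
  shows "vector_space (mscale M)" "module.subspace (mscale M) (mcar M)"
    "h \<in> carrier G \<Longrightarrow> v \<in> mcar M \<Longrightarrow> T h v \<in> mcar M" "v \<in> mcar M \<Longrightarrow> Y v \<in> mcar M"
    "v \<in> mcar M \<Longrightarrow> mact M a v =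
        (\<Sum>(s, h)\<in>{..<n} \<times> carrier G. mscale M (a (s, h)) ((Y ^^ s) (T h v)))"
    "v \<in> mcar M \<Longrightarrow> (Y ^^ s) v \<in> mcar M"
proof -
  show Y: "v \<in> mcar M \<Longrightarrow> Y v \<in> mcar M" for v using assms unfolding acts_by_def by blast
  show "v \<in> mcar M \<Longrightarrow> (Y ^^ s) v \<in> mcar M" by (induction s) (auto intro: Y)
qed (use assms in \<open>unfold acts_by_def, blast+\<close>)

lemma acts_by_closed:
  assumes "acts_by G n M T Y" "v \<in> mcar M"
  shows "mact M a v \<in> mcar M"
proof -
  interpret vector_space "mscale M" using assms(1) by (rule acts_byD)
  show ?thesis
    unfolding acts_byD(5)[OF assms]
    using assms by (intro subspace_sum) (auto intro!: subspace_scale acts_byD[OF assms(1)])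
qed

text \<open>
  This is what makes every later isomorphism a computation with two operators: equivariance
  under \<open>T\<close> and \<open>Y\<close> passes to the monomials \<open>y\<^sup>s h\<close> and then, by linearity, to all of \<open>H\<close>.
\<close>

lemma module_iso_acts_by:
  assumes M: "acts_by G n M T Y" and N: "acts_by G n N T' Y'"
    and f: "bij_betw f (mcar M) (mcar N)" and lin: "linear_between (mcar M) (mscale M) (mscale N) f"
    and T: "\<And>h v. h \<in> carrier G \<Longrightarrow> v \<in> mcar M \<Longrightarrow> f (T h v) = T' h (f v)"
    and Y: "\<And>v. v \<in> mcar M \<Longrightarrow> f (Y v) = Y' (f v)"
  shows "module_iso A M N"
proof -
  have fin: "f v \<in> mcar N" if "v \<in> mcar M" for v using that f by (auto simp: bij_betw_def)
  have pow: "f ((Y ^^ s) v) = (Y' ^^ s) (f v)" if "v \<in> mcar M" for s v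
    using that by (induction s) (auto simp: Y acts_byD[OF M])
  show ?thesis
    unfolding module_iso_def
  proof (intro exI[of _ f] conjI ballI f lin)
    fix a v assume v: "v \<in> mcar M"
    have "f (mact M a v) = (\<Sum>x\<in>{..<n} \<times> carrier G. mscale N (a x) (f ((Y ^^ fst x) (T (snd x) v))))"
      unfolding acts_byD(5)[OF M v] split_def prod.collapse
      by (rule linear_between_sum[OF acts_byD(1)[OF M] acts_byD(1)[OF N] acts_byD(2)[OF M] lin])
        (use v in \<open>auto intro!: acts_byD[OF M]\<close>)
    also have "\<dots> = mact N a (f v)"
      unfolding acts_byD(5)[OF N fin[OF v]] split_def
      by (rule sum.cong) (use v in \<open>auto simp: pow T acts_byD[OF M]\<close>)
    finally show "f (mact M a v) = mact N a (f v)" .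
  qed
qed

lemma acts_by_iso_sym:
  assumes "module_iso A M N" "acts_by G n M T Y"
  shows "module_iso A N M"
  using module_iso_sym[OF assms(1) acts_byD(1,2)[OF assms(2)]] acts_by_closed[OF assms(2)] by blast

definition operator_module :: "('g, 'y) monoid_scheme \<Rightarrow> nat \<Rightarrow> 'v set \<Rightarrow> ('k \<Rightarrow> 'v \<Rightarrow> 'v) \<Rightarrow>
    ('g \<Rightarrow> 'v \<Rightarrow> 'v) \<Rightarrow> ('v \<Rightarrow> 'v) \<Rightarrow> (nat \<times> 'g, 'k::field, 'v::ab_group_add) amod" where
  "operator_module G n C sc T Y = \<lparr>mcar = C, mscale = sc, mact =
     (\<lambda>a v. \<Sum>(s, h)\<in>{..<n} \<times> carrier G. sc (a (s, h)) ((Y ^^ s) (T h v)))\<rparr>"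

lemma acts_by_operator_module:
  assumes "vector_space sc" "module.subspace sc C"
    "\<And>h v. h \<in> carrier G \<Longrightarrow> v \<in> C \<Longrightarrow> T h v \<in> C" "\<And>v. v \<in> C \<Longrightarrow> Y v \<in> C"
  shows "acts_by G n (operator_module G n C sc T Y) T Y"
  using assms unfolding acts_by_def by (auto simp: operator_module_def)

text \<open>
  The operators satisfy the defining relations of \<open>H\<close>; the commutation rule is
  \<open>yh = \<chi>(h)hy\<close> solved for \<open>hy\<close>.
\<close>

definition skew_rep :: "('g, 'y) monoid_scheme \<Rightarrow> ('g \<Rightarrow> 'k::field) \<Rightarrow> nat \<Rightarrow>
    (nat \<times> 'g, 'k, 'v::ab_group_add) amod \<Rightarrow> ('g \<Rightarrow> 'v \<Rightarrow> 'v) \<Rightarrow> ('v \<Rightarrow> 'v) \<Rightarrow> bool" where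
  "skew_rep G \<chi> n M T Y \<longleftrightarrow> acts_by G n M T Y \<and>
     (\<forall>h\<in>carrier G. linear_between (mcar M) (mscale M) (mscale M) (T h)) \<and>
     linear_between (mcar M) (mscale M) (mscale M) Y \<and>
     (\<forall>v\<in>mcar M. T \<one>\<^bsub>G\<^esub> v = v \<and> (Y ^^ n) v = 0) \<and>
     (\<forall>h\<in>carrier G. \<forall>v\<in>mcar M. T h (Y v) = mscale M (inverse (\<chi> h)) (Y (T h v))) \<and>
     (\<forall>h\<in>carrier G. \<forall>h'\<in>carrier G. \<forall>v\<in>mcar M. T h (T h' v) = T (h \<otimes>\<^bsub>G\<^esub> h') v)"

lemma skew_repD:
  assumes "skew_rep G \<chi> n M T Y"
  shows "acts_by G n M T Y"
     "h \<in> carrier G \<Longrightarrow> linear_between (mcar M) (mscale M) (mscale M) (T h)"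
     "linear_between (mcar M) (mscale M) (mscale M) Y"
     "v \<in> mcar M \<Longrightarrow> T \<one>\<^bsub>G\<^esub> v = v" "v \<in> mcar M \<Longrightarrow> (Y ^^ n) v = 0"
     "h \<in> carrier G \<Longrightarrow> v \<in> mcar M \<Longrightarrow> T h (Y v) = mscale M (inverse (\<chi> h)) (Y (T h v))"
     "h \<in> carrier G \<Longrightarrow> h' \<in> carrier G \<Longrightarrow> v \<in> mcar M \<Longrightarrow> T h (T h' v) = T (h \<otimes>\<^bsub>G\<^esub> h') v"
  using assms unfolding skew_rep_def by blast+

lemma skew_rep_bvec:
  assumes "skew_rep G \<chi> n M T Y" "finite (carrier G)" "s < n" "h \<in> carrier G" "v \<in> mcar M"
  shows "mact M (bvec (s, h)) v = (Y ^^ s) (T h v)"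
proof -
  note acts = skew_repD(1)[OF assms(1)]
  interpret vector_space "mscale M" using acts by (rule acts_byD)
  have "mact M (bvec (s, h)) v =
      (\<Sum>x\<in>{..<n} \<times> carrier G. if x = (s, h) then (Y ^^ s) (T h v) else 0)"
    unfolding acts_byD(5)[OF acts assms(5)] split_def
    by (rule sum.cong) (auto simp: bvec_def)
  then show ?thesis using assms by simp
qed

lemma skew_rep_pow_linear:
  assumes "skew_rep G \<chi> n M T Y"
  shows "linear_between (mcar M) (mscale M) (mscale M) (Y ^^ s)"
proof (induction s)
  case 0
  show ?case by (simp add: linear_between_def)
next
  case (Suc s)
  then show ?case
    using linear_between_compose[OF Suc skew_repD(3)[OF assms]] acts_byD(6)[OF skew_repD(1)[OF assms]]
    by (auto simp: o_def)
qed

lemma skew_rep_bvec_linear: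
  assumes "skew_rep G \<chi> n M T Y" "finite (carrier G)" "x \<in> {..<n} \<times> carrier G"
  shows "mact M (bvec x) ` mcar M \<subseteq> mcar M"
    and "linear_between (mcar M) (mscale M) (mscale M) (mact M (bvec x))"
proof -
  obtain s h where x: "x = (s, h)" "s < n" "h \<in> carrier G" using assms(3) by (cases x) auto
  note acts = skew_repD(1)[OF assms(1)]
  interpret vector_space "mscale M" using acts by (rule acts_byD)
  show "mact M (bvec x) ` mcar M \<subseteq> mcar M" using acts_by_closed[OF acts] by auto
  have "linear_between (mcar M) (mscale M) (mscale M) (\<lambda>v. (Y ^^ s) (T h v))"
    by (rule linear_between_compose[OF skew_repD(2)[OF assms(1) x(3)] skew_rep_pow_linear[OF assms(1)]])
      (use acts_byD(3)[OF acts x(3)] in auto)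
  then show "linear_between (mcar M) (mscale M) (mscale M) (mact M (bvec x))"
    using acts_byD(2)[OF acts] unfolding linear_between_def
    by (simp add: x skew_rep_bvec[OF assms(1,2)] subspace_add subspace_scale)
qed

text \<open>
  The relations let \<open>y\<^sup>s h y\<^sup>t h'\<close> be reordered to \<open>\<chi>(h)\<^sup>-\<^sup>t y\<^sup>s\<^sup>+\<^sup>t hh'\<close>, which are exactly the
  structure constants of the algebra.
\<close>

lemma skew_rep_bvec_mult:
  assumes rep: "skew_rep G \<chi> n M T Y" and dat: "nilpotent_datum G \<chi> g n"
    and x: "x \<in> {..<n} \<times> carrier G" and x': "x' \<in> {..<n} \<times> carrier G" and v: "v \<in> mcar M"
  shows "mact M (bvec x) (mact M (bvec x') v) =
    (\<Sum>z\<in>{..<n} \<times> carrier G. mscale M (bmult (nilp_alg G \<chi> n) x x' z) (mact M (bvec z) v))"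
proof -
  interpret group G using dat by (simp add: nilpotent_datum_def)
  have fin: "finite (carrier G)" using dat by (simp add: nilpotent_datum_def)
  obtain s h where xx: "x = (s, h)" "s < n" "h \<in> carrier G" using x by (cases x) auto
  obtain t h' where xx': "x' = (t, h')" "t < n" "h' \<in> carrier G" using x' by (cases x') auto
  note acts = skew_repD(1)[OF rep]
  note clos = acts_byD(3,4,6)[OF acts]
  interpret vector_space "mscale M" using acts by (rule acts_byD)
  have comm: "T h ((Y ^^ r) u) = mscale M (inverse (\<chi> h) ^ r) ((Y ^^ r) (T h u))" if "u \<in> mcar M" for u r
    using that
  proof (induction r)
    case (Suc r)
    then show ?case
      using xx clos skew_repD(6)[OF rep xx(3), of "(Y ^^ r) u"]
      by (simp add: linear_betweenD[OF skew_repD(3)[OF rep]] mult.commute)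
  qed simp
  have "mact M (bvec x) (mact M (bvec x') v) = (Y ^^ s) (T h ((Y ^^ t) (T h' v)))"
    using xx xx' v clos by (simp add: skew_rep_bvec[OF rep fin])
  also have "\<dots> = mscale M (inverse (\<chi> h) ^ t) ((Y ^^ (s + t)) (T (h \<otimes>\<^bsub>G\<^esub> h') v))"
    using xx xx' v clos by (simp add: comm linear_betweenD[OF skew_rep_pow_linear[OF rep]] skew_repD(7)[OF rep] funpow_add)
  also have "\<dots> = (if s + t < n then mscale M (inverse (\<chi> h) ^ t) (mact M (bvec (s + t, h \<otimes>\<^bsub>G\<^esub> h')) v) else 0)"
  proof (cases "s + t < n")
    case False
    \<comment> \<open>An exponent beyond \<open>n\<close> contains the factor \<open>y\<^sup>n = 0\<close>.\<close>
    define r where "r = s + t - n"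
    have "(Y ^^ (s + t)) (T (h \<otimes>\<^bsub>G\<^esub> h') v) = (Y ^^ n) ((Y ^^ r) (T (h \<otimes>\<^bsub>G\<^esub> h') v))"
      using False funpow_add[of n r Y] by (simp add: r_def)
    also have "\<dots> = 0" using v xx xx' clos by (intro skew_repD(5)[OF rep]) auto
    finally show ?thesis using False by simp
  qed (use v xx xx' in \<open>simp add: skew_rep_bvec[OF rep fin]\<close>)
  also have "\<dots> = (\<Sum>z\<in>{..<n} \<times> carrier G. if z = (s + t, h \<otimes>\<^bsub>G\<^esub> h') then
      (if s + t < n then mscale M (inverse (\<chi> h) ^ t) (mact M (bvec (s + t, h \<otimes>\<^bsub>G\<^esub> h')) v) else 0) else 0)"
    using xx xx' fin by simp
  also have "\<dots> = (\<Sum>z\<in>{..<n} \<times> carrier G. mscale M (bmult (nilp_alg G \<chi> n) x x' z) (mact M (bvec z) v))"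
    by (rule sum.cong) (auto simp: xx xx' nilp_alg_def bvec_def)
  finally show ?thesis .
qed

section \<open>Tensor products and the action of the tensor square\<close>

lemma vector_space_functional: "vector_space (\<lambda>c (t :: 'a \<Rightarrow> 'k::field) x. c * t x)"
  by unfold_locales (auto simp: fun_eq_iff algebra_simps)

lemma pure_tensor_mem:
  fixes M :: "('b, 'k::field, 'v::ab_group_add) amod" and N :: "('b, 'k, 'w::ab_group_add) amod"
  assumes "v \<in> mcar M" "w \<in> mcar N"
  shows "pure_tensor M N v w \<in> mcar (tensor A M N)"
proof -
  interpret T: vector_space "\<lambda>c (t :: ('v \<Rightarrow> 'w \<Rightarrow> 'k) \<Rightarrow> 'k) \<beta>. c * t \<beta>"
    by (rule vector_space_functional)
  show ?thesis using assms by (auto simp: tensor_def intro: T.span_base)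
qed

lemma tensor_subspace:
  shows "vector_space (mscale (tensor A M N))"
    and "module.subspace (mscale (tensor A M N)) (mcar (tensor A M N))"
proof -
  show vs: "vector_space (mscale (tensor A M N))"
    by (simp add: tensor_def vector_space_functional)
  interpret T: vector_space "mscale (tensor A M N)" by (rule vs)
  show "module.subspace (mscale (tensor A M N)) (mcar (tensor A M N))"
    using T.subspace_span by (simp add: tensor_def)
qed

text \<open>
  The pure tensors span, so linear maps out of a tensor product are compared on them alone.
\<close>

lemma tensor_eqI:
  assumes s: "vector_space s"
    and f: "linear_between (mcar (tensor A M N)) (mscale (tensor A M N)) s f"
    and f': "linear_between (mcar (tensor A M N)) (mscale (tensor A M N)) s f'"
    and eq: "\<And>v w. v \<in> mcar M \<Longrightarrow> w \<in> mcar N \<Longrightarrow> f (pure_tensor M N v w) = f' (pure_tensor M N v w)"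
    and t: "t \<in> mcar (tensor A M N)"
  shows "f t = f' t"
proof -
  interpret T: vector_space "mscale (tensor A M N)" by (rule tensor_subspace)
  let ?P = "{pure_tensor M N v w | v w. v \<in> mcar M \<and> w \<in> mcar N}"
  have car: "mcar (tensor A M N) = T.span ?P" by (simp add: tensor_def)
  note D = linear_betweenD[OF f, unfolded car] linear_betweenD[OF f', unfolded car]
  from t have "t \<in> T.span ?P" by (simp add: car)
  then have "t \<in> T.span ?P \<and> f t = f' t"
  proof (induction rule: T.span_induct_alt)
    case base
    show ?case
      by (rule conjI[OF T.span_zero])
        (simp only: linear_between_zero[OF tensor_subspace(1) s tensor_subspace(2) f]
          linear_between_zero[OF tensor_subspace(1) s tensor_subspace(2) f'])
  next
    case (step c b t)
    have b: "b \<in> T.span ?P" "mscale (tensor A M N) c b \<in> T.span ?P"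
      using T.span_base[OF step(1)] T.span_scale[OF T.span_base[OF step(1)]] by -
    have "f b = f' b" using step(1) eq by blast
    then show ?case using b step(2) T.span_add[OF b(2)] by (simp only: D simp_thms)
  qed
  then show ?thesis by simp
qed

lemma tensor_closedI:
  assumes s: "vector_space s" "module.subspace s X"
    and f: "linear_between (mcar (tensor A M N)) (mscale (tensor A M N)) s f"
    and X: "\<And>v w. v \<in> mcar M \<Longrightarrow> w \<in> mcar N \<Longrightarrow> f (pure_tensor M N v w) \<in> X"
    and t: "t \<in> mcar (tensor A M N)"
  shows "f t \<in> X"
proof -
  interpret s: vector_space s by fact
  interpret T: vector_space "mscale (tensor A M N)" by (rule tensor_subspace)
  let ?P = "{pure_tensor M N v w | v w. v \<in> mcar M \<and> w \<in> mcar N}"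
  have car: "mcar (tensor A M N) = T.span ?P" by (simp add: tensor_def)
  note D = linear_betweenD[OF f, unfolded car]
  from t have "t \<in> T.span ?P" by (simp add: car)
  then have "t \<in> T.span ?P \<and> f t \<in> X"
  proof (induction rule: T.span_induct_alt)
    case base
    show ?case
      by (rule conjI[OF T.span_zero])
        (simp only: linear_between_zero[OF tensor_subspace(1) s(1) tensor_subspace(2) f]
          s.subspace_0[OF s(2)])
  next
    case (step c b t)
    have b: "b \<in> T.span ?P" "mscale (tensor A M N) c b \<in> T.span ?P"
      using T.span_base[OF step(1)] T.span_scale[OF T.span_base[OF step(1)]] by -
    have "f b \<in> X" using step(1) X by blast
    then show ?case
      using b step(2) T.span_add[OF b(2)] s.subspace_add[OF s(2)] s.subspace_scale[OF s(2)] by (simp only: D simp_thms)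
  qed
  then show ?thesis by simp
qed

text \<open>
  A concrete model \<open>X\<close> of a tensor product is recognised by a pair of maps. The composite
  \<open>f' \<circ> f\<close> has to be checked on pure tensors only, so no count of dimensions and no basis of the
  tensor product is involved.
\<close>

lemma tensor_bij:
  assumes s: "vector_space s" "module.subspace s X"
    and f: "linear_between (mcar (tensor A M N)) (mscale (tensor A M N)) s f"
    and X: "\<And>v w. v \<in> mcar M \<Longrightarrow> w \<in> mcar N \<Longrightarrow> f (pure_tensor M N v w) \<in> X"
    and inv: "\<And>v w. v \<in> mcar M \<Longrightarrow> w \<in> mcar N \<Longrightarrow> f' (f (pure_tensor M N v w)) = pure_tensor M N v w"
    and f': "linear_between X s (mscale (tensor A M N)) f'"
    and inv': "\<And>x. x \<in> X \<Longrightarrow> f' x \<in> mcar (tensor A M N)" "\<And>x. x \<in> X \<Longrightarrow> f (f' x) = x"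
  shows "bij_betw f (mcar (tensor A M N)) X"
proof (rule bij_betw_byWitness[where f' = f'])
  have clos: "f t \<in> X" if "t \<in> mcar (tensor A M N)" for t
    by (rule tensor_closedI[OF s f X that])
  then show "f ` mcar (tensor A M N) \<subseteq> X" by blast
  have "f' (f t) = t" if "t \<in> mcar (tensor A M N)" for t
  proof (rule tensor_eqI[where A = A and M = M and N = N and s = "mscale (tensor A M N)" and f' = "\<lambda>t. t", OF tensor_subspace(1)])
    show "linear_between (mcar (tensor A M N)) (mscale (tensor A M N)) (mscale (tensor A M N)) (\<lambda>t. f' (f t))"
      by (rule linear_between_compose[OF f f']) (use clos in blast)
  qed (use that inv in \<open>auto simp: linear_between_def\<close>)
  then show "\<forall>t\<in>mcar (tensor A M N). f' (f t) = t" by blast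
qed (use inv' in auto)

text \<open>
  The action of a whole element of \<open>A \<otimes> A\<close>. The module structure of a tensor product is its
  pull-back along the comultiplication.
\<close>

definition tensor_act :: "('b, 'k::field, 'z) balg_scheme \<Rightarrow> ('b, 'k, 'v::ab_group_add) amod \<Rightarrow>
    ('b, 'k, 'w::ab_group_add) amod \<Rightarrow> ('b \<times> 'b \<Rightarrow> 'k) \<Rightarrow>
    (('v \<Rightarrow> 'w \<Rightarrow> 'k) \<Rightarrow> 'k) \<Rightarrow> ('v \<Rightarrow> 'w \<Rightarrow> 'k) \<Rightarrow> 'k" where
  "tensor_act A M N c t = (\<lambda>\<beta>. \<Sum>x\<in>Bas A \<times> Bas A.
     c x * tensor_map M N (mact M (bvec (fst x))) (mact N (bvec (snd x))) t \<beta>)"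

lemma mact_tensor: "mact (tensor A M N) a = tensor_act A M N (comult A a)"
  by (intro ext) (simp add: tensor_def tensor_act_def sum.cartesian_product split_def)

lemma tensor_act_linear:
  "linear_between V (mscale (tensor A M N)) (mscale (tensor A M N)) (tensor_act B M N c)"
proof (rule linear_betweenI; rule ext)
  have add: "tensor_map M N \<phi> \<psi> (t + t') \<beta> = tensor_map M N \<phi> \<psi> t \<beta> + tensor_map M N \<phi> \<psi> t' \<beta>"
    and scale: "tensor_map M N \<phi> \<psi> (mscale (tensor A M N) r t) \<beta> = r * tensor_map M N \<phi> \<psi> t \<beta>"
    for \<phi> \<psi> t t' r \<beta>
    by (simp_all add: tensor_map_def tensor_def)
  show "tensor_act B M N c (t + t') \<beta> = (tensor_act B M N c t + tensor_act B M N c t') \<beta>" for t t' \<beta>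
    by (simp add: tensor_act_def add distrib_left sum.distrib)
  have "tensor_act B M N c (mscale (tensor A M N) r t) \<beta> = r * tensor_act B M N c t \<beta>" for r t \<beta>
    by (simp add: tensor_act_def scale sum_distrib_left mult.left_commute)
  then show "tensor_act B M N c (mscale (tensor A M N) r t) \<beta> =
      mscale (tensor A M N) r (tensor_act B M N c t) \<beta>" for r t \<beta>
    by (simp add: tensor_def)
qed

lemma tensor_act_add: "tensor_act A M N (\<lambda>x. c x + d x) t = tensor_act A M N c t + tensor_act A M N d t"
  by (rule ext) (simp add: tensor_act_def distrib_right sum.distrib)

lemma sum_fun_apply: "(\<Sum>i\<in>I. f i) x = (\<Sum>i\<in>I. f i x)"
  by (induction I rule: infinite_finite_induct) auto

lemma tensor_act_bvec:
  assumes "finite (Bas A)" "p \<in> Bas A" "q \<in> Bas A"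
  shows "tensor_act A M N (bvec (p, q)) t = tensor_map M N (mact M (bvec p)) (mact N (bvec q)) t"
proof
  fix \<beta>
  have "tensor_act A M N (bvec (p, q)) t \<beta> =
    (\<Sum>x\<in>Bas A \<times> Bas A. if x = (p, q) then tensor_map M N (mact M (bvec p)) (mact N (bvec q)) t \<beta> else 0)"
    unfolding tensor_act_def by (rule sum.cong) (auto simp: bvec_def)
  then show "tensor_act A M N (bvec (p, q)) t \<beta> = tensor_map M N (mact M (bvec p)) (mact N (bvec q)) t \<beta>"
    using assms by simp
qed

text \<open>
  Multiplicativity of the action on basis elements is all that the tensor product
  construction uses of a module.
\<close>

definition basis_rep :: "('b, 'k::field, 'z) balg_scheme \<Rightarrow> ('b, 'k, 'v::ab_group_add) amod \<Rightarrow> bool" where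
  "basis_rep A M \<longleftrightarrow> vector_space (mscale M) \<and> module.subspace (mscale M) (mcar M) \<and>
     (\<forall>x\<in>Bas A. mact M (bvec x) ` mcar M \<subseteq> mcar M \<and>
        linear_between (mcar M) (mscale M) (mscale M) (mact M (bvec x))) \<and>
     (\<forall>x\<in>Bas A. \<forall>x'\<in>Bas A. \<forall>v\<in>mcar M. mact M (bvec x) (mact M (bvec x') v) =
        (\<Sum>z\<in>Bas A. mscale M (bmult A x x' z) (mact M (bvec z) v)))"

lemma basis_repD:
  assumes "basis_rep A M"
  shows "vector_space (mscale M)" "module.subspace (mscale M) (mcar M)"
    "x \<in> Bas A \<Longrightarrow> mact M (bvec x) ` mcar M \<subseteq> mcar M"
    "x \<in> Bas A \<Longrightarrow> v \<in> mcar M \<Longrightarrow> mact M (bvec x) v \<in> mcar M"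
    "x \<in> Bas A \<Longrightarrow> linear_between (mcar M) (mscale M) (mscale M) (mact M (bvec x))"
    "x \<in> Bas A \<Longrightarrow> x' \<in> Bas A \<Longrightarrow> v \<in> mcar M \<Longrightarrow> mact M (bvec x) (mact M (bvec x') v) =
        (\<Sum>z\<in>Bas A. mscale M (bmult A x x' z) (mact M (bvec z) v))"
  using assms unfolding basis_rep_def by blast+

lemma pure_tensor_sum:
  fixes M :: "('b, 'k::field, 'v::ab_group_add) amod" and N :: "('b, 'k, 'w::ab_group_add) amod"
  assumes M: "vector_space (mscale M)" "module.subspace (mscale M) (mcar M)"
    and N: "vector_space (mscale N)" "module.subspace (mscale N) (mcar N)"
    and "\<And>i. i \<in> I \<Longrightarrow> v i \<in> mcar M" "\<And>j. j \<in> J \<Longrightarrow> w j \<in> mcar N"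
  shows "pure_tensor M N (\<Sum>i\<in>I. mscale M (c i) (v i)) (\<Sum>j\<in>J. mscale N (d j) (w j)) \<beta> =
    (\<Sum>x\<in>I\<times>J. c (fst x) * d (snd x) * pure_tensor M N (v (fst x)) (w (snd x)) \<beta>)"
proof (cases "bilinear_form M N \<beta>")
  case True
  interpret M: vector_space "mscale M" by fact
  interpret N: vector_space "mscale N" by fact
  have K: "vector_space ((*) :: 'k \<Rightarrow> 'k \<Rightarrow> 'k)" by unfold_locales (auto simp: algebra_simps)
  have l: "linear_between (mcar M) (mscale M) (*) (\<lambda>v. \<beta> v w)" if "w \<in> mcar N" for w
    using True that by (auto simp: bilinear_form_def bilinear_between_def)
  have r: "linear_between (mcar N) (mscale N) (*) (\<beta> v)" if "v \<in> mcar M" for v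
    using True that by (auto simp: bilinear_form_def bilinear_between_def)
  have "\<beta> (\<Sum>i\<in>I. mscale M (c i) (v i)) (\<Sum>j\<in>J. mscale N (d j) (w j)) =
      (\<Sum>i\<in>I. c i * \<beta> (v i) (\<Sum>j\<in>J. mscale N (d j) (w j)))"
    by (rule linear_between_sum[OF M(1) K M(2) l])
      (use N assms(5,6) in \<open>auto intro!: N.subspace_sum N.subspace_scale\<close>)
  also have "\<dots> = (\<Sum>i\<in>I. c i * (\<Sum>j\<in>J. d j * \<beta> (v i) (w j)))"
    by (rule sum.cong) (use assms(5,6) in \<open>auto simp: linear_between_sum[OF N(1) K N(2) r]\<close>)
  finally show ?thesis
    using True by (simp add: pure_tensor_def sum_distrib_left sum.cartesian_product split_def mult.assoc)
qed (simp add: pure_tensor_def)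

lemma tensor_act_pure:
  assumes "basis_rep A M" "basis_rep A N" "v \<in> mcar M" "w \<in> mcar N"
  shows "tensor_act A M N c (pure_tensor M N v w) \<beta> = (\<Sum>x\<in>Bas A \<times> Bas A.
     c x * pure_tensor M N (mact M (bvec (fst x)) v) (mact N (bvec (snd x)) w) \<beta>)"
  unfolding tensor_act_def
  by (rule sum.cong[OF refl], subst tensor_map_pure) (auto intro: basis_repD(4,5)[OF assms(1)] basis_repD(4,5)[OF assms(2)])

lemma tensor_act_closed:
  assumes "basis_rep A M" "basis_rep A N" "t \<in> mcar (tensor B M N)"
  shows "tensor_act A M N c t \<in> mcar (tensor B M N)"
proof (rule tensor_closedI[OF tensor_subspace tensor_act_linear _ assms(3)])
  fix v w assume vw: "v \<in> mcar M" "w \<in> mcar N"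
  interpret T: vector_space "mscale (tensor B M N)" by (rule tensor_subspace)
  have "tensor_act A M N c (pure_tensor M N v w) = (\<Sum>x\<in>Bas A \<times> Bas A.
     mscale (tensor B M N) (c x) (pure_tensor M N (mact M (bvec (fst x)) v) (mact N (bvec (snd x)) w)))"
    by (rule ext) (simp add: tensor_act_pure[OF assms(1,2) vw] sum_fun_apply tensor_def)
  then show "tensor_act A M N c (pure_tensor M N v w) \<in> mcar (tensor B M N)"
    using vw by (simp only:) (intro T.subspace_sum T.subspace_scale tensor_subspace pure_tensor_mem
        basis_repD(4)[OF assms(1)] basis_repD(4)[OF assms(2)]; auto)
qed

text \<open>
  By bilinearity both sides expand to triple sums of pure tensors \<open>z v \<otimes> z' w\<close> weighted with
  products of structure constants, and they differ only in the order of summation. Together with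
  \<open>\<Delta>(y\<^sup>s h) = \<Delta>(y)\<^sup>s \<Delta>(h)\<close> this reduces the tensor product to the action of \<open>\<Delta>(y)\<close> and \<open>\<Delta>(h)\<close>.
\<close>

lemma tensor_act_mult:
  assumes M: "basis_rep A M" and N: "basis_rep A N" and t: "t \<in> mcar (tensor B M N)"
  shows "tensor_act A M N (c \<otimes>\<^bsub>alg_ring (tensor_square A)\<^esub> d) t = tensor_act A M N c (tensor_act A M N d t)"
proof (rule tensor_eqI[where A = B and M = M and N = N and s = "mscale (tensor B M N)" and
      f = "tensor_act A M N (c \<otimes>\<^bsub>alg_ring (tensor_square A)\<^esub> d)"
      and f' = "\<lambda>t. tensor_act A M N c (tensor_act A M N d t)" for B, OF tensor_subspace(1) tensor_act_linear _ _ t])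
  show "linear_between (mcar (tensor B M N)) (mscale (tensor B M N)) (mscale (tensor B M N))
     (\<lambda>t. tensor_act A M N c (tensor_act A M N d t))"
    by (rule linear_between_compose[OF tensor_act_linear tensor_act_linear subset_UNIV])
  fix v w assume vw: "v \<in> mcar M" "w \<in> mcar N"
  note clos = basis_repD(4)[OF M _ vw(1)] basis_repD(4)[OF N _ vw(2)]
  define BB where "BB = Bas A \<times> Bas A"
  define P where "P = (\<lambda>x. pure_tensor M N (mact M (bvec (fst x)) v) (mact N (bvec (snd x)) w))"
  define m where "m = (\<lambda>x x' z. bmult A (fst x) (fst x') (fst z) * bmult A (snd x) (snd x') (snd z))"
  show "tensor_act A M N (c \<otimes>\<^bsub>alg_ring (tensor_square A)\<^esub> d) (pure_tensor M N v w) =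
    tensor_act A M N c (tensor_act A M N d (pure_tensor M N v w))"
  proof
    fix \<beta>
    have step: "tensor_map M N (mact M (bvec (fst x))) (mact N (bvec (snd x))) (P x') \<beta> =
       (\<Sum>z\<in>BB. m x x' z * P z \<beta>)" if "x \<in> BB" "x' \<in> BB" for x x'
    proof -
      have "tensor_map M N (mact M (bvec (fst x))) (mact N (bvec (snd x))) (P x') \<beta> =
        pure_tensor M N (mact M (bvec (fst x)) (mact M (bvec (fst x')) v))
           (mact N (bvec (snd x)) (mact N (bvec (snd x')) w)) \<beta>"
        unfolding P_def using that
        by (subst tensor_map_pure) (auto simp: BB_def intro: basis_repD(4,5)[OF M] basis_repD(4,5)[OF N])
      also have "\<dots> = (\<Sum>z\<in>BB. m x x' z * P z \<beta>)"
      proof -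
        have x: "fst x \<in> Bas A" "snd x \<in> Bas A" "fst x' \<in> Bas A" "snd x' \<in> Bas A"
          using that by (auto simp: BB_def)
        show ?thesis
          unfolding P_def m_def BB_def basis_repD(6)[OF M x(1,3) vw(1)] basis_repD(6)[OF N x(2,4) vw(2)]
          by (rule pure_tensor_sum[OF basis_repD(1,2)[OF M] basis_repD(1,2)[OF N]]) (erule clos)+
      qed
      finally show ?thesis .
    qed
    have lin: "tensor_map M N \<phi> \<psi> (tensor_act A M N d (pure_tensor M N v w)) \<beta> =
        (\<Sum>x'\<in>BB. d x' * tensor_map M N \<phi> \<psi> (P x') \<beta>)" for \<phi> \<psi>
      by (auto simp: tensor_map_def tensor_act_pure[OF M N vw] P_def BB_def)
    have "tensor_act A M N c (tensor_act A M N d (pure_tensor M N v w)) \<beta> =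
      (\<Sum>x\<in>BB. c x * (\<Sum>x'\<in>BB. d x' * (\<Sum>z\<in>BB. m x x' z * P z \<beta>)))"
      unfolding tensor_act_def[where t = "tensor_act A M N d (pure_tensor M N v w)"] BB_def[symmetric] lin
      by (intro sum.cong arg_cong2[of _ _ _ _ "(*)"] refl) (simp add: step)
    also have "\<dots> = (\<Sum>x\<in>BB. \<Sum>x'\<in>BB. \<Sum>z\<in>BB. c x * d x' * m x x' z * P z \<beta>)"
      by (simp add: sum_distrib_left mult.assoc)
    also have "\<dots> = (\<Sum>x\<in>BB. \<Sum>z\<in>BB. \<Sum>x'\<in>BB. c x * d x' * m x x' z * P z \<beta>)"
      by (rule sum.cong[OF refl], rule sum.swap)
    also have "\<dots> = (\<Sum>z\<in>BB. \<Sum>x\<in>BB. \<Sum>x'\<in>BB. c x * d x' * m x x' z * P z \<beta>)"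
      by (rule sum.swap)
    also have "\<dots> = (\<Sum>z\<in>BB. (\<Sum>x\<in>BB. \<Sum>x'\<in>BB. c x * d x' * m x x' z) * P z \<beta>)"
      by (simp add: sum_distrib_right)
    also have "\<dots> = tensor_act A M N (c \<otimes>\<^bsub>alg_ring (tensor_square A)\<^esub> d) (pure_tensor M N v w) \<beta>"
      unfolding tensor_act_pure[OF M N vw] BB_def P_def
      by (simp add: alg_ring_def tensor_square_def m_def split_def)
    finally show "tensor_act A M N (c \<otimes>\<^bsub>alg_ring (tensor_square A)\<^esub> d) (pure_tensor M N v w) \<beta> =
       tensor_act A M N c (tensor_act A M N d (pure_tensor M N v w)) \<beta>" by simp
  qed
qed

section \<open>Tensor products in terms of the generators\<close>

lemma skew_rep_basis_rep:
  assumes "skew_rep G \<chi> n M T Y" "nilpotent_datum G \<chi> g n"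
  shows "basis_rep (nilp_alg G \<chi> n) M"
proof -
  have fin: "finite (carrier G)" using assms(2) by (simp add: nilpotent_datum_def)
  have Bas: "Bas (nilp_alg G \<chi> n) = {..<n} \<times> carrier G" by (simp add: nilp_alg_def)
  show ?thesis
    unfolding basis_rep_def Bas
    using acts_byD(1,2)[OF skew_repD(1)[OF assms(1)]] skew_rep_bvec_linear[OF assms(1) fin]
      skew_rep_bvec_mult[OF assms] by blast
qed

definition tensor_T where
  "tensor_T G \<chi> n M N h = tensor_act (nilp_alg G \<chi> n) M N (bvec ((0, h), (0, h)))"

definition tensor_Y where
  "tensor_Y G \<chi> g n M N = tensor_act (nilp_alg G \<chi> n) M N
     (\<lambda>x. bvec ((1, \<one>\<^bsub>G\<^esub>), (0, g)) x + bvec ((0, \<one>\<^bsub>G\<^esub>), (1, \<one>\<^bsub>G\<^esub>)) x)"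

lemma tensor_T_pure:
  assumes "nilpotent_datum G \<chi> g n" "skew_rep G \<chi> n M T Y" "skew_rep G \<chi> n N T' Y'"
    and "h \<in> carrier G" "v \<in> mcar M" "w \<in> mcar N"
  shows "tensor_T G \<chi> n M N h (pure_tensor M N v w) = pure_tensor M N (T h v) (T' h w)"
proof -
  have fin: "finite (carrier G)" and n: "2 \<le> n" using assms(1) by (auto simp: nilpotent_datum_def)
  have h: "(0, h) \<in> {..<n} \<times> carrier G" using assms(4) n by auto
  have "tensor_T G \<chi> n M N h (pure_tensor M N v w) =
    tensor_map M N (mact M (bvec (0, h))) (mact N (bvec (0, h))) (pure_tensor M N v w)"
    unfolding tensor_T_def by (rule tensor_act_bvec) (use h fin in \<open>auto simp: nilp_alg_def\<close>)
  also have "\<dots> = pure_tensor M N (T h v) (T' h w)"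
    using n assms(4-6) tensor_map_pure[OF skew_rep_bvec_linear[OF assms(2) fin h] skew_rep_bvec_linear[OF assms(3) fin h]]
    by (simp add: skew_rep_bvec[OF assms(2) fin] skew_rep_bvec[OF assms(3) fin])
  finally show ?thesis .
qed

lemma tensor_Y_pure:
  assumes "nilpotent_datum G \<chi> g n" "skew_rep G \<chi> n M T Y" "skew_rep G \<chi> n N T' Y'"
    and "v \<in> mcar M" "w \<in> mcar N"
  shows "tensor_Y G \<chi> g n M N (pure_tensor M N v w) =
    pure_tensor M N (Y v) (T' g w) + pure_tensor M N v (Y' w)"
proof -
  interpret group G using assms(1) by (simp add: nilpotent_datum_def)
  have fin: "finite (carrier G)" and n: "2 \<le> n" "0 < n" "1 < n" "Suc 0 < n" and g: "g \<in> carrier G"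
    using assms(1) by (auto simp: nilpotent_datum_def)
  have B: "(0, \<one>\<^bsub>G\<^esub>) \<in> {..<n} \<times> carrier G" "(1, \<one>\<^bsub>G\<^esub>) \<in> {..<n} \<times> carrier G" "(0, g) \<in> {..<n} \<times> carrier G"
    using g n by auto
  have act: "tensor_act (nilp_alg G \<chi> n) M N (bvec (p, q)) (pure_tensor M N v w) =
     pure_tensor M N (mact M (bvec p) v) (mact N (bvec q) w)"
    if "p \<in> {..<n} \<times> carrier G" "q \<in> {..<n} \<times> carrier G" for p q
  proof -
    have "tensor_act (nilp_alg G \<chi> n) M N (bvec (p, q)) (pure_tensor M N v w) =
      tensor_map M N (mact M (bvec p)) (mact N (bvec q)) (pure_tensor M N v w)"
      by (rule tensor_act_bvec) (use that fin in \<open>auto simp: nilp_alg_def\<close>)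
    then show ?thesis
      using tensor_map_pure[OF skew_rep_bvec_linear[OF assms(2) fin that(1)] skew_rep_bvec_linear[OF assms(3) fin that(2)]]
      by simp
  qed
  show ?thesis
    unfolding tensor_Y_def tensor_act_add act[OF B(2,3)] act[OF B(1,2)]
    using assms(4,5) n g
    by (simp add: skew_rep_bvec[OF assms(2) fin] skew_rep_bvec[OF assms(3) fin]
        skew_repD(4)[OF assms(2)] skew_repD(4)[OF assms(3)])
qed

lemma tensor_T_linear:
  "linear_between V (mscale (tensor A M N)) (mscale (tensor A M N)) (tensor_T G \<chi> n M N h)"
  unfolding tensor_T_def by (rule tensor_act_linear)

lemma tensor_Y_linear:
  "linear_between V (mscale (tensor A M N)) (mscale (tensor A M N)) (tensor_Y G \<chi> g n M N)"
  unfolding tensor_Y_def by (rule tensor_act_linear)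

text \<open>
  The comultiplication is defined on \<open>y\<^sup>s h\<close> through powers in \<open>H \<otimes> H\<close>. Multiplicativity of
  the action of \<open>H \<otimes> H\<close> turns these powers into iterates of a single operator.
\<close>

lemma tensor_acts_by:
  fixes \<chi> :: "'g \<Rightarrow> 'k::field"
  assumes dat: "nilpotent_datum G \<chi> g n" and M: "skew_rep G \<chi> n M T Y" and N: "skew_rep G \<chi> n N T' Y'"
  shows "acts_by G n (tensor (nilp_hopf G \<chi> g n) M N) (tensor_T G \<chi> n M N) (tensor_Y G \<chi> g n M N)"
proof -
  define A where "A = nilp_alg G \<chi> n"
  define W where "W = tensor (nilp_hopf G \<chi> g n) M N"
  define R where "R = alg_ring (tensor_square A)"
  define y :: "(nat \<times> 'g) \<times> (nat \<times> 'g) \<Rightarrow> 'k" where "y = (\<lambda>x. bvec ((1, \<one>\<^bsub>G\<^esub>), (0, g)) x + bvec ((0, \<one>\<^bsub>G\<^esub>), (1, \<one>\<^bsub>G\<^esub>)) x)"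
  interpret group G using dat by (simp add: nilpotent_datum_def)
  have fin: "finite (carrier G)" and n: "0 < n" and g: "g \<in> carrier G"
    using dat by (auto simp: nilpotent_datum_def)
  note bM = skew_rep_basis_rep[OF M dat, folded A_def] and bN = skew_rep_basis_rep[OF N dat, folded A_def]
  have clos: "tensor_act A M N c t \<in> mcar W" if "t \<in> mcar W" for c t
    using that tensor_act_closed[OF bM bN] by (simp add: W_def)
  have mult: "tensor_act A M N (c \<otimes>\<^bsub>R\<^esub> d) t = tensor_act A M N c (tensor_act A M N d t)"
    if "t \<in> mcar W" for c d t
    using tensor_act_mult[OF bM bN] that by (simp add: W_def R_def)
  have one: "tensor_act A M N \<one>\<^bsub>R\<^esub> t = t" if t: "t \<in> mcar W" for t
  proof -
    have "\<one>\<^bsub>R\<^esub> = bvec ((0, \<one>\<^bsub>G\<^esub>), (0, \<one>\<^bsub>G\<^esub>))"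
      by (auto simp: R_def A_def alg_ring_def tensor_square_def nilp_alg_def bvec_def fun_eq_iff)
    then have "tensor_act A M N \<one>\<^bsub>R\<^esub> t = tensor_T G \<chi> n M N \<one>\<^bsub>G\<^esub> t"
      by (simp add: tensor_T_def A_def)
    also have "\<dots> = (\<lambda>t. t) t"
      by (rule tensor_eqI[OF tensor_subspace(1) tensor_T_linear _ _ t[unfolded W_def]])
        (auto simp: linear_between_def tensor_T_pure[OF dat M N] skew_repD(4)[OF M] skew_repD(4)[OF N])
    finally show ?thesis .
  qed
  have pow: "tensor_act A M N (y [^]\<^bsub>R\<^esub> s) t = (tensor_act A M N y ^^ s) t" if "t \<in> mcar W" for s :: nat and t
    using that
  proof (induction s arbitrary: t)
    case 0
    then show ?case by (simp add: one nat_pow_def)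
  next
    case (Suc s)
    have "y [^]\<^bsub>R\<^esub> Suc s = y [^]\<^bsub>R\<^esub> s \<otimes>\<^bsub>R\<^esub> y" by (simp add: nat_pow_def)
    then show ?case using Suc clos by (simp add: mult funpow_swap1)
  qed
  have comult: "nilp_comult G \<chi> g n (s, h) = y [^]\<^bsub>R\<^esub> s \<otimes>\<^bsub>R\<^esub> bvec ((0, h), (0, h))" for s h
    by (simp add: nilp_comult_def Let_def R_def A_def y_def alg_ring_def)
  have act: "tensor_act A M N (nilp_comult G \<chi> g n (s, h)) t =
      (tensor_Y G \<chi> g n M N ^^ s) (tensor_T G \<chi> n M N h t)" if "t \<in> mcar W" for s h t
    unfolding comult mult[OF that] pow[OF clos[OF that]] tensor_T_def tensor_Y_def A_def[symmetric] y_def[symmetric] ..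
  show ?thesis
    unfolding acts_by_def
  proof (intro conjI allI ballI tensor_subspace)
    show "tensor_T G \<chi> n M N h t \<in> mcar (tensor (nilp_hopf G \<chi> g n) M N)"
      "tensor_Y G \<chi> g n M N t \<in> mcar (tensor (nilp_hopf G \<chi> g n) M N)"
      if "t \<in> mcar (tensor (nilp_hopf G \<chi> g n) M N)" for t h
      using that clos by (auto simp: tensor_T_def tensor_Y_def A_def W_def)
    fix a t assume t: "t \<in> mcar (tensor (nilp_hopf G \<chi> g n) M N)"
    show "mact (tensor (nilp_hopf G \<chi> g n) M N) a t =
      (\<Sum>(s, h)\<in>{..<n} \<times> carrier G. mscale (tensor (nilp_hopf G \<chi> g n) M N) (a (s, h))
        ((tensor_Y G \<chi> g n M N ^^ s) (tensor_T G \<chi> n M N h t)))"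
    proof
      fix \<beta>
      have "mact (tensor (nilp_hopf G \<chi> g n) M N) a t \<beta> =
         tensor_act A M N (\<lambda>x. \<Sum>b\<in>{..<n} \<times> carrier G. a b * nilp_comult G \<chi> g n b x) t \<beta>"
        unfolding mact_tensor comult_def
        by (simp add: tensor_act_def A_def nilp_hopf_def balg.defs nilp_alg_def)
      also have "\<dots> = (\<Sum>b\<in>{..<n} \<times> carrier G. a b * tensor_act A M N (nilp_comult G \<chi> g n b) t \<beta>)"
        unfolding tensor_act_def sum_distrib_right sum_distrib_left
        by (subst sum.swap) (simp add: mult.assoc)
      also have "\<dots> = (\<Sum>(s, h)\<in>{..<n} \<times> carrier G. a (s, h) *
          (tensor_Y G \<chi> g n M N ^^ s) (tensor_T G \<chi> n M N h t) \<beta>)"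
        by (rule sum.cong) (auto simp: act[OF t[folded W_def]])
      finally show "mact (tensor (nilp_hopf G \<chi> g n) M N) a t \<beta> =
        (\<Sum>(s, h)\<in>{..<n} \<times> carrier G. mscale (tensor (nilp_hopf G \<chi> g n) M N) (a (s, h))
        ((tensor_Y G \<chi> g n M N ^^ s) (tensor_T G \<chi> n M N h t))) \<beta>"
        by (simp add: sum_fun_apply split_def tensor_def)
    qed
  qed
qed

section \<open>The modules built from a group representation\<close>

text \<open>
  A representation of the group, read off from the action of the basis of \<open>KG\<close> alone.
\<close>

definition group_rep :: "('g, 'y) monoid_scheme \<Rightarrow> ('g, 'k::field, 'v::ab_group_add) amod \<Rightarrow> bool" where
  "group_rep G V \<longleftrightarrow> vector_space (mscale V) \<and> module.subspace (mscale V) (mcar V) \<and>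
     (\<forall>h\<in>carrier G. \<forall>v\<in>mcar V. mact V (bvec h) v \<in> mcar V) \<and>
     (\<forall>h\<in>carrier G. linear_between (mcar V) (mscale V) (mscale V) (mact V (bvec h))) \<and>
     (\<forall>v\<in>mcar V. mact V (bvec \<one>\<^bsub>G\<^esub>) v = v) \<and>
     (\<forall>h\<in>carrier G. \<forall>h'\<in>carrier G. \<forall>v\<in>mcar V.
        mact V (bvec h) (mact V (bvec h') v) = mact V (bvec (h \<otimes>\<^bsub>G\<^esub> h')) v)"

lemma group_repD:
  assumes "group_rep G V"
  shows "vector_space (mscale V)" "module.subspace (mscale V) (mcar V)"
     "h \<in> carrier G \<Longrightarrow> v \<in> mcar V \<Longrightarrow> mact V (bvec h) v \<in> mcar V"
     "h \<in> carrier G \<Longrightarrow> linear_between (mcar V) (mscale V) (mscale V) (mact V (bvec h))"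
     "v \<in> mcar V \<Longrightarrow> mact V (bvec \<one>\<^bsub>G\<^esub>) v = v"
     "h \<in> carrier G \<Longrightarrow> h' \<in> carrier G \<Longrightarrow> v \<in> mcar V \<Longrightarrow>
        mact V (bvec h) (mact V (bvec h') v) = mact V (bvec (h \<otimes>\<^bsub>G\<^esub> h')) v"
  using assms unfolding group_rep_def by blast+

lemma group_rep_linear:
  assumes "group_rep G V" "h \<in> carrier G"
  shows "v \<in> mcar V \<Longrightarrow> w \<in> mcar V \<Longrightarrow>
      mact V (bvec h) (v + w) = mact V (bvec h) v + mact V (bvec h) w"
    "v \<in> mcar V \<Longrightarrow> mact V (bvec h) (mscale V c v) = mscale V c (mact V (bvec h) v)"
    "mact V (bvec h) 0 = 0"
  using linear_betweenD[OF group_repD(4)[OF assms]]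
    linear_between_zero[OF group_repD(1,1,2)[OF assms(1)] group_repD(4)[OF assms]] by auto

lemma fin_module_group_rep:
  fixes G :: "('g, 'y) monoid_scheme" and V :: "('g, 'k::field, 'v::ab_group_add) amod"
  assumes "fin_module (group_algebra G :: ('g, 'k) bialg) V" "group G" "finite (carrier G)"
  shows "group_rep G V"
proof -
  interpret group G by fact
  let ?A = "group_algebra G :: ('g, 'k) bialg"
  have car: "bvec h \<in> carrier (alg_ring ?A)" if "h \<in> carrier G" for h
    using that by (auto simp: alg_ring_def group_algebra_def bvec_def)
  have one: "\<one>\<^bsub>alg_ring ?A\<^esub> = bvec \<one>\<^bsub>G\<^esub>" by (simp add: alg_ring_def group_algebra_def)
  have mult: "bvec h \<otimes>\<^bsub>alg_ring ?A\<^esub> bvec h' = bvec (h \<otimes>\<^bsub>G\<^esub> h')" if "h \<in> carrier G" "h' \<in> carrier G" for h h'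
    using alg_ring_bvec_mult[of ?A h h'] that assms(3) by (simp add: group_algebra_def)
  show ?thesis
    unfolding group_rep_def
  proof (intro conjI ballI)
    fix h h' v assume *: "h \<in> carrier G" "h' \<in> carrier G" "v \<in> mcar V"
    show "mact V (bvec h) (mact V (bvec h') v) = mact V (bvec (h \<otimes>\<^bsub>G\<^esub> h')) v"
      unfolding mult[OF *(1,2), symmetric] using assms(1) car *
      unfolding fin_module_def by (metis (no_types, lifting))
  qed (use assms(1) car one in \<open>auto simp: fin_module_def image_subset_iff\<close>)
qed

lemma vector_space_M_module:
  assumes "group_rep G V"
  shows "vector_space (mscale (M_module G \<chi> n V j))"
    "module.subspace (mscale (M_module G \<chi> n V j)) (mcar (M_module G \<chi> n V j))"
proof -
  interpret V: vector_space "mscale V" using group_repD(1)[OF assms] .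
  have [simp]: "0 \<in> mcar V" using group_repD(2)[OF assms] by (rule V.subspace_0)
  show vs: "vector_space (mscale (M_module G \<chi> n V j))"
    unfolding M_module_def amod.simps by (rule vector_space_fun) unfold_locales
  interpret vector_space "mscale (M_module G \<chi> n V j)" by fact
  show "subspace (mcar (M_module G \<chi> n V j))"
    unfolding subspace_def
    using V.subspace_add[OF group_repD(2)[OF assms]] V.subspace_scale[OF group_repD(2)[OF assms]]
    by (auto simp: M_module_def)
qed

lemma M_y_pow:
  assumes "\<And>k. k \<ge> j \<Longrightarrow> f k = 0"
  shows "(M_y j ^^ s) f k = (if s \<le> k \<and> k < j then f (k - s) else 0)"
  using assms by (induction s arbitrary: k) (auto simp: M_y_def)

lemma M_module_skew_rep:
  assumes dat: "nilpotent_datum G \<chi> g n" and V: "group_rep G V" and j: "j \<le> n"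
  shows "skew_rep G \<chi> n (M_module G \<chi> n V j) (M_grp \<chi> V) (M_y j)"
proof -
  interpret group G using dat by (simp add: nilpotent_datum_def)
  interpret V: vector_space "mscale V" using group_repD(1)[OF V] .
  let ?M = "M_module G \<chi> n V j"
  note sub = group_repD(2)[OF V]
  have [simp]: "0 \<in> mcar V" using sub by (rule V.subspace_0)
  have chi: "\<chi> h \<noteq> 0" "\<chi> (h \<otimes>\<^bsub>G\<^esub> h') = \<chi> h * \<chi> h'" if "h \<in> carrier G" "h' \<in> carrier G" for h h'
    using dat that by (auto simp: nilpotent_datum_def linear_character_def)
  have chi1: "\<chi> \<one>\<^bsub>G\<^esub> = 1" using chi[of "\<one>\<^bsub>G\<^esub>" "\<one>\<^bsub>G\<^esub>"] by simp
  have car: "f \<in> mcar ?M \<longleftrightarrow> (\<forall>k. f k \<in> mcar V) \<and> (\<forall>k\<ge>j. f k = 0)" for f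
    by (auto simp: M_module_def) (metis \<open>0 \<in> mcar V\<close> linorder_not_le)
  have sc: "mscale ?M = (\<lambda>c f k. mscale V c (f k))" by (simp add: M_module_def)
  note lin = group_rep_linear[OF V]
  have T: "M_grp \<chi> V h f \<in> mcar ?M" if "h \<in> carrier G" "f \<in> mcar ?M" for h f
    using that by (auto simp: car M_grp_def lin intro!: V.subspace_scale[OF sub] group_repD[OF V])
  have Y: "M_y j f \<in> mcar ?M" if "f \<in> mcar ?M" for f
    using that by (auto simp: car M_y_def)
  show ?thesis
    unfolding skew_rep_def acts_by_def
  proof (intro conjI ballI allI vector_space_M_module[OF V] T Y)
    show "mact ?M a f = (\<Sum>(s, h)\<in>{..<n} \<times> carrier G. mscale ?M (a (s, h)) ((M_y j ^^ s) (M_grp \<chi> V h f)))" for a f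
      by (rule ext) (simp add: M_module_def sum_fun_apply split_def)
    show "linear_between (mcar ?M) (mscale ?M) (mscale ?M) (M_grp \<chi> V h)" if "h \<in> carrier G" for h
      using that
      by (auto simp: linear_between_def car sc M_grp_def lin fun_eq_iff V.scale_right_distrib mult.commute)
    show "linear_between (mcar ?M) (mscale ?M) (mscale ?M) (M_y j)"
      by (auto simp: linear_between_def sc M_y_def fun_eq_iff)
    show "M_grp \<chi> V \<one>\<^bsub>G\<^esub> f = f" if "f \<in> mcar ?M" for f
      using that by (auto simp: M_grp_def car chi1 group_repD(5)[OF V])
    show "(M_y j ^^ n) f = 0" if "f \<in> mcar ?M" for f
      using that j by (auto simp: M_y_pow car fun_eq_iff)
    show "M_grp \<chi> V h (M_y j f) = mscale ?M (inverse (\<chi> h)) (M_y j (M_grp \<chi> V h f))"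
      if "h \<in> carrier G" "f \<in> mcar ?M" for h f
    proof
      fix k
      show "M_grp \<chi> V h (M_y j f) k = mscale ?M (inverse (\<chi> h)) (M_y j (M_grp \<chi> V h f)) k"
        using that by (cases k) (auto simp: M_grp_def M_y_def sc lin)
    qed
    show "M_grp \<chi> V h (M_grp \<chi> V h' f) = M_grp \<chi> V (h \<otimes>\<^bsub>G\<^esub> h') f"
      if "h \<in> carrier G" "h' \<in> carrier G" "f \<in> mcar ?M" for h h' f
      using that
      by (auto simp: M_grp_def car lin group_repD[OF V] chi fun_eq_iff power_mult_distrib)
  qed
qed

section \<open>Tensoring with the two-step module\<close>

text \<open>
  The universal property gives a linear map from the tensor product to the model \<open>X\<close>. It
  intertwines the operators as soon as the bilinear map \<open>b\<close> satisfies the product rule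
  for \<open>\<Delta>(y) = y \<otimes> g + 1 \<otimes> y\<close>, and \<open>P\<close> is its inverse.
\<close>

lemma tensor_module_iso:
  assumes dat: "nilpotent_datum G \<chi> g n" and M: "skew_rep G \<chi> n M T Y" and N: "skew_rep G \<chi> n N T' Y'"
    and X: "acts_by G n X TX YX"
    and TX: "\<And>h. h \<in> carrier G \<Longrightarrow> linear_between (mcar X) (mscale X) (mscale X) (TX h)"
    and YX: "linear_between (mcar X) (mscale X) (mscale X) YX"
    and b: "bilinear_between (mcar M) (mcar N) (mscale M) (mscale N) (mscale X) b"
    and bX: "\<And>v w. v \<in> mcar M \<Longrightarrow> w \<in> mcar N \<Longrightarrow> b v w \<in> mcar X"
    and bT: "\<And>h v w. h \<in> carrier G \<Longrightarrow> v \<in> mcar M \<Longrightarrow> w \<in> mcar N \<Longrightarrow> TX h (b v w) = b (T h v) (T' h w)"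
    and bY: "\<And>v w. v \<in> mcar M \<Longrightarrow> w \<in> mcar N \<Longrightarrow> YX (b v w) = b (Y v) (T' g w) + b v (Y' w)"
    and P: "linear_between (mcar X) (mscale X) (mscale (tensor (nilp_hopf G \<chi> g n) M N)) P"
    and PX: "\<And>x. x \<in> mcar X \<Longrightarrow> P x \<in> mcar (tensor (nilp_hopf G \<chi> g n) M N)"
    and Pb: "\<And>v w. v \<in> mcar M \<Longrightarrow> w \<in> mcar N \<Longrightarrow> P (b v w) = pure_tensor M N v w"
    and FP: "\<And>F x. linear_between (mcar (tensor (nilp_hopf G \<chi> g n) M N))
           (mscale (tensor (nilp_hopf G \<chi> g n) M N)) (mscale X) F \<Longrightarrow>
         (\<And>v w. v \<in> mcar M \<Longrightarrow> w \<in> mcar N \<Longrightarrow> F (pure_tensor M N v w) = b v w) \<Longrightarrow>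
         x \<in> mcar X \<Longrightarrow> F (P x) = x"
  shows "module_iso A (tensor (nilp_hopf G \<chi> g n) M N) X"
proof -
  let ?W = "tensor (nilp_hopf G \<chi> g n) M N"
  note W = tensor_acts_by[OF dat M N]
  have g: "g \<in> carrier G" using dat by (simp add: nilpotent_datum_def)
  note cM = acts_byD(3,4)[OF skew_repD(1)[OF M]] and cN = acts_byD(3,4)[OF skew_repD(1)[OF N]]
  obtain F where F: "linear_between (mcar ?W) (mscale ?W) (mscale X) F"
    and Fp: "\<And>v w. v \<in> mcar M \<Longrightarrow> w \<in> mcar N \<Longrightarrow> F (pure_tensor M N v w) = b v w"
    using tensor_universal[OF acts_byD(1)[OF X] b, of "nilp_hopf G \<chi> g n"] by blast
  have FX: "F t \<in> mcar X" if "t \<in> mcar ?W" for t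
    by (rule tensor_closedI[OF acts_byD(1,2)[OF X] F _ that]) (simp add: Fp bX)
  show ?thesis
  proof (rule module_iso_acts_by[OF W X _ F])
    show "bij_betw F (mcar ?W) (mcar X)"
    proof (rule tensor_bij[OF acts_byD(1,2)[OF X] F _ _ P PX])
      show "F (P x) = x" if "x \<in> mcar X" for x
        by (rule FP[OF F _ that]) (rule Fp)
    qed (simp_all add: Fp bX Pb)
    show "F (tensor_T G \<chi> n M N h t) = TX h (F t)" if h: "h \<in> carrier G" and t: "t \<in> mcar ?W" for h t
    proof (rule tensor_eqI[OF acts_byD(1)[OF X] _ _ _ t])
      show "linear_between (mcar ?W) (mscale ?W) (mscale X) (\<lambda>t. F (tensor_T G \<chi> n M N h t))"
        by (rule linear_between_compose[OF tensor_T_linear F]) (use h acts_byD(3)[OF W] in auto)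
      show "linear_between (mcar ?W) (mscale ?W) (mscale X) (\<lambda>t. TX h (F t))"
        by (rule linear_between_compose[OF F TX[OF h]]) (use FX in auto)
    qed (simp add: tensor_T_pure[OF dat M N h] Fp bT h cM cN)
    show "F (tensor_Y G \<chi> g n M N t) = YX (F t)" if t: "t \<in> mcar ?W" for t
    proof (rule tensor_eqI[OF acts_byD(1)[OF X] _ _ _ t])
      show "linear_between (mcar ?W) (mscale ?W) (mscale X) (\<lambda>t. F (tensor_Y G \<chi> g n M N t))"
        by (rule linear_between_compose[OF tensor_Y_linear F]) (use acts_byD(4)[OF W] in auto)
      show "linear_between (mcar ?W) (mscale ?W) (mscale X) (\<lambda>t. YX (F t))"
        by (rule linear_between_compose[OF F YX]) (use FX in auto)
    qed (simp only: tensor_Y_pure[OF dat M N] linear_betweenD[OF F] pure_tensor_mem Fp bY g cM cN)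
  qed
qed

text \<open>
  The module \<open>M(1,2)\<close> in coordinates: \<open>e0\<close> is \<open>G\<close>-invariant, \<open>y e0 = e1\<close>, \<open>y e1 = 0\<close> and \<open>h\<close> acts on
  \<open>e1\<close> by \<open>\<chi>(h)\<^sup>-\<^sup>1\<close>. It is described through the dual basis \<open>c0, c1\<close>, which is
  what bilinear maps out of it are built from.
\<close>

definition two_step :: "('g, 'y) monoid_scheme \<Rightarrow> ('g \<Rightarrow> 'k::field) \<Rightarrow> nat \<Rightarrow>
    (nat \<times> 'g, 'k, 'v::ab_group_add) amod \<Rightarrow> ('g \<Rightarrow> 'v \<Rightarrow> 'v) \<Rightarrow> ('v \<Rightarrow> 'v) \<Rightarrow>
    'v \<Rightarrow> 'v \<Rightarrow> ('v \<Rightarrow> 'k) \<Rightarrow> ('v \<Rightarrow> 'k) \<Rightarrow> bool" where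
  "two_step G \<chi> n E T Y e0 e1 c0 c1 \<longleftrightarrow> skew_rep G \<chi> n E T Y \<and> e0 \<in> mcar E \<and> e1 \<in> mcar E \<and>
     linear_between (mcar E) (mscale E) (*) c0 \<and> linear_between (mcar E) (mscale E) (*) c1 \<and>
     c0 e0 = 1 \<and> c1 e0 = 0 \<and> c0 e1 = 0 \<and> c1 e1 = 1 \<and>
     (\<forall>f\<in>mcar E. f = mscale E (c0 f) e0 + mscale E (c1 f) e1) \<and>
     (\<forall>f\<in>mcar E. \<forall>h\<in>carrier G. c0 (T h f) = c0 f \<and> c1 (T h f) = inverse (\<chi> h) * c1 f) \<and>
     (\<forall>f\<in>mcar E. c0 (Y f) = 0 \<and> c1 (Y f) = c0 f)"

lemma two_stepD:
  assumes "two_step G \<chi> n E T Y e0 e1 c0 c1"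
  shows "skew_rep G \<chi> n E T Y" "e0 \<in> mcar E" "e1 \<in> mcar E"
     "linear_between (mcar E) (mscale E) (*) c0" "linear_between (mcar E) (mscale E) (*) c1"
     "c0 e0 = 1" "c1 e0 = 0" "c0 e1 = 0" "c1 e1 = 1"
     "f \<in> mcar E \<Longrightarrow> mscale E (c0 f) e0 + mscale E (c1 f) e1 = f"
     "f \<in> mcar E \<Longrightarrow> h \<in> carrier G \<Longrightarrow> c0 (T h f) = c0 f"
     "f \<in> mcar E \<Longrightarrow> h \<in> carrier G \<Longrightarrow> c1 (T h f) = inverse (\<chi> h) * c1 f"
     "f \<in> mcar E \<Longrightarrow> c0 (Y f) = 0" "f \<in> mcar E \<Longrightarrow> c1 (Y f) = c0 f"
  using assms unfolding two_step_def by simp_all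

text \<open>
  Tensoring \<open>M\<close> with the two-step module, on either side, gives two copies of \<open>M\<close>, the second
  twisted by \<open>\<chi>\<^sup>-\<^sup>1\<close>. The group action is always the one given here; the tensor products and the
  normal form below differ in the operator \<open>Y\<close> only.
\<close>

definition extension :: "('g, 'y) monoid_scheme \<Rightarrow> ('g \<Rightarrow> 'k::field) \<Rightarrow> nat \<Rightarrow>
    (nat \<times> 'g, 'k, 'v::ab_group_add) amod \<Rightarrow> ('g \<Rightarrow> 'v \<Rightarrow> 'v) \<Rightarrow> ('v \<times> 'v \<Rightarrow> 'v \<times> 'v) \<Rightarrow>
    (nat \<times> 'g, 'k, 'v \<times> 'v) amod" where
  "extension G \<chi> n M T Y = operator_module G n (mcar M \<times> mcar M)
     (\<lambda>c (v, w). (mscale M c v, mscale M c w))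
     (\<lambda>h (u, w). (T h u, mscale M (inverse (\<chi> h)) (T h w))) Y"

lemma extension_sel:
  "mcar (extension G \<chi> n M T Y) = mcar M \<times> mcar M"
  "mscale (extension G \<chi> n M T Y) c (v, w) = (mscale M c v, mscale M c w)"
  by (simp_all add: extension_def operator_module_def)

lemma extension_acts_by:
  assumes "acts_by G n M T Y" "\<And>u w. u \<in> mcar M \<Longrightarrow> w \<in> mcar M \<Longrightarrow> Y' (u, w) \<in> mcar M \<times> mcar M"
  shows "acts_by G n (extension G \<chi> n M T Y') (\<lambda>h (u, w). (T h u, mscale M (inverse (\<chi> h)) (T h w))) Y'"
proof -
  interpret vector_space "mscale M" using assms(1) by (rule acts_byD)
  show ?thesis
    unfolding extension_def
    by (rule acts_by_operator_module)
      (use assms acts_byD[OF assms(1)] in \<open>auto intro!: vector_space_pair_scale subspace_Times subspace_scale\<close>)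
qed

lemma extension_T_linear:
  assumes "skew_rep G \<chi> n M T Y" "h \<in> carrier G"
  shows "linear_between (mcar (extension G \<chi> n M T Y')) (mscale (extension G \<chi> n M T Y'))
    (mscale (extension G \<chi> n M T Y')) (\<lambda>(u, w). (T h u, mscale M (inverse (\<chi> h)) (T h w)))"
proof -
  interpret vector_space "mscale M" using skew_repD(1)[OF assms(1)] by (rule acts_byD)
  show ?thesis
    by (rule linear_betweenI)
      (auto simp: extension_sel linear_betweenD[OF skew_repD(2)[OF assms]] scale_right_distrib mult.commute)
qed

text \<open>
  The pair \<open>(u, w)\<close> stands for \<open>u \<otimes> e0 + w \<otimes> e1\<close>. Then \<open>y(u \<otimes> e0) = yu \<otimes> ge0 + u \<otimes> e1\<close> with \<open>ge0 = e0\<close>,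
  whereas \<open>g e1 = q\<^sup>-\<^sup>1 e1\<close> produces the factor in front of \<open>Y w\<close>.
\<close>

lemma tensor_right_iso:
  assumes dat: "nilpotent_datum G \<chi> g n" and M: "skew_rep G \<chi> n M T Y"
    and E: "two_step G \<chi> n E TE YE e0 e1 c0 c1"
  shows "module_iso A (tensor (nilp_hopf G \<chi> g n) M E)
    (extension G \<chi> n M T (\<lambda>(u, w). (Y u, u + mscale M (inverse (\<chi> g)) (Y w))))"
proof -
  let ?X = "extension G \<chi> n M T (\<lambda>(u, w). (Y u, u + mscale M (inverse (\<chi> g)) (Y w)))"
  let ?W = "tensor (nilp_hopf G \<chi> g n) M E"
  note aM = skew_repD(1)[OF M] and aE = skew_repD(1)[OF two_stepD(1)[OF E]]
  interpret M: vector_space "mscale M" using aM by (rule acts_byD)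
  interpret E: vector_space "mscale E" using aE by (rule acts_byD)
  interpret W: vector_space "mscale ?W" by (rule tensor_subspace)
  have g: "g \<in> carrier G" using dat by (simp add: nilpotent_datum_def)
  note clos = M.subspace_add[OF acts_byD(2)[OF aM]] M.subspace_scale[OF acts_byD(2)[OF aM]] acts_byD(3,4)[OF aM]
  note lin = linear_betweenD[OF two_stepD(4)[OF E]] linear_betweenD[OF two_stepD(5)[OF E]]
    linear_betweenD[OF skew_repD(2)[OF M]] linear_betweenD[OF skew_repD(3)[OF M]]
  have bil: "bilinear_between (mcar M) (mcar E) (mscale M) (mscale E) (mscale ?W) (pure_tensor M E)"
    by (rule pure_tensor_bilinear) (use acts_byD[OF aM] acts_byD[OF aE] in auto)
  then have pl: "\<And>v v' w. v \<in> mcar M \<Longrightarrow> v' \<in> mcar M \<Longrightarrow> w \<in> mcar E \<Longrightarrow>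
      pure_tensor M E (v + v') w = pure_tensor M E v w + pure_tensor M E v' w"
    "\<And>c v w. v \<in> mcar M \<Longrightarrow> w \<in> mcar E \<Longrightarrow> pure_tensor M E (mscale M c v) w = mscale ?W c (pure_tensor M E v w)"
    "\<And>v w w'. v \<in> mcar M \<Longrightarrow> w \<in> mcar E \<Longrightarrow> w' \<in> mcar E \<Longrightarrow>
      pure_tensor M E v (w + w') = pure_tensor M E v w + pure_tensor M E v w'"
    "\<And>c v w. v \<in> mcar M \<Longrightarrow> w \<in> mcar E \<Longrightarrow> pure_tensor M E v (mscale E c w) = mscale ?W c (pure_tensor M E v w)"
    unfolding bilinear_between_def linear_between_def by blast+
  note e = two_stepD(2,3)[OF E]
  show ?thesis
  proof (rule tensor_module_iso[OF dat M two_stepD(1)[OF E],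
        where b = "\<lambda>u f. (mscale M (c0 f) u, mscale M (c1 f) u)"
          and P = "\<lambda>(u, w). pure_tensor M E u e0 + pure_tensor M E w e1"])
    show "acts_by G n ?X (\<lambda>h (u, w). (T h u, mscale M (inverse (\<chi> h)) (T h w)))
        (\<lambda>(u, w). (Y u, u + mscale M (inverse (\<chi> g)) (Y w)))"
      by (rule extension_acts_by[OF aM]) (auto intro!: clos)
    show "linear_between (mcar ?X) (mscale ?X) (mscale ?X) (\<lambda>(u, w). (T h u, mscale M (inverse (\<chi> h)) (T h w)))"
      if "h \<in> carrier G" for h by (rule extension_T_linear[OF M that])
    show "linear_between (mcar ?X) (mscale ?X) (mscale ?X) (\<lambda>(u, w). (Y u, u + mscale M (inverse (\<chi> g)) (Y w)))"
      by (rule linear_betweenI) (auto simp: extension_sel lin M.scale_right_distrib mult.commute)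
    show "bilinear_between (mcar M) (mcar E) (mscale M) (mscale E) (mscale ?X)
       (\<lambda>u f. (mscale M (c0 f) u, mscale M (c1 f) u))"
      unfolding bilinear_between_def linear_between_def
      by (auto simp: extension_sel lin M.scale_right_distrib M.scale_left_distrib mult.commute)
    show "linear_between (mcar ?X) (mscale ?X) (mscale ?W) (\<lambda>(u, w). pure_tensor M E u e0 + pure_tensor M E w e1)"
      by (rule linear_betweenI) (auto simp: extension_sel pl e W.scale_right_distrib)
    show "(\<lambda>(u, w). pure_tensor M E u e0 + pure_tensor M E w e1) x \<in> mcar ?W" if "x \<in> mcar ?X" for x
      using that by (auto simp: extension_sel e intro!: W.subspace_add tensor_subspace pure_tensor_mem)
    show "(\<lambda>(u, w). pure_tensor M E u e0 + pure_tensor M E w e1) (mscale M (c0 f) u, mscale M (c1 f) u) =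
       pure_tensor M E u f" if "u \<in> mcar M" "f \<in> mcar E" for u f
    proof -
      have "pure_tensor M E u f = pure_tensor M E u (mscale E (c0 f) e0 + mscale E (c1 f) e1)"
        using that by (simp add: two_stepD(10)[OF E])
      then show ?thesis using that e by (simp add: pl E.subspace_scale[OF acts_byD(2)[OF aE]])
    qed
    show "F ((\<lambda>(u, w). pure_tensor M E u e0 + pure_tensor M E w e1) x) = x"
      if F: "linear_between (mcar ?W) (mscale ?W) (mscale ?X) F"
        and Fp: "\<And>v w. v \<in> mcar M \<Longrightarrow> w \<in> mcar E \<Longrightarrow>
          F (pure_tensor M E v w) = (mscale M (c0 w) v, mscale M (c1 w) v)"
        and x: "x \<in> mcar ?X" for F x
      using x e by (auto simp: extension_sel linear_betweenD[OF F] pure_tensor_mem Fp two_stepD(6-9)[OF E])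
  qed (auto simp: extension_sel clos lin two_stepD(11-14)[OF E] g M.scale_right_distrib M.scale_left_distrib
      mult.commute)
qed

text \<open>
  The pair \<open>(u, w)\<close> stands for \<open>e0 \<otimes> u + e1 \<otimes> w\<close>, and \<open>y(e0 \<otimes> u) = e1 \<otimes> gu + e0 \<otimes> yu\<close>.
\<close>

lemma tensor_left_iso:
  assumes dat: "nilpotent_datum G \<chi> g n" and M: "skew_rep G \<chi> n M T Y"
    and E: "two_step G \<chi> n E TE YE e0 e1 c0 c1"
  shows "module_iso A (tensor (nilp_hopf G \<chi> g n) E M)
    (extension G \<chi> n M T (\<lambda>(u, w). (Y u, T g u + Y w)))"
proof -
  let ?X = "extension G \<chi> n M T (\<lambda>(u, w). (Y u, T g u + Y w))"
  let ?W = "tensor (nilp_hopf G \<chi> g n) E M"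
  note aM = skew_repD(1)[OF M] and aE = skew_repD(1)[OF two_stepD(1)[OF E]]
  interpret M: vector_space "mscale M" using aM by (rule acts_byD)
  interpret E: vector_space "mscale E" using aE by (rule acts_byD)
  interpret W: vector_space "mscale ?W" by (rule tensor_subspace)
  have g: "g \<in> carrier G" using dat by (simp add: nilpotent_datum_def)
  note clos = M.subspace_add[OF acts_byD(2)[OF aM]] M.subspace_scale[OF acts_byD(2)[OF aM]] acts_byD(3,4)[OF aM]
  note lin = linear_betweenD[OF two_stepD(4)[OF E]] linear_betweenD[OF two_stepD(5)[OF E]]
    linear_betweenD[OF skew_repD(2)[OF M]] linear_betweenD[OF skew_repD(3)[OF M]]
  have bil: "bilinear_between (mcar E) (mcar M) (mscale E) (mscale M) (mscale ?W) (pure_tensor E M)"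
    by (rule pure_tensor_bilinear) (use acts_byD[OF aM] acts_byD[OF aE] in auto)
  then have pl: "\<And>v v' w. v \<in> mcar E \<Longrightarrow> v' \<in> mcar E \<Longrightarrow> w \<in> mcar M \<Longrightarrow>
      pure_tensor E M (v + v') w = pure_tensor E M v w + pure_tensor E M v' w"
    "\<And>c v w. v \<in> mcar E \<Longrightarrow> w \<in> mcar M \<Longrightarrow> pure_tensor E M (mscale E c v) w = mscale ?W c (pure_tensor E M v w)"
    "\<And>v w w'. v \<in> mcar E \<Longrightarrow> w \<in> mcar M \<Longrightarrow> w' \<in> mcar M \<Longrightarrow>
      pure_tensor E M v (w + w') = pure_tensor E M v w + pure_tensor E M v w'"
    "\<And>c v w. v \<in> mcar E \<Longrightarrow> w \<in> mcar M \<Longrightarrow> pure_tensor E M v (mscale M c w) = mscale ?W c (pure_tensor E M v w)"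
    unfolding bilinear_between_def linear_between_def by blast+
  note e = two_stepD(2,3)[OF E]
  show ?thesis
  proof (rule tensor_module_iso[OF dat two_stepD(1)[OF E] M,
        where b = "\<lambda>f u. (mscale M (c0 f) u, mscale M (c1 f) u)"
          and P = "\<lambda>(u, w). pure_tensor E M e0 u + pure_tensor E M e1 w"])
    show "acts_by G n ?X (\<lambda>h (u, w). (T h u, mscale M (inverse (\<chi> h)) (T h w)))
        (\<lambda>(u, w). (Y u, T g u + Y w))"
      by (rule extension_acts_by[OF aM]) (auto intro!: clos g)
    show "linear_between (mcar ?X) (mscale ?X) (mscale ?X) (\<lambda>(u, w). (T h u, mscale M (inverse (\<chi> h)) (T h w)))"
      if "h \<in> carrier G" for h by (rule extension_T_linear[OF M that])
    show "linear_between (mcar ?X) (mscale ?X) (mscale ?X) (\<lambda>(u, w). (Y u, T g u + Y w))"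
      by (rule linear_betweenI) (auto simp: extension_sel lin g M.scale_right_distrib mult.commute)
    show "bilinear_between (mcar E) (mcar M) (mscale E) (mscale M) (mscale ?X)
       (\<lambda>f u. (mscale M (c0 f) u, mscale M (c1 f) u))"
      unfolding bilinear_between_def linear_between_def
      by (auto simp: extension_sel lin M.scale_right_distrib M.scale_left_distrib mult.commute)
    show "linear_between (mcar ?X) (mscale ?X) (mscale ?W) (\<lambda>(u, w). pure_tensor E M e0 u + pure_tensor E M e1 w)"
      by (rule linear_betweenI) (auto simp: extension_sel pl e W.scale_right_distrib)
    show "(\<lambda>(u, w). pure_tensor E M e0 u + pure_tensor E M e1 w) x \<in> mcar ?W" if "x \<in> mcar ?X" for x
      using that by (auto simp: extension_sel e intro!: W.subspace_add tensor_subspace pure_tensor_mem)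
    show "(\<lambda>(u, w). pure_tensor E M e0 u + pure_tensor E M e1 w) (mscale M (c0 f) u, mscale M (c1 f) u) =
       pure_tensor E M f u" if "f \<in> mcar E" "u \<in> mcar M" for u f
    proof -
      have "pure_tensor E M f u = pure_tensor E M (mscale E (c0 f) e0 + mscale E (c1 f) e1) u"
        using that by (simp add: two_stepD(10)[OF E])
      then show ?thesis using that e by (simp add: pl E.subspace_scale[OF acts_byD(2)[OF aE]])
    qed
    show "F ((\<lambda>(u, w). pure_tensor E M e0 u + pure_tensor E M e1 w) x) = x"
      if F: "linear_between (mcar ?W) (mscale ?W) (mscale ?X) F"
        and Fp: "\<And>v w. v \<in> mcar E \<Longrightarrow> w \<in> mcar M \<Longrightarrow>
          F (pure_tensor E M v w) = (mscale M (c0 v) w, mscale M (c1 v) w)"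
        and x: "x \<in> mcar ?X" for F x
      using x e by (auto simp: extension_sel linear_betweenD[OF F] pure_tensor_mem Fp two_stepD(6-9)[OF E])
  qed (auto simp: extension_sel clos lin two_stepD(11-14)[OF E] g M.scale_right_distrib M.scale_left_distrib
      mult.commute)
qed

text \<open>
  Invariance of the coordinate \<open>\<kappa>\<close> says that \<open>V\<close> is the trivial module.
\<close>

lemma two_step_M_module:
  fixes \<kappa> :: "'v::ab_group_add \<Rightarrow> 'k::field"
  assumes dat: "nilpotent_datum G \<chi> g n" and V: "group_rep G V"
    and bij: "bij_betw \<kappa> (mcar V) UNIV" and lin: "linear_between (mcar V) (mscale V) (*) \<kappa>"
    and inv: "\<And>h v. h \<in> carrier G \<Longrightarrow> v \<in> mcar V \<Longrightarrow> \<kappa> (mact V (bvec h) v) = \<kappa> v"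
  shows "\<exists>e0 e1 c0 c1. two_step G \<chi> n (M_module G \<chi> n V 2) (M_grp \<chi> V) (M_y 2) e0 e1 c0 c1"
proof -
  interpret V: vector_space "mscale V" using group_repD(1)[OF V] .
  note sub = group_repD(2)[OF V]
  have z[simp]: "0 \<in> mcar V" using sub by (rule V.subspace_0)
  have n: "2 \<le> n" using dat by (simp add: nilpotent_datum_def)
  note L = linear_betweenD[OF lin]
  have k0[simp]: "\<kappa> 0 = 0" using L(2)[of 0 0] by simp
  obtain e where e: "e \<in> mcar V" "\<kappa> e = 1" using bij by (metis bij_betw_iff_bijections UNIV_I)
  have ke: "mscale V (\<kappa> v) e = v" if "v \<in> mcar V" for v
  proof -
    have "\<kappa> (mscale V (\<kappa> v) e) = \<kappa> v" using e by (simp add: L)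
    moreover have "mscale V (\<kappa> v) e \<in> mcar V" using e sub by (auto intro: V.subspace_scale)
    ultimately show ?thesis using that bij by (auto simp: bij_betw_def dest: inj_onD)
  qed
  have car: "f \<in> mcar (M_module G \<chi> n V 2) \<longleftrightarrow> (\<forall>k. f k \<in> mcar V) \<and> (\<forall>k\<ge>2. f k = 0)" for f
    by (auto simp: M_module_def) (metis z linorder_not_le)
  have sc: "mscale (M_module G \<chi> n V 2) = (\<lambda>c f k. mscale V c (f k))" by (simp add: M_module_def)
  have "two_step G \<chi> n (M_module G \<chi> n V 2) (M_grp \<chi> V) (M_y 2)
     (\<lambda>k. if k = 0 then e else 0) (\<lambda>k. if k = 1 then e else 0) (\<lambda>f. \<kappa> (f 0)) (\<lambda>f. \<kappa> (f 1))"
    unfolding two_step_def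
  proof (intro conjI ballI M_module_skew_rep[OF dat V n])
    fix f assume "f \<in> mcar (M_module G \<chi> n V 2)"
    then show "f = mscale (M_module G \<chi> n V 2) (\<kappa> (f 0)) (\<lambda>k. if k = 0 then e else 0) +
        mscale (M_module G \<chi> n V 2) (\<kappa> (f 1)) (\<lambda>k. if k = 1 then e else 0)"
      by (auto simp: sc fun_eq_iff ke car)
  qed (auto simp: car e sc L linear_between_def M_grp_def M_y_def inv group_repD[OF V])
  then show ?thesis by blast
qed

section \<open>The normal form of both tensor products\<close>

lemma M_module_mem:
  assumes "group_rep G V"
  shows "f \<in> mcar (M_module G \<chi> n V j) \<longleftrightarrow> (\<forall>k. f k \<in> mcar V) \<and> (\<forall>k\<ge>j. f k = 0)"
proof -
  interpret vector_space "mscale V" using group_repD(1)[OF assms] .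
  have "0 \<in> mcar V" using group_repD(2)[OF assms] by (rule subspace_0)
  then show ?thesis by (auto simp: M_module_def) (metis linorder_not_le)
qed

lemma M_module_scale: "mscale (M_module G \<chi> n V j) = (\<lambda>c f k. mscale V c (f k))"
  by (simp add: M_module_def)

text \<open>
  Write elements of the extension as \<open>(u, w)\<close> and place \<open>u k\<close> in degree \<open>k\<close> and \<open>w k\<close> in degree
  \<open>Suc k\<close>, so that \<open>h\<close> acts by \<open>\<chi>(h)\<^sup>-\<^sup>d h\<close> in degree \<open>d\<close>. A triangular change of coordinates within each degree
  then commutes with \<open>G\<close>, provided the diagonal entry acting on \<open>V\<close> comes from a central element \<open>z\<close>.
  Only compatibility with the operators \<open>Y1\<close> and \<open>Y2\<close> remains to be checked.
\<close>

lemma extension_shear_iso: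
  assumes dat: "nilpotent_datum G \<chi> g n" and V: "group_rep G V" and j: "j \<le> n"
    and z: "z \<in> carrier G" "\<And>h. h \<in> carrier G \<Longrightarrow> z \<otimes>\<^bsub>G\<^esub> h = h \<otimes>\<^bsub>G\<^esub> z"
    and a: "\<And>k. a k \<noteq> 0"
    and S: "\<And>u w. S (u, w) = (u, \<lambda>k. mscale V (a k) (mact V (bvec z) (w k)) - mscale V (b k) (u (Suc k)))"
    and C: "C = mcar (M_module G \<chi> n V j)"
    and Y1: "\<And>u w. u \<in> C \<Longrightarrow> w \<in> C \<Longrightarrow> Y1 (u, w) \<in> C \<times> C"
    and Y2: "\<And>u w. u \<in> C \<Longrightarrow> w \<in> C \<Longrightarrow> Y2 (u, w) \<in> C \<times> C"
    and Y: "\<And>u w. u \<in> C \<Longrightarrow> w \<in> C \<Longrightarrow> S (Y1 (u, w)) = Y2 (S (u, w))"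
  shows "module_iso A (extension G \<chi> n (M_module G \<chi> n V j) (M_grp \<chi> V) Y1)
     (extension G \<chi> n (M_module G \<chi> n V j) (M_grp \<chi> V) Y2)"
proof -
  interpret group G using dat by (simp add: nilpotent_datum_def)
  interpret V: vector_space "mscale V" using group_repD(1)[OF V] .
  let ?M = "M_module G \<chi> n V j"
  note rep = M_module_skew_rep[OF dat V j]
  note sub = V.subspace_add[OF group_repD(2)[OF V]] V.subspace_scale[OF group_repD(2)[OF V]]
    V.subspace_diff[OF group_repD(2)[OF V]]
  note lin = group_rep_linear[OF V]
  note act = group_repD(3,5,6)[OF V]
  have car: "f \<in> C \<longleftrightarrow> (\<forall>k. f k \<in> mcar V) \<and> (\<forall>k\<ge>j. f k = 0)" for f
    unfolding C by (rule M_module_mem[OF V])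
  have diff: "mact V (bvec h) (v - w) = mact V (bvec h) v - mact V (bvec h) w"
    if "h \<in> carrier G" "v \<in> mcar V" "w \<in> mcar V" for h v w
  proof -
    have "mact V (bvec h) (v + mscale V (-1) w) = mact V (bvec h) v + mscale V (-1) (mact V (bvec h) w)"
      using that by (simp add: lin sub del: V.scale_minus_left)
    then show ?thesis by simp
  qed
  define S' where "S' = (\<lambda>(u, w). (u, \<lambda>k. mscale V (inverse (a k))
      (mact V (bvec (inv\<^bsub>G\<^esub> z)) (w k + mscale V (b k) (u (Suc k))))))"
  have iz: "inv\<^bsub>G\<^esub> z \<in> carrier G" using z by simp
  show ?thesis
  proof (rule module_iso_acts_by[where f = S])
    let ?T = "\<lambda>h (u, w). (M_grp \<chi> V h u, mscale ?M (inverse (\<chi> h)) (M_grp \<chi> V h w))"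
    show "acts_by G n (extension G \<chi> n ?M (M_grp \<chi> V) Y1) ?T Y1"
      by (rule extension_acts_by[OF skew_repD(1)[OF rep]]) (rule Y1[unfolded C])
    show "acts_by G n (extension G \<chi> n ?M (M_grp \<chi> V) Y2) ?T Y2"
      by (rule extension_acts_by[OF skew_repD(1)[OF rep]]) (rule Y2[unfolded C])
    show "bij_betw S (mcar (extension G \<chi> n ?M (M_grp \<chi> V) Y1)) (mcar (extension G \<chi> n ?M (M_grp \<chi> V) Y2))"
      unfolding extension_sel C[symmetric]
    proof (rule bij_betw_byWitness[where f' = S'])
      show "\<forall>x\<in>C \<times> C. S' (S x) = x"
      proof clarify
        fix u w assume "u \<in> C" "w \<in> C"
        then show "S' (S (u, w)) = (u, w)"
          using z iz a by (auto simp: S S'_def car fun_eq_iff lin act)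
      qed
      show "\<forall>x\<in>C \<times> C. S (S' x) = x"
      proof clarify
        fix u w assume "u \<in> C" "w \<in> C"
        then show "S (S' (u, w)) = (u, w)"
          using z iz a by (auto simp: S S'_def car fun_eq_iff lin act sub)
      qed
      show "S ` (C \<times> C) \<subseteq> C \<times> C" using z by (auto simp: S car lin intro!: sub act)
      show "S' ` (C \<times> C) \<subseteq> C \<times> C" using iz by (auto simp: S'_def car lin intro!: sub act)
    qed
    show "linear_between (mcar (extension G \<chi> n ?M (M_grp \<chi> V) Y1)) (mscale (extension G \<chi> n ?M (M_grp \<chi> V) Y1))
       (mscale (extension G \<chi> n ?M (M_grp \<chi> V) Y2)) S"
      unfolding linear_between_def extension_sel C[symmetric] using z
      by (auto simp: extension_sel S M_module_scale car lin fun_eq_iff V.scale_right_distrib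
          V.scale_right_diff_distrib mult.commute)
    show "S (case x of (u, w) \<Rightarrow> (M_grp \<chi> V h u, mscale ?M (inverse (\<chi> h)) (M_grp \<chi> V h w))) =
      (case S x of (u, w) \<Rightarrow> (M_grp \<chi> V h u, mscale ?M (inverse (\<chi> h)) (M_grp \<chi> V h w)))"
      if h: "h \<in> carrier G" and x: "x \<in> mcar (extension G \<chi> n ?M (M_grp \<chi> V) Y1)" for h x
    proof -
      obtain u w where uw: "x = (u, w)" "u \<in> C" "w \<in> C" using x by (auto simp: extension_sel C)
      show ?thesis
        using h z uw(2,3)
        by (auto simp: uw(1) S M_module_scale M_grp_def car lin act sub fun_eq_iff diff
            V.scale_right_diff_distrib mult_ac)
    qed
    show "S (Y1 x) = Y2 (S x)" if x: "x \<in> mcar (extension G \<chi> n ?M (M_grp \<chi> V) Y1)" for x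
      using x Y by (auto simp: extension_sel C)
  qed
qed

text \<open>
  The quantum integer \<open>[k]\<close> at \<open>p\<close>.
\<close>

definition q_int :: "'k::field \<Rightarrow> nat \<Rightarrow> 'k" where
  "q_int p k = (\<Sum>i<k. p ^ i)"

lemma q_int_simps: "q_int p 0 = 0" "q_int p (Suc k) = q_int p k + p ^ k" "q_int p k + p ^ k = 1 + p * q_int p k"
proof -
  show "q_int p k + p ^ k = 1 + p * q_int p k"
  proof (induction k)
    case (Suc k)
    have "q_int p (Suc k) + p ^ Suc k = (q_int p k + p ^ k) + p * p ^ k" by (simp add: q_int_def)
    also have "\<dots> = 1 + p * q_int p (Suc k)" unfolding Suc by (simp add: q_int_def distrib_left)
    finally show ?case .
  qed (simp add: q_int_def)
qed (simp_all add: q_int_def)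

lemma q_int_eq_0_iff:
  assumes "p \<noteq> 1" shows "q_int p k = 0 \<longleftrightarrow> p ^ k = 1"
  using assms one_diff_power_eq[of p k] by (auto simp: q_int_def)

text \<open>
  Two strings \<open>u 0 \<rightarrow> u 1 \<rightarrow> \<dots>\<close> and \<open>w 0 \<rightarrow> w 1 \<rightarrow> \<dots>\<close> of length \<open>j\<close>, linked only at their ends: \<open>y\<close> puts \<open>c\<close>
  times the last entry of the first string into the last place of the second.
\<close>

definition normal_Y :: "('b, 'k::field, 'v::ab_group_add) amod \<Rightarrow> nat \<Rightarrow> 'k \<Rightarrow>
    (nat \<Rightarrow> 'v) \<times> (nat \<Rightarrow> 'v) \<Rightarrow> (nat \<Rightarrow> 'v) \<times> (nat \<Rightarrow> 'v)" where
  "normal_Y V j c = (\<lambda>(u, w). (M_y j u, \<lambda>k. M_y j w k + (if Suc k = j then mscale V c (u k) else 0)))"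

lemma normal_Y_closed:
  assumes "group_rep G V" "C = mcar (M_module G \<chi> n V j)" "u \<in> C" "w \<in> C"
  shows "normal_Y V j c (u, w) \<in> C \<times> C"
proof -
  interpret V: vector_space "mscale V" using group_repD(1)[OF assms(1)] .
  note sub = V.subspace_add[OF group_repD(2)[OF assms(1)]] V.subspace_scale[OF group_repD(2)[OF assms(1)]]
    V.subspace_0[OF group_repD(2)[OF assms(1)]]
  show ?thesis
    using assms(3,4) unfolding assms(2)
    by (auto simp: normal_Y_def M_module_mem[OF assms(1)] M_y_def intro!: sub)
qed

text \<open>
  In the coordinates \<open>(u, w)\<close> of the tensor product, \<open>y\<^sup>k(v \<otimes> e0) = x\<^sup>k v \<otimes> e0 + [k] x\<^sup>k\<^sup>-\<^sup>1 v \<otimes> e1\<close>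
  with \<open>p = q\<^sup>-\<^sup>1\<close> and \<open>[k]\<close> the quantum integer. Subtracting the multiple \<open>[k]\<close> of the
  first string from the second therefore decouples them in all degrees below \<open>j\<close>. In degree \<open>j\<close> the
  first string has ended and the defect \<open>[j]\<close> stays. The powers of \<open>p\<close> rescale the second string so
  that \<open>y\<close> acts on it without a factor and the defect is exactly \<open>[j]\<close>.
\<close>

lemma right_normal_form:
  assumes dat: "nilpotent_datum G \<chi> g n" and V: "group_rep G V" and j: "1 \<le> j" "j \<le> n"
  defines "M \<equiv> M_module G \<chi> n V j" and "p \<equiv> inverse (\<chi> g)"
  shows "module_iso A
    (extension G \<chi> n M (M_grp \<chi> V) (\<lambda>(u, w). (M_y j u, u + mscale M p (M_y j w))))
    (extension G \<chi> n M (M_grp \<chi> V) (normal_Y V j (q_int p j)))"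
proof -
  interpret group G using dat by (simp add: nilpotent_datum_def)
  interpret V: vector_space "mscale V" using group_repD(1)[OF V] .
  define C where "C = mcar M"
  have g: "g \<in> carrier G" using dat by (simp add: nilpotent_datum_def)
  have p: "p \<noteq> 0" using dat g by (simp add: p_def nilpotent_datum_def linear_character_def)
  note rep = M_module_skew_rep[OF dat V j(2), folded M_def]
  note sub = V.subspace_add[OF group_repD(2)[OF V]] V.subspace_scale[OF group_repD(2)[OF V]]
    V.subspace_0[OF group_repD(2)[OF V]]
  have car: "f \<in> C \<longleftrightarrow> (\<forall>k. f k \<in> mcar V) \<and> (\<forall>k\<ge>j. f k = 0)" for f
    unfolding C_def M_def by (rule M_module_mem[OF V])
  \<comment> \<open>The identity of \<open>G\<close> serves as the central element; truncated subtraction is harmless because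
      all entries with \<open>k \<ge> j\<close> vanish.\<close>
  define S where "S = (\<lambda>(u, w). (u, \<lambda>k. mscale V (p ^ (j - Suc k)) (mact V (bvec \<one>\<^bsub>G\<^esub>) (w k))
     - mscale V (p ^ (j - Suc k) * q_int p (Suc k)) (u (Suc k))))"
  show ?thesis
    unfolding M_def
  proof (rule extension_shear_iso[OF dat V j(2) one_closed, where S = S and C = C])
    fix u w assume u: "u \<in> C" and w: "w \<in> C"
    show "(case (u, w) of (u, w) \<Rightarrow> (M_y j u, u + mscale (M_module G \<chi> n V j) p (M_y j w))) \<in> C \<times> C"
      using u w by (auto simp: car M_y_def M_module_scale intro!: sub)
    show "normal_Y V j (q_int p j) (u, w) \<in> C \<times> C"
      by (rule normal_Y_closed[OF V _ u w]) (simp add: C_def M_def)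
    have "mscale V (p ^ (j - Suc k)) (u k + mscale V p (M_y j w k))
        - mscale V (p ^ (j - Suc k) * q_int p (Suc k)) (M_y j u (Suc k)) =
      M_y j (\<lambda>k. mscale V (p ^ (j - Suc k)) (w k) - mscale V (p ^ (j - Suc k) * q_int p (Suc k)) (u (Suc k))) k
        + (if Suc k = j then mscale V (q_int p j) (u k) else 0)" (is "?l = ?r") for k
    proof -
      consider "k \<ge> j" | "Suc k = j" | "Suc k < j" by linarith
      then show ?thesis
      proof cases
        case 1
        then show ?thesis using u by (simp add: car M_y_def)
      next
        case 2
        show ?thesis
        proof (cases k)
          case 0
          then show ?thesis using 2[symmetric] by (simp add: M_y_def q_int_simps)
        next
          case (Suc i)
          have "?r = mscale V p (w i) + mscale V (q_int p j - p * q_int p k) (u k)"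
            using 2[symmetric] Suc by (simp add: M_y_def V.scale_left_diff_distrib)
          also have "q_int p j - p * q_int p k = 1"
            using q_int_simps(2,3)[of p k] 2[symmetric] by simp
          finally show ?thesis using 2[symmetric] Suc by (simp add: M_y_def)
        qed
      next
        case 3
        define Q where "Q = p ^ (j - Suc k)"
        have l: "?l = mscale V (Q - Q * q_int p (Suc k)) (u k) + mscale V (Q * p) (M_y j w k)"
          using 3 by (simp add: M_y_def Q_def V.scale_right_distrib V.scale_left_diff_distrib)
        \<comment> \<open>This is \<open>[k+1] = 1 + p[k]\<close>.\<close>
        have coef: "Q - Q * q_int p (Suc k) = - (Q * p * q_int p k)"
          using q_int_simps(3)[of p k] by (simp add: q_int_simps(2) algebra_simps)
        show ?thesis
        proof (cases k)
          case 0
          then show ?thesis using 3 l unfolding coef by (simp add: M_y_def q_int_simps)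
        next
          case (Suc i)
          have "p ^ (j - Suc i) = Q * p"
            using 3 Suc by (simp add: Q_def Suc_diff_Suc flip: power_Suc2)
          then show ?thesis using 3 l unfolding coef by (simp add: M_y_def Suc)
        qed
      qed
    qed
    moreover have "mact V (bvec \<one>\<^bsub>G\<^esub>) (u k + mscale V p (M_y j w k)) = u k + mscale V p (M_y j w k)" 
        "mact V (bvec \<one>\<^bsub>G\<^esub>) (w k) = w k" for k
      using u w by (auto simp: car M_y_def intro!: group_repD(5)[OF V] sub)
    ultimately show "S (case (u, w) of (u, w) \<Rightarrow> (M_y j u, u + mscale (M_module G \<chi> n V j) p (M_y j w))) =
      normal_Y V j (q_int p j) (S (u, w))"
      by (simp add: S_def normal_Y_def M_module_scale fun_eq_iff)
  qed (use p in \<open>auto simp: S_def C_def M_def\<close>)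
qed

text \<open>
  Here \<open>y\<close> sends the first string to the second through \<open>gu\<close>, that is, by \<open>p\<^sup>k\<close> times the
  action of \<open>g\<close> on \<open>V\<close> in degree \<open>k\<close>. Undoing that action with the central element \<open>g\<^sup>-\<^sup>1\<close> leaves the
  coefficients \<open>p\<^sup>k = [k+1] - [k]\<close>, which the shear by \<open>[k+1]\<close> telescopes away up to the same defect \<open>[j]\<close> at
  the end. That the two defects agree is the reason why the two-step module commutes with \<open>M(V,j)\<close>.
\<close>

lemma left_normal_form:
  assumes dat: "nilpotent_datum G \<chi> g n" and V: "group_rep G V" and j: "1 \<le> j" "j \<le> n"
  defines "M \<equiv> M_module G \<chi> n V j" and "p \<equiv> inverse (\<chi> g)"
  shows "module_iso A
    (extension G \<chi> n M (M_grp \<chi> V) (\<lambda>(u, w). (M_y j u, M_grp \<chi> V g u + M_y j w)))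
    (extension G \<chi> n M (M_grp \<chi> V) (normal_Y V j (q_int p j)))"
proof -
  interpret group G using dat by (simp add: nilpotent_datum_def)
  interpret V: vector_space "mscale V" using group_repD(1)[OF V] .
  define C where "C = mcar M"
  have g: "g \<in> carrier G" and ig: "inv\<^bsub>G\<^esub> g \<in> carrier G"
    and central: "\<And>h. h \<in> carrier G \<Longrightarrow> g \<otimes>\<^bsub>G\<^esub> h = h \<otimes>\<^bsub>G\<^esub> g"
    using dat by (auto simp: nilpotent_datum_def)
  have icentral: "inv\<^bsub>G\<^esub> g \<otimes>\<^bsub>G\<^esub> h = h \<otimes>\<^bsub>G\<^esub> inv\<^bsub>G\<^esub> g" if "h \<in> carrier G" for h
    using central[OF that] that g by (metis inv_solve_left inv_solve_right m_closed ig m_assoc)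
  note sub = V.subspace_add[OF group_repD(2)[OF V]] V.subspace_scale[OF group_repD(2)[OF V]]
    V.subspace_0[OF group_repD(2)[OF V]]
  note lin = group_rep_linear[OF V] and act = group_repD(3,5,6)[OF V]
  have car: "f \<in> C \<longleftrightarrow> (\<forall>k. f k \<in> mcar V) \<and> (\<forall>k\<ge>j. f k = 0)" for f
    unfolding C_def M_def by (rule M_module_mem[OF V])
  let ?z = "mact V (bvec (inv\<^bsub>G\<^esub> g))"
  define S where "S = (\<lambda>(u, w). (u, \<lambda>k. mscale V 1 (?z (w k)) - mscale V (q_int p (Suc k)) (u (Suc k))))"
  show ?thesis
    unfolding M_def
  proof (rule extension_shear_iso[OF dat V j(2) ig icentral, where S = S and C = C and a = "\<lambda>_. 1"
        and b = "\<lambda>k. q_int p (Suc k)"])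
    fix u w assume u: "u \<in> C" and w: "w \<in> C"
    show "(case (u, w) of (u, w) \<Rightarrow> (M_y j u, M_grp \<chi> V g u + M_y j w)) \<in> C \<times> C"
      using u w g by (auto simp: car M_y_def M_grp_def lin intro!: sub act)
    show "normal_Y V j (q_int p j) (u, w) \<in> C \<times> C"
      by (rule normal_Y_closed[OF V _ u w]) (simp add: C_def M_def)
    have z: "?z (M_grp \<chi> V g u k + M_y j w k) = mscale V (p ^ k) (u k) + M_y j (\<lambda>k. ?z (w k)) k" for k
      using u w g ig by (auto simp: M_grp_def M_y_def car lin act sub p_def)
    have "mscale V (p ^ k) (u k) + M_y j (\<lambda>k. ?z (w k)) k - mscale V (q_int p (Suc k)) (M_y j u (Suc k)) =
      M_y j (\<lambda>k. ?z (w k) - mscale V (q_int p (Suc k)) (u (Suc k))) k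
        + (if Suc k = j then mscale V (q_int p j) (u k) else 0)" for k
    proof -
      have split: "M_y j (\<lambda>k. ?z (w k) - mscale V (q_int p (Suc k)) (u (Suc k))) k =
         M_y j (\<lambda>k. ?z (w k)) k - mscale V (q_int p k) (u k)"
        using u by (cases k) (auto simp: M_y_def car q_int_simps(1) not_less)
      have "mscale V (p ^ k) (u k) - mscale V (q_int p (Suc k)) (M_y j u (Suc k)) =
        - mscale V (q_int p k) (u k) + (if Suc k = j then mscale V (q_int p j) (u k) else 0)"
        using u by (auto simp: M_y_def car q_int_simps(2) V.scale_left_distrib not_less)
      then show ?thesis unfolding split by (simp add: algebra_simps)
    qed
    then show "S (case (u, w) of (u, w) \<Rightarrow> (M_y j u, M_grp \<chi> V g u + M_y j w)) =
      normal_Y V j (q_int p j) (S (u, w))"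
      by (simp add: S_def normal_Y_def fun_eq_iff z)
  qed (auto simp: S_def C_def M_def)
qed

section \<open>Decomposition of the normal form\<close>

lemma direct_sum_acts_by:
  assumes M: "acts_by G n M T Y" and N: "acts_by G n N T' Y'"
  shows "acts_by G n (direct_sum M N) (\<lambda>h (v, w). (T h v, T' h w)) (\<lambda>(v, w). (Y v, Y' w))"
proof -
  have pow: "((\<lambda>(v, w). (Y v, Y' w)) ^^ s) (v, w) = ((Y ^^ s) v, (Y' ^^ s) w)" for s v w
    by (induction s) auto
  have sum: "(\<Sum>i\<in>I. (f i, f' i)) = (\<Sum>i\<in>I. f i, \<Sum>i\<in>I. f' i)" for I and f :: "nat \<times> 'a \<Rightarrow> 'd" and f' :: "nat \<times> 'a \<Rightarrow> 'e"
    by (induction I rule: infinite_finite_induct) (auto simp: zero_prod_def)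
  show ?thesis
    unfolding acts_by_def
  proof (intro conjI allI ballI)
    show "vector_space (mscale (direct_sum M N))"
      unfolding direct_sum_def amod.simps by (rule vector_space_pair_scale[OF acts_byD(1)[OF M] acts_byD(1)[OF N]])
    show "module.subspace (mscale (direct_sum M N)) (mcar (direct_sum M N))"
      unfolding direct_sum_def amod.simps
      by (rule subspace_Times[OF acts_byD(1)[OF M] acts_byD(1)[OF N] acts_byD(2)[OF M] acts_byD(2)[OF N]])
    fix a x assume "x \<in> mcar (direct_sum M N)"
    then obtain v w where x: "x = (v, w)" "v \<in> mcar M" "w \<in> mcar N" by (auto simp: direct_sum_def)
    show "mact (direct_sum M N) a x = (\<Sum>(s, h)\<in>{..<n} \<times> carrier G. mscale (direct_sum M N) (a (s, h))
        (((\<lambda>(v, w). (Y v, Y' w)) ^^ s) (case x of (v, w) \<Rightarrow> (T h v, T' h w))))"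
      unfolding x(1) prod.case pow direct_sum_def amod.simps acts_byD(5)[OF M x(2)] acts_byD(5)[OF N x(3)]
      by (simp only: split_def sum fst_conv snd_conv)
  qed (auto simp: direct_sum_def acts_byD[OF M] acts_byD[OF N])
qed

lemma direct_sum_sel:
  "mcar (direct_sum M N) = mcar M \<times> mcar N"
  "mscale (direct_sum M N) c (v, w) = (mscale M c v, mscale N c w)"
  by (simp_all add: direct_sum_def)

text \<open>
  An isomorphism from \<open>V\<close> twisted by \<open>\<chi>\<^sup>-\<^sup>1\<close> to \<open>V'\<close>.
\<close>

definition twist_iso :: "('g, 'y) monoid_scheme \<Rightarrow> ('g \<Rightarrow> 'k::field) \<Rightarrow> ('g, 'k, 'v::ab_group_add) amod \<Rightarrow>
    ('g, 'k, 'w::ab_group_add) amod \<Rightarrow> ('v \<Rightarrow> 'w) \<Rightarrow> bool" where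
  "twist_iso G \<chi> V V' \<phi> \<longleftrightarrow> bij_betw \<phi> (mcar V) (mcar V') \<and>
     linear_between (mcar V) (mscale V) (mscale V') \<phi> \<and>
     (\<forall>h\<in>carrier G. \<forall>v\<in>mcar V. \<phi> (mscale V (inverse (\<chi> h)) (mact V (bvec h) v)) = mact V' (bvec h) (\<phi> v))"

lemma twist_isoD:
  assumes "twist_iso G \<chi> V V' \<phi>" "group_rep G V" "group_rep G V'"
  shows "bij_betw \<phi> (mcar V) (mcar V')" "v \<in> mcar V \<Longrightarrow> w \<in> mcar V \<Longrightarrow> \<phi> (v + w) = \<phi> v + \<phi> w"
    "v \<in> mcar V \<Longrightarrow> \<phi> (mscale V c v) = mscale V' c (\<phi> v)" "\<phi> 0 = 0"
    "v \<in> mcar V \<Longrightarrow> \<phi> v \<in> mcar V'"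
    "h \<in> carrier G \<Longrightarrow> v \<in> mcar V \<Longrightarrow>
       mscale V' (inverse (\<chi> h)) (\<phi> (mact V (bvec h) v)) = mact V' (bvec h) (\<phi> v)"
proof -
  have lin: "linear_between (mcar V) (mscale V) (mscale V') \<phi>" and b: "bij_betw \<phi> (mcar V) (mcar V')"
    and act: "\<And>h v. h \<in> carrier G \<Longrightarrow> v \<in> mcar V \<Longrightarrow>
      \<phi> (mscale V (inverse (\<chi> h)) (mact V (bvec h) v)) = mact V' (bvec h) (\<phi> v)"
    using assms(1) unfolding twist_iso_def by blast+
  note L = linear_betweenD[OF lin]
  show "bij_betw \<phi> (mcar V) (mcar V')" by (rule b)
  show "v \<in> mcar V \<Longrightarrow> w \<in> mcar V \<Longrightarrow> \<phi> (v + w) = \<phi> v + \<phi> w" by (rule L)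
  show "v \<in> mcar V \<Longrightarrow> \<phi> (mscale V c v) = mscale V' c (\<phi> v)" by (rule L)
  show "\<phi> 0 = 0" by (rule linear_between_zero[OF group_repD(1)[OF assms(2)] group_repD(1)[OF assms(3)] group_repD(2)[OF assms(2)] lin])
  show "v \<in> mcar V \<Longrightarrow> \<phi> v \<in> mcar V'" using b by (rule bij_betwE[rule_format])
  show "mscale V' (inverse (\<chi> h)) (\<phi> (mact V (bvec h) v)) = mact V' (bvec h) (\<phi> v)"
    if "h \<in> carrier G" "v \<in> mcar V"
    using act[OF that] group_repD(3)[OF assms(2) that] by (simp add: L)
qed

text \<open>
  With \<open>c = 0\<close> the strings are not linked, and the second one is \<open>M(V', j)\<close> up to the twist.
\<close>

lemma normal_form_split_iso:
  assumes dat: "nilpotent_datum G \<chi> g n" and V: "group_rep G V" and V': "group_rep G V'"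
    and \<phi>: "twist_iso G \<chi> V V' \<phi>" and j: "j \<le> n"
  shows "module_iso A (extension G \<chi> n (M_module G \<chi> n V j) (M_grp \<chi> V) (normal_Y V j 0))
    (direct_sum (M_module G \<chi> n V j) (M_module G \<chi> n V' j))"
proof -
  interpret V: vector_space "mscale V" using group_repD(1)[OF V] .
  interpret V': vector_space "mscale V'" using group_repD(1)[OF V'] .
  let ?M = "M_module G \<chi> n V j" and ?M' = "M_module G \<chi> n V' j"
  let ?X = "extension G \<chi> n ?M (M_grp \<chi> V) (normal_Y V j 0)"
  note rep = M_module_skew_rep[OF dat V j] and rep' = M_module_skew_rep[OF dat V' j]
  note car = M_module_mem[OF V] and car' = M_module_mem[OF V']
  note P = twist_isoD[OF \<phi> V V']
  let ?\<psi> = "the_inv_into (mcar V) \<phi>"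
  have psi: "?\<psi> w \<in> mcar V" "\<phi> (?\<psi> w) = w" if "w \<in> mcar V'" for w
    using that P(1) by (auto simp: f_the_inv_into_f_bij_betw intro: bij_betwE[OF bij_betw_the_inv_into, rule_format])
  have psiphi: "?\<psi> (\<phi> v) = v" if "v \<in> mcar V" for v
    using that P(1) by (simp add: the_inv_into_f_f bij_betw_def)
  have psi0: "?\<psi> 0 = 0" using psiphi[of 0] V.subspace_0[OF group_repD(2)[OF V]] by (simp add: P)
  show ?thesis
  proof (rule module_iso_acts_by[OF _ direct_sum_acts_by[OF skew_repD(1)[OF rep] skew_repD(1)[OF rep']],
        where f = "\<lambda>(u, w). (u, \<lambda>k. \<phi> (w k))"])
    show "acts_by G n ?X (\<lambda>h (u, w). (M_grp \<chi> V h u, mscale ?M (inverse (\<chi> h)) (M_grp \<chi> V h w))) (normal_Y V j 0)"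
      by (rule extension_acts_by[OF skew_repD(1)[OF rep]]) (rule normal_Y_closed[OF V refl])
    show "bij_betw (\<lambda>(u, w). (u, \<lambda>k. \<phi> (w k))) (mcar ?X) (mcar (direct_sum ?M ?M'))"
      unfolding extension_sel direct_sum_sel
      by (rule bij_betw_byWitness[where f' = "\<lambda>(u, w). (u, \<lambda>k. ?\<psi> (w k))"])
        (auto simp: car car' P psi psi0 psiphi)
    show "linear_between (mcar ?X) (mscale ?X) (mscale (direct_sum ?M ?M')) (\<lambda>(u, w). (u, \<lambda>k. \<phi> (w k)))"
      unfolding linear_between_def
      by (auto simp: extension_sel direct_sum_sel M_module_scale car P fun_eq_iff)
    show "(case case x of (u, w) \<Rightarrow> (M_grp \<chi> V h u, mscale ?M (inverse (\<chi> h)) (M_grp \<chi> V h w)) of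
         (u, w) \<Rightarrow> (u, \<lambda>k. \<phi> (w k))) =
      (case case x of (u, w) \<Rightarrow> (u, \<lambda>k. \<phi> (w k)) of (v, w) \<Rightarrow> (M_grp \<chi> V h v, M_grp \<chi> V' h w))"
      if h: "h \<in> carrier G" and x: "x \<in> mcar ?X" for h x
    proof -
      obtain u w where uw: "x = (u, w)" "w \<in> mcar ?M" using x by (auto simp: extension_sel)
      have "w k \<in> mcar V" for k using uw(2) by (simp add: car)
      then have "\<phi> (mscale V (inverse (\<chi> h)) (mscale V (inverse (\<chi> h) ^ k) (mact V (bvec h) (w k)))) =
         mscale V' (inverse (\<chi> h) ^ k) (mact V' (bvec h) (\<phi> (w k)))" for k
        using h by (simp add: P(3) group_repD(3)[OF V] P(6)[symmetric] mult.commute)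
      then show ?thesis by (simp add: uw(1) M_module_scale M_grp_def del: V.scale_scale)
    qed
    show "(case normal_Y V j 0 x of (u, w) \<Rightarrow> (u, \<lambda>k. \<phi> (w k))) =
      (case case x of (u, w) \<Rightarrow> (u, \<lambda>k. \<phi> (w k)) of (v, w) \<Rightarrow> (M_y j v, M_y j w))"
      if "x \<in> mcar ?X" for x
      by (cases x) (simp add: normal_Y_def M_y_def P fun_eq_iff)
  qed
qed

text \<open>
  With \<open>c \<noteq> 0\<close> the first string continues one step further, into the last entry of the second, and
  so becomes a string of length \<open>j + 1\<close>. The projection to this string is \<open>u + c\<^sup>-\<^sup>1 w\<close> with \<open>w\<close> shifted by one
  degree; the factor \<open>c\<^sup>-\<^sup>1\<close> makes the link between the strings an ordinary step. The complementary
  projection forgets the last entry of \<open>w\<close>, which leaves length \<open>j - 1\<close>.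
\<close>

lemma normal_form_regroup_iso:
  assumes dat: "nilpotent_datum G \<chi> g n" and V: "group_rep G V" and V': "group_rep G V'"
    and \<phi>: "twist_iso G \<chi> V V' \<phi>" and j: "1 \<le> j" "Suc j \<le> n" and c: "c \<noteq> 0"
  shows "module_iso A (extension G \<chi> n (M_module G \<chi> n V j) (M_grp \<chi> V) (normal_Y V j c))
    (direct_sum (M_module G \<chi> n V (j + 1)) (M_module G \<chi> n V' (j - 1)))"
proof -
  interpret V: vector_space "mscale V" using group_repD(1)[OF V] .
  interpret V': vector_space "mscale V'" using group_repD(1)[OF V'] .
  let ?M = "M_module G \<chi> n V j" and ?M1 = "M_module G \<chi> n V (j + 1)" and ?M2 = "M_module G \<chi> n V' (j - 1)"
  let ?X = "extension G \<chi> n ?M (M_grp \<chi> V) (normal_Y V j c)"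
  have j': "j \<le> n" "j + 1 \<le> n" "j - 1 \<le> n" using j by auto
  note rep = M_module_skew_rep[OF dat V j'(1)] and rep1 = M_module_skew_rep[OF dat V j'(2)]
    and rep2 = M_module_skew_rep[OF dat V' j'(3)]
  note car = M_module_mem[OF V] and car' = M_module_mem[OF V']
  note P = twist_isoD[OF \<phi> V V']
  note sub = V.subspace_add[OF group_repD(2)[OF V]] V.subspace_scale[OF group_repD(2)[OF V]]
    V.subspace_0[OF group_repD(2)[OF V]] V.subspace_diff[OF group_repD(2)[OF V]]
    V'.subspace_0[OF group_repD(2)[OF V']]
  note lin = group_rep_linear[OF V] and act = group_repD(3)[OF V]
  let ?\<psi> = "the_inv_into (mcar V) \<phi>"
  have psi: "?\<psi> w \<in> mcar V" "\<phi> (?\<psi> w) = w" if "w \<in> mcar V'" for w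
    using that P(1) by (auto simp: f_the_inv_into_f_bij_betw intro: bij_betwE[OF bij_betw_the_inv_into, rule_format])
  have psiphi: "?\<psi> (\<phi> v) = v" if "v \<in> mcar V" for v
    using that P(1) by (simp add: the_inv_into_f_f bij_betw_def)
  define S where "S = (\<lambda>(u :: nat \<Rightarrow> 'd, w :: nat \<Rightarrow> 'd).
    (\<lambda>k. u k + (if k = 0 then 0 else mscale V (inverse c) (w (k - 1))),
     \<lambda>k. if k < j - 1 then \<phi> (w k) else 0))"
  \<comment> \<open>The last entry of the second string is recovered from the top of the long string.\<close>
  define K where "K = (\<lambda>(f :: nat \<Rightarrow> 'd) f' k.
    if k < j - 1 then ?\<psi> (f' k) else if k < j then mscale V c (f j) else 0)"
  define S' where "S' = (\<lambda>(f, f').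
    (\<lambda>k. if k < j then f k - (if k = 0 then 0 else mscale V (inverse c) (K f f' (k - 1))) else 0, K f f'))"
  have KV: "K f f' k \<in> mcar V" if "f \<in> mcar ?M1" "f' \<in> mcar ?M2" for f f' k
    using that by (auto simp: K_def car car' psi sub)
  show ?thesis
  proof (rule module_iso_acts_by[OF _ direct_sum_acts_by[OF skew_repD(1)[OF rep1] skew_repD(1)[OF rep2]],
        where f = S])
    show "acts_by G n ?X (\<lambda>h (u, w). (M_grp \<chi> V h u, mscale ?M (inverse (\<chi> h)) (M_grp \<chi> V h w))) (normal_Y V j c)"
      by (rule extension_acts_by[OF skew_repD(1)[OF rep]]) (rule normal_Y_closed[OF V refl])
    show "bij_betw S (mcar ?X) (mcar (direct_sum ?M1 ?M2))"
      unfolding extension_sel direct_sum_sel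
    proof (rule bij_betw_byWitness[where f' = S'])
      show "S ` (mcar ?M \<times> mcar ?M) \<subseteq> mcar ?M1 \<times> mcar ?M2"
        using j by (auto simp: S_def car car' P sub)
      show "S' ` (mcar ?M1 \<times> mcar ?M2) \<subseteq> mcar ?M \<times> mcar ?M"
        by (auto simp: S'_def KV car sub) (auto simp: K_def)
      show "\<forall>x\<in>mcar ?M \<times> mcar ?M. S' (S x) = x"
      proof clarify
        fix u w assume u: "u \<in> mcar ?M" and w: "w \<in> mcar ?M"
        have K: "K (fst (S (u, w))) (snd (S (u, w))) = w"
        proof
          fix k
          consider "k < j - 1" | "k = j - 1" "k < j" | "j \<le> k" by linarith
          then show "K (fst (S (u, w))) (snd (S (u, w))) k = w k"
            using u w j c by cases (auto simp: S_def K_def car psiphi)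
        qed
        have "S' (S (u, w)) = (\<lambda>k. if k < j then fst (S (u, w)) k -
            (if k = 0 then 0 else mscale V (inverse c) (w (k - 1))) else 0, w)"
          by (subst prod.collapse[of "S (u, w)", symmetric]) (simp only: S'_def prod.case K)
        also have "\<dots> = (u, w)" using u by (auto simp: S_def car fun_eq_iff)
        finally show "S' (S (u, w)) = (u, w)" .
      qed
      show "\<forall>x\<in>mcar ?M1 \<times> mcar ?M2. S (S' x) = x"
      proof clarify
        fix f f' assume f: "f \<in> mcar ?M1" and f': "f' \<in> mcar ?M2"
        have 1: "fst (S (S' (f, f'))) k = f k" for k
        proof -
          consider "k < j" | "k = j" | "j < k" by linarith
          then show ?thesis
            using f j c by cases (auto simp: S_def S'_def K_def car)
        qed
        have 2: "snd (S (S' (f, f'))) k = f' k" for k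
          using f' by (auto simp: S_def S'_def K_def car' psi not_less)
        show "S (S' (f, f')) = (f, f')" using 1 2 by (simp add: prod_eq_iff fun_eq_iff)
      qed
    qed
    show "linear_between (mcar ?X) (mscale ?X) (mscale (direct_sum ?M1 ?M2)) S"
      unfolding linear_between_def
      by (auto simp: extension_sel direct_sum_sel M_module_scale car P fun_eq_iff S_def
          V.scale_right_distrib mult.commute)
    fix x assume x: "x \<in> mcar ?X"
    obtain u w where uw: "x = (u, w)" "u \<in> mcar ?M" "w \<in> mcar ?M" using x by (auto simp: extension_sel)
    have uV: "u k \<in> mcar V" "w k \<in> mcar V" for k using uw(2,3) by (auto simp: car)
    show "S (case x of (u, w) \<Rightarrow> (M_grp \<chi> V h u, mscale ?M (inverse (\<chi> h)) (M_grp \<chi> V h w))) =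
      (case S x of (v, w) \<Rightarrow> (M_grp \<chi> V h v, M_grp \<chi> V' h w))" if h: "h \<in> carrier G" for h
    proof -
      have 1: "mscale V (inverse (\<chi> h) ^ k) (mact V (bvec h) (u k)) +
          (if k = 0 then 0 else mscale V (inverse c) (mscale V (inverse (\<chi> h)) (mscale V (inverse (\<chi> h) ^ (k - 1)) (mact V (bvec h) (w (k - 1)))))) =
        mscale V (inverse (\<chi> h) ^ k) (mact V (bvec h) (u k + (if k = 0 then 0 else mscale V (inverse c) (w (k - 1)))))" for k
        using uV h by (cases k) (auto simp: lin sub V.scale_right_distrib mult_ac)
      have 2: "\<phi> (mscale V (inverse (\<chi> h)) (mscale V (inverse (\<chi> h) ^ k) (mact V (bvec h) (w k)))) =
         mscale V' (inverse (\<chi> h) ^ k) (mact V' (bvec h) (\<phi> (w k)))" for k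
        using uV h by (simp add: P(3) act P(6)[symmetric] mult.commute)
      show ?thesis
        unfolding uw(1) S_def prod.case M_grp_def M_module_scale 1 2
        using h by (auto simp: fun_eq_iff group_rep_linear[OF V'])
    qed
    show "S (normal_Y V j c x) = (case S x of (v, w) \<Rightarrow> (M_y (j + 1) v, M_y (j - 1) w))"
    proof -
      have 1: "fst (S (normal_Y V j c x)) k = M_y (j + 1) (fst (S x)) k" for k
      proof -
        consider "k = 0" | i where "k = Suc i" "k < j" | i where "k = Suc i" "k = j" | i where "k = Suc i" "j < k"
          by (cases k) (auto, meson linorder_neqE_nat)
        then show ?thesis
          using j c uw(2,3)
          by cases (auto simp: uw(1) S_def normal_Y_def M_y_def car V.scale_right_distrib)
      qed
      have 2: "snd (S (normal_Y V j c x)) k = M_y (j - 1) (snd (S x)) k" for k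
        using uV by (auto simp: uw(1) S_def normal_Y_def M_y_def P)
      show ?thesis using 1 2 by (simp add: prod_eq_iff fun_eq_iff split_def)
    qed
  qed
qed

text \<open>
  Tensoring with a one-dimensional module only twists: \<open>v \<mapsto> v \<otimes> 1\<close> is bijective with inverse
  \<open>v \<otimes> c \<mapsto> c v\<close>.
\<close>

lemma twist_iso_tensor:
  fixes G :: "('g, 'y) monoid_scheme" and \<chi> :: "'g \<Rightarrow> 'k::field"
    and V :: "('g, 'k, 'v::ab_group_add) amod" and V' :: "('g, 'k, 'w::ab_group_add) amod"
  defines "KG \<equiv> (group_algebra G :: ('g, 'k) bialg)" and "L \<equiv> char_module G (\<lambda>h. inverse (\<chi> h))"
  assumes fin: "finite (carrier G)" and V: "group_rep G V"
    and iso: "module_iso KG (tensor KG V L) V'"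
  shows "\<exists>\<phi>. twist_iso G \<chi> V V' \<phi>"
proof -
  interpret V: vector_space "mscale V" using group_repD(1)[OF V] .
  interpret L: vector_space "mscale L" by unfold_locales (auto simp: L_def char_module_def algebra_simps)
  let ?W = "tensor KG V L"
  interpret W: vector_space "mscale ?W" by (rule tensor_subspace)
  have carL: "mcar L = UNIV" and scL: "mscale L = (*)" by (simp_all add: L_def char_module_def)
  have subL: "module.subspace (mscale L) (mcar L)" by (simp add: carL L.subspace_UNIV)
  have actL: "mact L (bvec h) c = inverse (\<chi> h) * c" if "h \<in> carrier G" for h c
  proof -
    have "(\<Sum>h'\<in>carrier G. bvec h h' * inverse (\<chi> h')) = (\<Sum>h'\<in>carrier G. if h' = h then inverse (\<chi> h) else 0)"
      by (rule sum.cong) (auto simp: bvec_def)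
    then show ?thesis using that fin by (simp add: L_def char_module_def)
  qed
  note sub = V.subspace_scale[OF group_repD(2)[OF V]]
  have bil: "bilinear_between (mcar V) (mcar L) (mscale V) (mscale L) (mscale ?W) (pure_tensor V L)"
    by (rule pure_tensor_bilinear) (use group_repD[OF V] subL in \<open>auto intro: L.vector_space_axioms\<close>)
  have pl: "pure_tensor V L (v + v') c = pure_tensor V L v c + pure_tensor V L v' c"
    "pure_tensor V L (mscale V r v) c = mscale ?W r (pure_tensor V L v c)"
    "pure_tensor V L v (r * c) = mscale ?W r (pure_tensor V L v c)"
    if "v \<in> mcar V" "v' \<in> mcar V" for v v' r c
    using bil that unfolding bilinear_between_def linear_between_def carL scL by blast+
  have one: "pure_tensor V L v c = pure_tensor V L (mscale V c v) 1" if "v \<in> mcar V" for v c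
    using pl(3)[OF that that, of c 1] pl(2)[OF that that, of c 1] by simp
  obtain f where f: "linear_between (mcar ?W) (mscale ?W) (mscale V) f"
    and fp: "\<And>v c. v \<in> mcar V \<Longrightarrow> f (pure_tensor V L v c) = mscale V c v"
  proof -
    have "bilinear_between (mcar V) (mcar L) (mscale V) (mscale L) (mscale V) (\<lambda>v c. mscale V c v)"
      by (auto simp: bilinear_between_def linear_between_def scL V.scale_right_distrib V.scale_left_distrib mult.commute)
    from tensor_universal[OF V.vector_space_axioms this, of KG] show ?thesis using that carL by blast
  qed
  let ?i = "\<lambda>v. pure_tensor V L v 1"
  have i: "linear_between (mcar V) (mscale V) (mscale ?W) ?i"
    by (rule linear_betweenI) (simp_all only: pl)
  have iW: "?i v \<in> mcar ?W" if "v \<in> mcar V" for v using that by (intro pure_tensor_mem) (auto simp: carL)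
  have bf: "bij_betw f (mcar ?W) (mcar V)"
  proof (rule tensor_bij[OF V.vector_space_axioms group_repD(2)[OF V] f _ _ i iW])
    show "?i (f (pure_tensor V L v c)) = pure_tensor V L v c" if "v \<in> mcar V" for v c
      unfolding fp[OF that] by (rule one[OF that, symmetric])
  qed (auto simp: fp sub)
  have bi: "bij_betw ?i (mcar V) (mcar ?W)"
  proof (rule bij_betw_byWitness[where f' = f])
    show "\<forall>t\<in>mcar ?W. ?i (f t) = t"
    proof
      fix t assume t: "t \<in> mcar ?W"
      then have ft: "f t \<in> mcar V" using bf by (auto simp: bij_betw_def)
      then have "f (?i (f t)) = f t" by (simp add: fp)
      then show "?i (f t) = t" using bf t iW[OF ft] by (auto simp: bij_betw_def dest: inj_onD)
    qed
    show "f ` mcar ?W \<subseteq> mcar V" using bf by (auto simp: bij_betw_def)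
  qed (use iW fp in auto)
  have iact: "mact ?W (bvec h) (?i v) = ?i (mscale V (inverse (\<chi> h)) (mact V (bvec h) v))"
    if h: "h \<in> carrier G" and v: "v \<in> mcar V" for h v
  proof -
    have Bas: "Bas KG = carrier G" by (simp add: KG_def group_algebra_def)
    have "comult KG (bvec h) = bvec (h, h)"
    proof
      fix x
      have "comult KG (bvec h) x = (\<Sum>b\<in>carrier G. if b = h then bvec (h, h) x else 0)"
        unfolding comult_def Bas by (rule sum.cong) (auto simp: KG_def group_algebra_def bvec_def)
      then show "comult KG (bvec h) x = bvec (h, h) x" using fin h by simp
    qed
    then have "mact ?W (bvec h) (?i v) = tensor_map V L (mact V (bvec h)) (mact L (bvec h)) (?i v)"
      unfolding mact_tensor using fin h by (simp add: tensor_act_bvec Bas)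
    also have "\<dots> = pure_tensor V L (mact V (bvec h) v) (mact L (bvec h) 1)"
      by (rule tensor_map_pure)
        (use h group_repD(3,4)[OF V] in \<open>auto simp: carL linear_between_def actL scL algebra_simps\<close>)
    also have "\<dots> = ?i (mscale V (inverse (\<chi> h)) (mact V (bvec h) v))"
      using h v group_repD(3)[OF V h v] by (simp add: actL one)
    finally show ?thesis .
  qed
  obtain F where F: "bij_betw F (mcar ?W) (mcar V')" "linear_between (mcar ?W) (mscale ?W) (mscale V') F"
    "\<And>a v. a \<in> carrier (alg_ring KG) \<Longrightarrow> v \<in> mcar ?W \<Longrightarrow> F (mact ?W a v) = mact V' a (F v)"
    using iso unfolding module_iso_def by blast
  have "twist_iso G \<chi> V V' (\<lambda>v. F (?i v))"
    unfolding twist_iso_def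
  proof (intro conjI ballI)
    show "bij_betw (\<lambda>v. F (?i v)) (mcar V) (mcar V')"
      using bij_betw_trans[OF bi F(1)] by (simp add: o_def)
    show "linear_between (mcar V) (mscale V) (mscale V') (\<lambda>v. F (?i v))"
      by (rule linear_between_compose[OF i F(2)]) (use iW in auto)
    show "F (?i (mscale V (inverse (\<chi> h)) (mact V (bvec h) v))) = mact V' (bvec h) (F (?i v))"
      if "h \<in> carrier G" "v \<in> mcar V" for h v
      unfolding iact[OF that, symmetric]
      by (rule F(3)) (use that iW in \<open>auto simp: KG_def alg_ring_def group_algebra_def bvec_def\<close>)
  qed
  then show ?thesis by blast
qed

text \<open>
  Both tensor products have the normal form with defect \<open>[j]\<close> at \<open>p = q\<^sup>-\<^sup>1\<close>. As \<open>q\<close> has order \<open>n\<close>, the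
  defect vanishes for \<open>j = n\<close> and is invertible for \<open>1 \<le> j < n\<close>; this is the only difference between the
  two cases.
\<close>

theorem tensor_two_step_decomposition:
  assumes dat: "nilpotent_datum G \<chi> g n" and V: "group_rep G V" and V': "group_rep G V'"
    and \<phi>: "twist_iso G \<chi> V V' \<phi>" and E: "two_step G \<chi> n E TE YE e0 e1 c0 c1"
    and j: "1 \<le> j" "j \<le> n"
  defines "H \<equiv> nilp_hopf G \<chi> g n" and "M \<equiv> M_module G \<chi> n"
  shows "module_iso A (tensor H E (M V j)) (tensor H (M V j) E)"
    and "j < n \<Longrightarrow> module_iso A (tensor H (M V j) E) (direct_sum (M V (j + 1)) (M V' (j - 1)))"
    and "j = n \<Longrightarrow> module_iso A (tensor H (M V j) E) (direct_sum (M V n) (M V' n))"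
proof -
  note rep = M_module_skew_rep[OF dat V j(2)]
  define q where "q = \<chi> g"
  have q: "q \<noteq> 0" "q \<noteq> 1" "q ^ n = 1" "\<And>k. 0 < k \<Longrightarrow> k < n \<Longrightarrow> q ^ k \<noteq> 1"
  proof -
    have "\<And>k. 0 < k \<Longrightarrow> k < n \<Longrightarrow> q ^ k \<noteq> 1" "2 \<le> n"
      using dat by (auto simp: nilpotent_datum_def q_def)
    from this(1)[of 1] this show "q \<noteq> 1" "\<And>k. 0 < k \<Longrightarrow> k < n \<Longrightarrow> q ^ k \<noteq> 1" by auto
  qed (use dat in \<open>auto simp: nilpotent_datum_def linear_character_def q_def\<close>)
  let ?X = "extension G \<chi> n (M V j) (M_grp \<chi> V) (normal_Y V j (q_int (inverse q) j))"
  have right: "module_iso A (tensor H (M V j) E) ?X"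
    unfolding H_def M_def q_def
    by (rule module_iso_trans[OF tensor_right_iso[OF dat rep E] right_normal_form[OF dat V j]])
  have left: "module_iso A (tensor H E (M V j)) ?X"
    unfolding H_def M_def q_def
    by (rule module_iso_trans[OF tensor_left_iso[OF dat rep E] left_normal_form[OF dat V j]])
  show "module_iso A (tensor H E (M V j)) (tensor H (M V j) E)"
    by (rule module_iso_trans[OF left acts_by_iso_sym[OF right]])
      (unfold H_def M_def, rule tensor_acts_by[OF dat rep two_stepD(1)[OF E]])
  have zero: "q_int (inverse q) j = 0 \<longleftrightarrow> q ^ j = 1"
    using q(1,2) by (subst q_int_eq_0_iff) (auto simp: power_inverse)
  show "module_iso A (tensor H (M V j) E) (direct_sum (M V (j + 1)) (M V' (j - 1)))" if "j < n"
  proof -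
    have "q_int (inverse q) j \<noteq> 0" using zero q(4) that j by simp
    with that j show ?thesis
      unfolding M_def by (intro module_iso_trans[OF right[unfolded M_def] normal_form_regroup_iso[OF dat V V' \<phi>]]) auto
  qed
  show "module_iso A (tensor H (M V j) E) (direct_sum (M V n) (M V' n))" if "j = n"
  proof -
    have "q_int (inverse q) j = 0" using zero q(3) that by simp
    then show ?thesis
      using module_iso_trans[OF right[unfolded M_def] normal_form_split_iso[OF dat V V' \<phi> j(2), folded \<open>q_int (inverse q) j = 0\<close>]] that
      by (simp add: M_def)
  qed
qed

section \<open>The decomposition for the simple modules\<close>

theorem proposition3p6:
  fixes G :: "('g, 'y) monoid_scheme"
    and \<chi> :: "'g \<Rightarrow> 'k::{alg_closed_field, field_char_0}"
    and g :: 'g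
    and n m :: nat
    and V :: "nat \<Rightarrow> ('g, 'k, 'v::ab_group_add) amod"
    and \<tau> :: "nat \<Rightarrow> nat"
  defines "KG \<equiv> (group_algebra G :: ('g, 'k) bialg)"
    and "H \<equiv> nilp_hopf G \<chi> g n"
    and "M \<equiv> (\<lambda>i j. M_module G \<chi> n (V i) j)"
    and "V\<chi>' \<equiv> char_module G (\<lambda>h. inverse (\<chi> h))"
  assumes datum: "nilpotent_datum G \<chi> g n"
    and simples: "complete_simples G m V"
    and trivial: "1 \<le> m" "module_iso KG (V 1) (char_module G (\<lambda>h. 1))"
    and tau: "\<tau> permutes {1..m}"
      "\<forall>i\<in>{1..m}. module_iso KG (tensor KG V\<chi>' (V i)) (tensor KG (V i) V\<chi>') \<and>
                  module_iso KG (tensor KG (V i) V\<chi>') (V (\<tau> i))"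
  shows "\<forall>i\<in>{1..m}.
      (\<forall>j. 2 \<le> j \<and> j \<le> n - 1 \<longrightarrow>
         module_iso H (tensor H (M 1 2) (M i j)) (tensor H (M i j) (M 1 2)) \<and>
         module_iso H (tensor H (M i j) (M 1 2)) (direct_sum (M i (j + 1)) (M (\<tau> i) (j - 1)))) \<and>
      module_iso H (tensor H (M 1 2) (M i n)) (tensor H (M i n) (M 1 2)) \<and>
      module_iso H (tensor H (M i n) (M 1 2)) (direct_sum (M i n) (M (\<tau> i) n))"
proof
  have G: "group G" and fin: "finite (carrier G)" and n: "2 \<le> n"
    using datum by (auto simp: nilpotent_datum_def)
  have rep: "group_rep G (V i)" if "i \<in> {1..m}" for i
  proof -
    have "simple_module (group_algebra G :: ('g, 'k) bialg) (V i)"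
      using simples that unfolding complete_simples_def by (elim conjE) (rule bspec)
    then show ?thesis unfolding simple_module_def by (elim conjE) (rule fin_module_group_rep[OF _ G fin])
  qed
  have V1: "group_rep G (V 1)" using trivial(1) by (intro rep) simp
  obtain \<kappa> where \<kappa>: "bij_betw \<kappa> (mcar (V 1)) UNIV" "linear_between (mcar (V 1)) (mscale (V 1)) (*) \<kappa>"
    and \<kappa>_act: "\<And>a v. a \<in> carrier (alg_ring KG) \<Longrightarrow> v \<in> mcar (V 1) \<Longrightarrow>
      \<kappa> (mact (V 1) a v) = (\<Sum>h\<in>carrier G. a h * 1) * \<kappa> v"
    using trivial(2) unfolding module_iso_def char_module_def amod.simps by blast
  have \<kappa>_inv: "\<kappa> (mact (V 1) (bvec h) v) = \<kappa> v" if "h \<in> carrier G" "v \<in> mcar (V 1)" for h v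
  proof -
    have "(\<Sum>h'\<in>carrier G. bvec h h' * 1) = (1 :: 'k)" using that fin by (simp add: bvec_def)
    moreover have "bvec h \<in> carrier (alg_ring KG)"
      using that by (auto simp: KG_def alg_ring_def group_algebra_def bvec_def)
    ultimately show ?thesis using \<kappa>_act that by simp
  qed
  obtain e0 e1 c0 c1 where E: "two_step G \<chi> n (M_module G \<chi> n (V 1) 2) (M_grp \<chi> (V 1)) (M_y 2) e0 e1 c0 c1"
    using two_step_M_module[OF datum V1 \<kappa> \<kappa>_inv] by blast
  fix i assume i: "i \<in> {1..m}"
  have \<tau>i: "\<tau> i \<in> {1..m}" using permutes_in_image[OF tau(1)] i by simp
  \<comment> \<open>The isomorphism that defines \<open>\<tau>\<close> turns the twist of \<open>V i\<close> into \<open>V (\<tau> i)\<close>.\<close>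
  obtain \<phi> where \<phi>: "twist_iso G \<chi> (V i) (V (\<tau> i)) \<phi>"
  proof -
    have "module_iso KG (tensor KG (V i) V\<chi>') (V (\<tau> i))" using tau(2) i by simp
    from twist_iso_tensor[OF fin rep[OF i] this[unfolded KG_def V\<chi>'_def]] that show ?thesis by blast
  qed
  note iso = tensor_two_step_decomposition[OF datum rep[OF i] rep[OF \<tau>i] \<phi> E]
  show "(\<forall>j. 2 \<le> j \<and> j \<le> n - 1 \<longrightarrow>
         module_iso H (tensor H (M 1 2) (M i j)) (tensor H (M i j) (M 1 2)) \<and>
         module_iso H (tensor H (M i j) (M 1 2)) (direct_sum (M i (j + 1)) (M (\<tau> i) (j - 1)))) \<and>
      module_iso H (tensor H (M 1 2) (M i n)) (tensor H (M i n) (M 1 2)) \<and>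
      module_iso H (tensor H (M i n) (M 1 2)) (direct_sum (M i n) (M (\<tau> i) n))"
    unfolding H_def M_def using n by (intro conjI allI impI iso) auto
qed

end
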